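(* Let $q\ge 3$ be odd and let $p$ be a positive integer with $p<q$, $(p,q)=1$. Let $\Delta_j$ denote the length of the $j$-th gap of $S(p/q)$ and $w_j$ the length of the part of the $j$-th band $B_j$ of $S(p/q)$ lying to the right of $\lambda_j$ (see context). Put $C_0=1+\frac{2e}{\sqrt5-1}=5.398\dots$. Then $$\Delta_0>\left(\frac{w_0}{4}\right)^2,\qquad \Delta_j>\frac{w_j^2}{4C_0^{2(j+1)}}\quad\text{for } 1\le j<\frac{q-1}{2},$$ $$\Delta_j>\left(\frac{w_0}{8}\right)^{2j}\quad\text{for } 1\le j<\frac{q-1}{2}.$$
   Context: For $\alpha,\theta\in(0,1]$ let $H_{\alpha,\theta}$ be the self-adjoint operator on $l^2(\mathbb{Z})$ given by $(H_{\alpha,\theta}\phi)(n)=\phi(n-1)+\phi(n+1)+2\cos(2\pi(\alpha n+\theta))\,\phi(n)$. Let $S(\alpha)$ be the union over all $\theta\in(0,1]$ of the spectra of $H_{\alpha,\theta}$. For $\alpha=p/q$ with $(p,q)=1$, the discriminant is the polynomial of degree $q$ $$\sigma(E)=-\operatorname{tr}\left\{\begin{pmatrix}E-2\cos(2\pi p/q+\frac{\pi}{2q})&-1\\1&0\end{pmatrix}\begin{pmatrix}E-2\cos(2\pi\cdot 2p/q+\frac{\pi}{2q})&-1\\1&0\end{pmatrix}\cdots\begin{pmatrix}E-2\cos(2\pi qp/q+\frac{\pi}{2q})&-1\\1&0\end{pmatrix}\right\},$$ and $S(p/q)=\sigma^{-1}([-4,4])$. One has $\sigma(E)=(-1)^q\sigma(-E)$,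 so $S(p/q)$ is symmetric about $0$. For $q$ odd, $S(p/q)$ consists of $q$ disjoint closed intervals (bands) separated by $q-1$ nonempty open intervals (gaps), and each band contains exactly one zero of $\sigma$. Let $q$ be odd. Number the bands $B_j$ from left to right, $j=-(q-1)/2,\dots,(q-1)/2$. Let $\lambda_j$ be the zero of $\sigma$ in $B_j$ (so $\lambda_0=0$). Let $\mu_j,\eta_j$ be the edges of $B_j$, labelled as follows: if $q\equiv 3 \pmod 4$, $\sigma(\mu_j)=4$ and $\sigma(\eta_j)=-4$ for all $j$; if $q\equiv1\pmod 4$, $\sigma(\mu_j)=-4$ and $\sigma(\eta_j)=4$ for all $j$. Then $B_j=[\eta_j,\mu_j]$ for $|j|$ even and $B_j=[\mu_j,\eta_j]$ for $|j|$ odd. Put $w_j=\mu_j-\lambda_j$ for $|j|$ even and $w_j=\eta_j-\lambda_j$ for $|j|$ odd (so $w_j$ is the distance from $\lambda_j$ to the right edge of $B_j$). The gaps $G_j$, $-(q-1)/2\le j<(q-1)/2$, and their lengths $\Delta_j$ are: $G_j=(\mu_j,\mu_{j+1})$, $\Delta_j=\mu_{j+1}-\mu_j$ for $|j|$ even; $G_j=(\eta_j,\eta_{j+1})$, $\Delta_j=\eta_{j+1}-\eta_j$ for $|j|$ odd (so $G_j$ is the gap between $B_j$ and $B_{j+1}$). *)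

theory Defs
  imports "HOL-Analysis.Analysis"
begin

definition l2 :: "(int \<Rightarrow> complex) set" where
  "l2 = {\<phi>. (\<lambda>n. (cmod (\<phi> n))\<^sup>2) summable_on UNIV}"

definition l2_norm :: "(int \<Rightarrow> complex) \<Rightarrow> real" where
  "l2_norm \<phi> = sqrt (\<Sum>\<^sub>\<infinity>n. (cmod (\<phi> n))\<^sup>2)"

(* The set of z for which T - z has no bounded two-sided inverse on l2.  For a linear T that maps
   l2 into l2, such an R is automatically linear, so linearity need not be required. *)
definition l2_spectrum :: "((int \<Rightarrow> complex) \<Rightarrow> (int \<Rightarrow> complex)) \<Rightarrow> complex set" where
  "l2_spectrum T = {z. \<not> (\<exists>R.
      (\<forall>\<phi>\<in>l2. R \<phi> \<in> l2) \<and>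
      (\<forall>\<phi>\<in>l2. (\<lambda>n. T (R \<phi>) n - z * R \<phi> n) = \<phi>) \<and>
      (\<forall>\<phi>\<in>l2. R (\<lambda>n. T \<phi> n - z * \<phi> n) = \<phi>) \<and>
      (\<exists>C. \<forall>\<phi>\<in>l2. l2_norm (R \<phi>) \<le> C * l2_norm \<phi>))}"

definition almost_mathieu :: "real \<Rightarrow> real \<Rightarrow> (int \<Rightarrow> complex) \<Rightarrow> (int \<Rightarrow> complex)" where
  "almost_mathieu \<alpha> \<theta> \<phi> =
     (\<lambda>n. \<phi> (n - 1) + \<phi> (n + 1) + of_real (2 * cos (2 * pi * (\<alpha> * of_int n + \<theta>))) * \<phi> n)"

(* The operators are bounded and self-adjoint, so their spectra are real; hence the union of the
   spectra is represented as a set of reals. *)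
definition spec_union :: "real \<Rightarrow> real set" where
  "spec_union \<alpha> =
     {E. \<exists>\<theta>\<in>{0<..1}. complex_of_real E \<in> l2_spectrum (almost_mathieu \<alpha> \<theta>)}"

definition transfer_matrix :: "nat \<Rightarrow> nat \<Rightarrow> real \<Rightarrow> nat \<Rightarrow> real^2^2" where
  "transfer_matrix p q E k =
     vector [vector [E - 2 * cos (2 * pi * real (k * p) / real q + pi / (2 * real q)), -1],
             vector [1, 0]]"

definition discriminant :: "nat \<Rightarrow> nat \<Rightarrow> real \<Rightarrow> real" where
  "discriminant p q E = - trace (foldr (**) (map (transfer_matrix p q E) [1..<q+1]) (mat 1))"

(* The bands of S(p/q) for q odd, numbered from left to right by
   j = -(q-1)/2, ..., (q-1)/2: the band B_j has exactly j + (q-1)/2 bands to its left. *)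
definition band :: "nat \<Rightarrow> nat \<Rightarrow> int \<Rightarrow> real set" where
  "band p q j = (let \<B> = components (spec_union (real p / real q)) in
     THE B. B \<in> \<B> \<and>
       finite {B' \<in> \<B>. Sup B' < Inf B} \<and>
       int (card {B' \<in> \<B>. Sup B' < Inf B}) = j + int ((q - 1) div 2))"

definition band_zero :: "nat \<Rightarrow> nat \<Rightarrow> int \<Rightarrow> real" where
  "band_zero p q j = (THE x. x \<in> band p q j \<and> discriminant p q x = 0)"

(* band_mu and band_eta are the two edges (frontier points) of B_j, told apart by the value of the
   discriminant there; q is meant to be odd, so that q mod 4 is 1 or 3. *)
definition band_mu :: "nat \<Rightarrow> nat \<Rightarrow> int \<Rightarrow> real" where
  "band_mu p q j = (THE x. x \<in> frontier (band p q j) \<and>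
     discriminant p q x = (if q mod 4 = 3 then 4 else -4))"

definition band_eta :: "nat \<Rightarrow> nat \<Rightarrow> int \<Rightarrow> real" where
  "band_eta p q j = (THE x. x \<in> frontier (band p q j) \<and>
     discriminant p q x = (if q mod 4 = 3 then -4 else 4))"

definition band_w :: "nat \<Rightarrow> nat \<Rightarrow> int \<Rightarrow> real" where
  "band_w p q j =
     (if even \<bar>j\<bar> then band_mu p q j - band_zero p q j else band_eta p q j - band_zero p q j)"

definition gap_length :: "nat \<Rightarrow> nat \<Rightarrow> int \<Rightarrow> real" where
  "gap_length p q j =
     (if even \<bar>j\<bar> then band_mu p q (j + 1) - band_mu p q j
      else band_eta p q (j + 1) - band_eta p q j)"

definition C0 :: real where
  "C0 = 1 + 2 * exp 1 / (sqrt 5 - 1)"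

end

theory Submission
  imports Defs "HOL-Computational_Algebra.Fundamental_Theorem_Algebra"
begin

text \<open>
  Let \<open>f = - \<sigma>\<close>. By Chambers' formula the trace of the transfer matrix at phase \<open>\<theta>\<close> is
  \<open>f(E) - 2 cos (2\<pi>q\<theta>)\<close>, so the union of the spectra is \<open>{|f| \<le> 4}\<close>, and every level \<open>c\<close> with \<open>|c| \<le> 4\<close>
  has \<open>q\<close> real roots, the eigenvalues of a Hermitian operator \<open>H = U + U\<^sup>* + V + V\<^sup>*\<close> on \<open>\<complex>\<^sup>q\<close>.

  The decisive point is that \<open>|f'| \<ge> q\<close> on the spectrum. With \<open>q = 2N + 1\<close>, the trace of \<open>H\<^sup>k\<close> against
  the Weyl operator of \<open>(N, N)\<close> vanishes for \<open>k < 2N\<close>, because that point has \<open>\<ell>\<^sup>1\<close>-distance \<open>2N\<close> from the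
  origin of the torus \<open>\<int>\<^sub>q\<^sup>2\<close>, and for \<open>k = 2N\<close> it is \<open>q\<close> times the Gaussian binomial coefficient of \<open>2N\<close>
  over \<open>N\<close> at a primitive \<open>q\<close>-th root of unity, which has modulus \<open>1\<close>. Expanding in eigenvectors, one
  reads off the value \<open>\<Prod>\<^sub>l\<^sub>\<noteq>\<^sub>i (e\<^sub>i - e\<^sub>l) = f'(e\<^sub>i)\<close>.

  At a gap edge \<open>f'\<close> is the gap length times the product of the distances to the remaining edges on the
  same level. This product is compared with the product of the distances from \<open>0\<close> or from \<open>\<lambda>\<^sub>j\<close> to these
  edges, which is \<open>4\<close>; by the symmetry of the spectrum almost all factors cancel in pairs.
\<close>

subsection \<open>Transfer matrices and Chambers' formula\<close>

text \<open>Why the point \<open>(N, N)\<close>: a polynomial that isolates one of \<open>q\<close>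
  eigenvalues has degree \<open>q - 1\<close>, so the test operator must annihilate all lower powers
  of \<open>H\<close>. For odd \<open>q\<close> the torus has a point at distance exactly
  \<open>q - 1\<close>, where only the top coefficient of the polynomial survives. Diagonal entries
  of a Weyl operator in unit eigenvectors have modulus at most \<open>1\<close>, whence the bound
  \<open>q\<close>; the gap estimates draw on \<open>1 \<le> |f'|\<close>. Bands and edges are
  defined through components of the true spectrum on the line. Hence truncated Bloch waves are
  needed to put the level set into the spectrum, and a Green function to invert the operator off it.
  Constants: \<open>4\<close> is the value of \<open>|f|\<close> at every edge. At most
  \<open>2(j + 1)\<close> edges remain unpaired in the gap estimate. Seen from the zero of the band,
  each costs at most \<open>C0\<close>, because \<open>C0 - 1\<close> bounds the ratio of the right
  part of a band to its left part. Seen from \<open>0\<close>, those left of the mirror image of the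
  gap edge cost \<open>2\<close> each; the others cost \<open>2\<alpha> / w\<close>, with
  \<open>w\<close> half the central band, and \<open>\<alpha> \<le> 4\<close> turns this into
  \<open>w / 8\<close>.\<close>

definition tmat :: "'a::comm_ring_1 \<Rightarrow> 'a^2^2" where
  "tmat a = vector [vector [a, -1], vector [1, 0]]"

definition tprod :: "'a::comm_ring_1 list \<Rightarrow> 'a^2^2" where
  "tprod xs = foldr (**) (map tmat xs) (mat 1)"

lemma tmat_mult_nth [simp]:
  "(tmat a ** M) $ 1 $ j = a * M $ 1 $ j - M $ 2 $ j"
  "(tmat a ** M) $ 2 $ j = M $ 1 $ j"
  by (simp_all add: matrix_matrix_mult_def sum_2 tmat_def)

lemma tprod_Nil [simp]: "tprod [] = mat 1"
  and tprod_Cons [simp]: "tprod (x # xs) = tmat x ** tprod xs"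
  by (simp_all add: tprod_def)

lemma tprod_append: "tprod (xs @ ys) = tprod xs ** tprod ys"
  by (induction xs) (simp_all add: matrix_mul_assoc)

lemma mat_1_nth_2 [simp]:
  "(mat 1 :: 'a::comm_ring_1^2^2) $ 1 $ 1 = 1" "(mat 1 :: 'a^2^2) $ 1 $ 2 = 0"
  "(mat 1 :: 'a^2^2) $ 2 $ 1 = 0" "(mat 1 :: 'a^2^2) $ 2 $ 2 = 1"
  by (simp_all add: mat_def)

lemma trace_2: "trace (M :: 'a::comm_ring_1^2^2) = M $ 1 $ 1 + M $ 2 $ 2"
  by (simp add: trace_def sum_2)

lemma det_tprod: "det (tprod xs) = 1"
proof (induction xs)
  case (Cons x xs)
  then show ?case by (simp add: det_2 algebra_simps)
qed (simp add: det_2)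

lemma trace_tprod_rotate1: "trace (tprod (xs @ [x])) = trace (tprod (x # xs))"
  using trace_mul_sym[of "tprod xs" "tprod [x]"] tprod_append[of "[x]" xs] tprod_append[of xs "[x]"]
  by (simp only: append.simps)

lemma tprod_hom:
  fixes h :: "'a::comm_ring_1 \<Rightarrow> 'b::comm_ring_1"
  assumes "\<And>x y. h (x * y) = h x * h y" "\<And>x y. h (x - y) = h x - h y" "h 0 = 0" "h 1 = 1"
  shows "tprod (map h xs) $ i $ j = h (tprod xs $ i $ j)"
proof -
  have "\<forall>i j. tprod (map h xs) $ i $ j = h (tprod xs $ i $ j)"
    by (induction xs) (simp_all add: forall_2 assms)
  then show ?thesis by simp
qed

lemma trace_tprod_hom:
  fixes h :: "'a::comm_ring_1 \<Rightarrow> 'b::comm_ring_1"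
  assumes "\<And>x y. h (x * y) = h x * h y" "\<And>x y. h (x - y) = h x - h y" "h 0 = 0" "h 1 = 1"
    "\<And>x y. h (x + y) = h x + h y"
  shows "trace (tprod (map h xs)) = h (trace (tprod xs))"
  by (simp add: trace_2 tprod_hom[where h = h] assms)

text \<open>With \<open>D = diag(1, -1)\<close> one has \<open>tmat (- a) = - D (tmat a) D\<close>,
  so negating all entries conjugates the product by \<open>D\<close> up to the sign.\<close>

lemma trace_tprod_uminus:
  "trace (tprod (map uminus xs)) = (-1) ^ length xs * trace (tprod xs)"
proof -
  have "tprod (map uminus xs) $ 1 $ 1 = (-1) ^ length xs * tprod xs $ 1 $ 1 \<and>
    tprod (map uminus xs) $ 2 $ 1 = - ((-1) ^ length xs) * tprod xs $ 2 $ 1 \<and>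
    tprod (map uminus xs) $ 1 $ 2 = - ((-1) ^ length xs) * tprod xs $ 1 $ 2 \<and>
    tprod (map uminus xs) $ 2 $ 2 = (-1) ^ length xs * tprod xs $ 2 $ 2"
    by (induction xs) (simp_all add: algebra_simps)
  then show ?thesis by (simp add: trace_2 algebra_simps)
qed



text \<open>Each factor is a Laurent polynomial in \<open>t\<close> of span \<open>-1..1\<close>, so
  \<open>t ^ n\<close> clears the denominators of a product of \<open>n\<close> factors. The extreme
  powers arise only when every factor contributes its corner entry, that is, in the entry (1,1). The
  guard \<open>ks \<noteq> []\<close> is for the empty product, whose entry (2,2) is
  \<open>1\<close>.\<close>

lemma tprod_Laurent:
  fixes E :: complex and w :: "nat \<Rightarrow> complex"
  assumes "\<And>k. w k \<noteq> 0"
  defines "M \<equiv> \<lambda>ks t. tprod (map (\<lambda>k. E - t * w k - inverse (t * w k)) ks)"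
  shows "\<exists>P11 P12 P21 P22 :: complex poly.
    (\<forall>t. t \<noteq> 0 \<longrightarrow> t ^ length ks * M ks t $ 1 $ 1 = poly P11 t \<and> t ^ length ks * M ks t $ 1 $ 2 = poly P12 t \<and>
      t ^ length ks * M ks t $ 2 $ 1 = poly P21 t \<and> t ^ length ks * M ks t $ 2 $ 2 = poly P22 t) \<and>
    (\<forall>m>2 * length ks. coeff P11 m = 0 \<and> coeff P12 m = 0 \<and> coeff P21 m = 0 \<and> coeff P22 m = 0) \<and>
    coeff P21 0 = 0 \<and> coeff P21 (2 * length ks) = 0 \<and>
    (ks \<noteq> [] \<longrightarrow> coeff P22 0 = 0 \<and> coeff P22 (2 * length ks) = 0) \<and>
    coeff P11 0 = (\<Prod>k\<leftarrow>ks. - inverse (w k)) \<and> coeff P11 (2 * length ks) = (\<Prod>k\<leftarrow>ks. - w k)"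
proof (induction ks)
  case Nil
  show ?case
    by (rule exI[of _ 1], rule exI[of _ 0], rule exI[of _ 0], rule exI[of _ 1]) (auto simp: M_def)
next
  case (Cons k ks)
  define n where "n = length ks"
  from Cons obtain P11 P12 P21 P22 where
    ev: "\<And>t. t \<noteq> 0 \<Longrightarrow> t ^ n * M ks t $ 1 $ 1 = poly P11 t" "\<And>t. t \<noteq> 0 \<Longrightarrow> t ^ n * M ks t $ 1 $ 2 = poly P12 t"
      "\<And>t. t \<noteq> 0 \<Longrightarrow> t ^ n * M ks t $ 2 $ 1 = poly P21 t" "\<And>t. t \<noteq> 0 \<Longrightarrow> t ^ n * M ks t $ 2 $ 2 = poly P22 t"
    and hi: "\<And>m. m > 2 * n \<Longrightarrow> coeff P11 m = 0" "\<And>m. m > 2 * n \<Longrightarrow> coeff P12 m = 0"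
      "\<And>m. m > 2 * n \<Longrightarrow> coeff P21 m = 0" "\<And>m. m > 2 * n \<Longrightarrow> coeff P22 m = 0"
    and z: "coeff P21 0 = 0" "coeff P21 (2 * n) = 0"
    and lead: "coeff P11 0 = (\<Prod>k\<leftarrow>ks. - inverse (w k))" "coeff P11 (2 * n) = (\<Prod>k\<leftarrow>ks. - w k)"
    unfolding n_def by blast
  define A where "A = (\<lambda>P. smult (- inverse (w k)) P + pCons 0 (smult E P) + pCons 0 (pCons 0 (smult (- w k) P)))"
  have M: "M (k # ks) t = tmat (E - t * w k - inverse (t * w k)) ** M ks t" for t
    by (simp add: M_def)
  have A: "poly (A P) t = t * (E - t * w k - inverse (t * w k)) * poly P t" if "t \<noteq> 0" for t P
    using that assms(1)[of k] by (simp add: A_def field_simps)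
  have cA: "coeff (A P) (Suc (Suc m)) = - inverse (w k) * coeff P (Suc (Suc m)) + E * coeff P (Suc m) - w k * coeff P m"
    "coeff (A P) 0 = - inverse (w k) * coeff P 0" for P m
    by (simp_all add: A_def)
  show ?case
  proof (rule exI[of _ "A P11 - pCons 0 P21"], rule exI[of _ "A P12 - pCons 0 P22"],
      rule exI[of _ "pCons 0 P11"], rule exI[of _ "pCons 0 P12"], intro conjI allI impI)
    fix t :: complex assume t: "t \<noteq> 0"
    show "t ^ length (k # ks) * M (k # ks) t $ 1 $ 1 = poly (A P11 - pCons 0 P21) t"
      "t ^ length (k # ks) * M (k # ks) t $ 1 $ 2 = poly (A P12 - pCons 0 P22) t"
      "t ^ length (k # ks) * M (k # ks) t $ 2 $ 1 = poly (pCons 0 P11) t"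
      "t ^ length (k # ks) * M (k # ks) t $ 2 $ 2 = poly (pCons 0 P12) t"
      by (simp_all add: M A t ev[OF t, symmetric] n_def[symmetric] algebra_simps)
  next
    fix m assume "m > 2 * length (k # ks)"
    then obtain m' where m': "m = Suc (Suc m')" "m' > 2 * n"
      by (cases m; cases "m - 1") (auto simp: n_def)
    show "coeff (A P11 - pCons 0 P21) m = 0" "coeff (A P12 - pCons 0 P22) m = 0"
      "coeff (pCons 0 P11) m = 0" "coeff (pCons 0 P12) m = 0"
      using hi[OF m'(2)] hi[OF less_SucI[OF m'(2)]] hi[OF less_SucI[OF less_SucI[OF m'(2)]]] by (simp_all add: m'(1) cA)
  next
    have ln: "2 * length (k # ks) = Suc (Suc (2 * n))" by (simp add: n_def)
    show "coeff (pCons 0 P11) 0 = 0" "coeff (pCons 0 P12) 0 = 0" by simp_all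
    show "coeff (pCons 0 P11) (2 * length (k # ks)) = 0" "coeff (pCons 0 P12) (2 * length (k # ks)) = 0"
      unfolding ln using hi[of "Suc (2 * n)"] by simp_all
    show "coeff (A P11 - pCons 0 P21) 0 = (\<Prod>k\<leftarrow>k # ks. - inverse (w k))"
      using lead(1) z by (simp add: cA)
    show "coeff (A P11 - pCons 0 P21) (2 * length (k # ks)) = (\<Prod>k\<leftarrow>k # ks. - w k)"
      unfolding ln using lead(2) hi[of "Suc (2 * n)"] hi[of "Suc (Suc (2 * n))"] by (simp add: cA)
  qed
qed

text \<open>The exponents add up to \<open>q (q + 1) / 2\<close>, a multiple of \<open>q\<close>
  because \<open>q\<close> is odd; only the sign is left. This evaluates both extreme Laurent
  coefficients.\<close>

lemma prod_list_root_of_unity: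
  fixes \<omega> :: "'a::field"
  assumes "\<omega> ^ q = 1" "odd q"
  shows "(\<Prod>k\<leftarrow>[1..<q+1]. - (\<omega> ^ k)) = -1"
proof -
  have "(\<Prod>k\<leftarrow>[1..<n+1]. - (\<omega> ^ k)) = (-1) ^ n * \<omega> ^ (\<Sum>k=1..n. k)" for n
    by (induction n) (simp_all add: power_add algebra_simps)
  moreover obtain m where m: "q = 2 * m + 1" using assms(2) by (elim oddE)
  then have "(\<Sum>k=1..q. k) = q * (m + 1)"
    using Sum_Icc_nat[of 1 q] by simp
  ultimately have "(\<Prod>k\<leftarrow>[1..<q+1]. - (\<omega> ^ k)) = (-1) ^ q * \<omega> ^ (q * (m + 1))"
    by (metis (no_types))
  also have "\<dots> = -1" using assms by (simp only: power_mult) simp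
  finally show ?thesis .
qed

text \<open>Replacing \<open>t\<close> by \<open>\<omega> t\<close> rotates the factors cyclically
  and preserves the trace. So in the polynomial \<open>t ^ q * X t\<close> of degree at most
  \<open>2q\<close> only the exponents \<open>0\<close>, \<open>q\<close>, \<open>2q\<close>
  survive, and the outer two coefficients do not involve \<open>E\<close>.\<close>

theorem Chambers:
  fixes E \<omega> :: complex
  assumes "odd q" and \<omega>: "\<And>n. \<omega> ^ n = 1 \<longleftrightarrow> q dvd n"
  defines "X \<equiv> \<lambda>t. trace (tprod (map (\<lambda>k. E - t * \<omega> ^ k - inverse (t * \<omega> ^ k)) [1..<q+1]))"
  shows "\<exists>g. \<forall>t. t \<noteq> 0 \<longrightarrow> X t = g - t ^ q - inverse (t ^ q)"
proof -
  have q: "q > 0" using assms(1) by (auto elim: oddE)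
  have wq: "\<omega> ^ q = 1" using \<omega> by simp
  have w0: "\<omega> \<noteq> 0" using wq q by (auto simp: zero_power)
  define ks where "ks = [1..<q+1]"
  have ks: "length ks = q" "ks \<noteq> []" using q by (simp_all add: ks_def)
  obtain P11 P22 where
    ev: "\<And>t. t \<noteq> 0 \<Longrightarrow> t ^ q * X t = poly (P11 + P22) t"
    and hi: "\<And>m. m > 2 * q \<Longrightarrow> coeff (P11 + P22) m = 0"
    and c0: "coeff (P11 + P22) 0 = (\<Prod>k\<leftarrow>ks. - inverse (\<omega> ^ k))"
    and c2: "coeff (P11 + P22) (2 * q) = (\<Prod>k\<leftarrow>ks. - (\<omega> ^ k))"
    using tprod_Laurent[where w = "\<lambda>k. \<omega> ^ k" and E = E and ks = ks] w0 ks unfolding X_def trace_2 ks_def[symmetric]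
    by (auto simp: distrib_left)
  define G where "G = P11 + P22"
  have rot: "X (\<omega> * t) = X t" for t
  proof -
    define f where "f k = E - t * \<omega> ^ k - inverse (t * \<omega> ^ k)" for k
    have split: "[1..<q+1] = 1 # [2..<q+1]"
      using q by (metis One_nat_def Suc_1 less_add_same_cancel2 upt_conv_Cons)
    have shift: "[2..<q+1] @ [q + 1] = map Suc [1..<q+1]"
      using q by (simp add: map_Suc_upt numeral_2_eq_2)
    have "E - \<omega> * t * \<omega> ^ k - inverse (\<omega> * t * \<omega> ^ k) = f (Suc k)" for k
    proof -
      have "\<omega> * t * \<omega> ^ k = t * \<omega> ^ Suc k" by simp
      then show ?thesis unfolding f_def by metis
    qed
    then have "map (\<lambda>k. E - \<omega> * t * \<omega> ^ k - inverse (\<omega> * t * \<omega> ^ k)) [1..<q+1] = map (\<lambda>k. f (Suc k)) [1..<q+1]"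
      by (rule map_cong[OF refl])
    also have "\<dots> = map f (map Suc [1..<q+1])" by (simp only: map_map o_def)
    also have "\<dots> = map f [2..<q+1] @ [f (q + 1)]" unfolding shift[symmetric] map_append by simp
    also have "f (q + 1) = f 1" by (simp add: f_def wq)
    finally have "X (\<omega> * t) = trace (tprod (f 1 # map f [2..<q+1]))"
      unfolding X_def by (simp only: trace_tprod_rotate1)
    also have "f 1 # map f [2..<q+1] = map f [1..<q+1]"
      unfolding split by (simp only: list.map)
    finally show ?thesis unfolding X_def f_def .
  qed
  have "poly (G \<circ>\<^sub>p [:0, \<omega>:]) t = poly G t" if "t \<noteq> 0" for t
  proof -
    have "poly G (\<omega> * t) = (\<omega> * t) ^ q * X (\<omega> * t)"
      using ev[of "\<omega> * t"] that w0 by (simp add: G_def)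
    also have "\<dots> = t ^ q * X t" by (simp add: rot power_mult_distrib wq)
    finally show ?thesis using ev[of t] that by (simp add: poly_pcompose G_def mult.commute)
  qed
  \<comment> \<open>The identity is known for \<open>t \<noteq> 0\<close> only; multiplying by the
    variable makes it hold at \<open>0\<close> too.\<close>
  then have "poly (pCons 0 (G \<circ>\<^sub>p [:0, \<omega>:])) = poly (pCons 0 G)"
    by (intro ext) (case_tac "x = 0", auto)
  then have "pCons 0 (G \<circ>\<^sub>p [:0, \<omega>:]) = pCons 0 G"
    by (simp only: poly_eq_poly_eq_iff)
  then have "G \<circ>\<^sub>p [:0, \<omega>:] = G" by simp
  then have "\<omega> ^ m * coeff G m = coeff G m" for m
    by (metis coeff_pcompose_linear mult.commute)
  then have van: "coeff G m = 0" if "\<not> q dvd m" for m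
    using that \<omega>[of m] by (metis mult_cancel_right1)
  have hi': "coeff G m = 0" if "m > 2 * q" for m using hi that by (simp add: G_def)
  have c0': "coeff G 0 = -1"
  proof -
    have "inverse \<omega> ^ q = 1" using wq by (simp add: power_inverse)
    from prod_list_root_of_unity[OF this assms(1)] show ?thesis
      by (simp only: c0 G_def ks_def power_inverse)
  qed
  have c2': "coeff G (2 * q) = -1"
    using prod_list_root_of_unity[OF wq assms(1)] by (simp only: c2 G_def ks_def)
  have polyG: "poly G t = - 1 + coeff G q * t ^ q - t ^ (2 * q)" for t
  proof -
    have "poly G t = (\<Sum>m\<le>2 * q. coeff G m * t ^ m)"
    proof -
      have "degree G \<le> 2 * q" using hi' by (intro degree_le) auto
      then show ?thesis unfolding poly_altdef
        by (intro sum.mono_neutral_left) (auto simp: coeff_eq_0)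
    qed
    also have "\<dots> = (\<Sum>m\<in>{0, q, 2 * q}. coeff G m * t ^ m)"
    proof (rule sum.mono_neutral_right)
      show "\<forall>i\<in>{..2 * q} - {0, q, 2 * q}. coeff G i * t ^ i = 0"
      proof
        fix i assume i: "i \<in> {..2 * q} - {0, q, 2 * q}"
        have "\<not> q dvd i"
        proof
          assume "q dvd i"
          then obtain c where c: "i = q * c" by blast
          then have "c \<le> 2" using i q by auto
          then have "c = 0 \<or> c = 1 \<or> c = 2" by auto
          then show False using c i by auto
        qed
        then show "coeff G i * t ^ i = 0" by (simp add: van)
      qed
    qed auto
    finally show ?thesis using q by (simp add: c0' c2')
  qed
  show ?thesis
  proof (intro exI allI impI)
    fix t :: complex assume t: "t \<noteq> 0"
    have "t ^ q * X t = - 1 + coeff G q * t ^ q - t ^ (2 * q)"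
      using ev[OF t] polyG[of t] by (simp add: G_def)
    then have "X t = (- 1 + coeff G q * t ^ q - t ^ q * t ^ q) / t ^ q"
      using t by (simp add: nonzero_eq_divide_eq power_add[symmetric] mult_2[symmetric] mult.commute)
    then show "X t = coeff G q - t ^ q - inverse (t ^ q)"
      using t by (simp add: field_simps)
  qed
qed

text \<open>Only the entry (1,1) reaches full degree, so the trace is monic. The guard
  \<open>0 < m\<close> is again for the empty product.\<close>

lemma tprod_char_coeff:
  fixes xs :: "'a::comm_ring_1 list"
  defines "M \<equiv> \<lambda>xs. tprod (map (\<lambda>x. [:- x, 1:]) xs)"
  shows "coeff (M xs $ 1 $ 1) (length xs) = 1 \<and> (\<forall>m>length xs. coeff (M xs $ 1 $ 1) m = 0) \<and>
    (\<forall>m\<ge>length xs. coeff (M xs $ 1 $ 2) m = 0 \<and> coeff (M xs $ 2 $ 1) m = 0) \<and>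
    (\<forall>m\<ge>length xs. 0 < m \<longrightarrow> coeff (M xs $ 2 $ 2) m = 0)"
proof (induction xs)
  case (Cons x xs)
  have M: "M (x # xs) = tmat [:- x, 1:] ** M xs" by (simp add: M_def)
  show ?case using Cons by (auto simp: M coeff_pCons split: nat.splits)
qed (auto simp: M_def)

lemma trace_tprod_monic:
  fixes xs :: "'a::comm_ring_1 list"
  assumes "xs \<noteq> []"
  defines "P \<equiv> trace (tprod (map (\<lambda>x. [:- x, 1:]) xs))"
  shows "degree P = length xs" "lead_coeff P = 1"
proof -
  have 1: "coeff P (length xs) = 1"
    using tprod_char_coeff[of xs] assms(1) by (simp add: P_def trace_2)
  moreover have "degree P \<le> length xs"
    using tprod_char_coeff[of xs] assms(1) by (intro degree_le) (auto simp: P_def trace_2)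
  ultimately show "degree P = length xs" by (metis le_antisym le_degree zero_neq_one)
  then show "lead_coeff P = 1" using 1 by simp
qed

subsection \<open>Floquet solutions\<close>

text \<open>Solving the recurrence for its leftmost term shows that these products transport data
  backwards, from the right end of the stretch to its left end.\<close>

lemma tprod_transport:
  fixes u :: "nat \<Rightarrow> 'a::comm_ring_1"
  assumes "\<And>i. i < length xs \<Longrightarrow> u (m + i) + u (m + i + 2) = xs ! i * u (m + i + 1)"
  shows "u m = tprod xs $ 1 $ 1 * u (m + length xs) + tprod xs $ 1 $ 2 * u (m + length xs + 1)"
    and "u (m + 1) = tprod xs $ 2 $ 1 * u (m + length xs) + tprod xs $ 2 $ 2 * u (m + length xs + 1)"
  using assms
proof (induction xs arbitrary: m)
  case (Cons x xs)
  {
    case 1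
    have "u m = x * u (m + 1) - u (Suc m + 1)" using 1[of 0] by (simp add: algebra_simps)
    moreover have "u (m + 1 + i) + u (m + 1 + i + 2) = xs ! i * u (m + 1 + i + 1)" if "i < length xs" for i
      using 1[of "Suc i"] that by simp
    ultimately show ?case using Cons[of "m + 1"] by (simp add: algebra_simps)
  next
    case 2
    have "u (m + 1 + i) + u (m + 1 + i + 2) = xs ! i * u (m + 1 + i + 1)" if "i < length xs" for i
      using 2[of "Suc i"] that by simp
    then show ?case using Cons(1)[of "m + 1"] by simp
  }
qed simp_all

fun recsol :: "(nat \<Rightarrow> 'a::comm_ring_1) \<Rightarrow> 'a \<Rightarrow> 'a \<Rightarrow> nat \<Rightarrow> 'a" where
  "recsol a x y 0 = x"
| "recsol a x y (Suc 0) = y"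
| "recsol a x y (Suc (Suc n)) = a (Suc n) * recsol a x y (Suc n) - recsol a x y n"

text \<open>The vector \<open>(b, z - a)\<close> works unless \<open>b = 0\<close>; the triangular
  cases are listed separately.\<close>

lemma eigenvector_2:
  fixes A :: "'a::field^2^2"
  assumes det: "det A = 1" and z: "z \<noteq> 0" "trace A = z + inverse z"
  obtains x y where "x \<noteq> 0 \<or> y \<noteq> 0" "A $ 1 $ 1 * x + A $ 1 $ 2 * y = z * x"
    "A $ 2 $ 1 * x + A $ 2 $ 2 * y = z * y"
proof -
  define a b c d where abcd: "a = A $ 1 $ 1" "b = A $ 1 $ 2" "c = A $ 2 $ 1" "d = A $ 2 $ 2"
  have char: "(a - z) * (d - z) = b * c"
  proof -
    have "(z + inverse z) * z = z * z + 1" using z by (simp add: field_simps)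
    then have "(a + d) * z = z * z + 1" using z by (simp add: abcd trace_2)
    moreover have "a * d - b * c = 1" using det by (simp add: abcd det_2)
    ultimately show ?thesis by algebra
  qed
  consider "b \<noteq> 0" | "b = 0" "a \<noteq> z" "d = z" | "b = 0" "a = z" "c \<noteq> 0 \<or> d \<noteq> z" | "b = 0" "a = z" "c = 0" "d = z"
    using char by fastforce
  then show thesis
  proof cases
    case 1
    show thesis
    proof (rule that[of b "z - a"])
      show "A $ 2 $ 1 * b + A $ 2 $ 2 * (z - a) = z * (z - a)"
        using char by (simp add: abcd[symmetric] algebra_simps)
    qed (use 1 in \<open>simp_all add: abcd[symmetric] algebra_simps\<close>)
  next
    case 2
    show thesis by (rule that[of 0 1]) (use 2 in \<open>simp_all add: abcd[symmetric]\<close>)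
  next
    case 3
    show thesis by (rule that[of "z - d" c]) (use 3 in \<open>auto simp: abcd[symmetric] algebra_simps\<close>)
  next
    case 4
    show thesis by (rule that[of 1 0]) (use 4 in \<open>simp_all add: abcd[symmetric]\<close>)
  qed
qed

text \<open>The initial data form an eigenvector of the monodromy matrix. Since that matrix
  transports backwards, the eigenvalue to take is \<open>inverse z\<close>; determinant
  \<open>1\<close> makes \<open>z\<close> and \<open>inverse z\<close> its two eigenvalues.\<close>

lemma Floquet_solution:
  fixes a :: "int \<Rightarrow> complex" and q :: nat
  assumes per: "\<And>n. a (n + int q) = a n" and q: "q > 0" and z: "z \<noteq> 0"
    and tr: "trace (tprod (map (\<lambda>k. a (int k)) [1..<q+1])) = z + inverse z"
  obtains u where "u \<noteq> (\<lambda>n. 0)" "\<And>n. u (n - 1) + u (n + 1) = a n * u n" "\<And>n. u (n + int q) = z * u n"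
proof -
  define A where "A = tprod (map (\<lambda>k. a (int k)) [1..<q+1])"
  have det: "A $ 1 $ 1 * A $ 2 $ 2 - A $ 1 $ 2 * A $ 2 $ 1 = 1"
    using det_tprod unfolding A_def det_2[symmetric] .
  obtain x y where xy: "x \<noteq> 0 \<or> y \<noteq> 0" and A1: "A $ 1 $ 1 * x + A $ 1 $ 2 * y = inverse z * x"
    and A2: "A $ 2 $ 1 * x + A $ 2 $ 2 * y = inverse z * y"
    using eigenvector_2[of A "inverse z"] det_tprod z tr unfolding A_def by (auto simp: add.commute)
  define s where "s = recsol (\<lambda>n. a (int n)) x y"
  have s: "s n + s (n + 2) = a (int (n + 1)) * s (n + 1)" for n
    by (simp add: s_def)
  define xs where "xs = map (\<lambda>k. a (int k)) [1..<q+1]"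
  have len: "length xs = q" by (simp add: xs_def)
  have "s (0 + i) + s (0 + i + 2) = xs ! i * s (0 + i + 1)" if "i < length xs" for i
  proof -
    have "xs ! i = a (int (i + 1))" using that unfolding xs_def
      by (simp add: nth_append del: upt_Suc)
    then show ?thesis using s[of i] by simp
  qed
  then have "s 0 = A $ 1 $ 1 * s q + A $ 1 $ 2 * s (q + 1)"
    "s 1 = A $ 2 $ 1 * s q + A $ 2 $ 2 * s (q + 1)"
    using tprod_transport[of xs s 0] unfolding A_def xs_def[symmetric] len by simp_all
  then have B: "x = A $ 1 $ 1 * s q + A $ 1 $ 2 * s (q + 1)" "y = A $ 2 $ 1 * s q + A $ 2 $ 2 * s (q + 1)"
    by (simp_all add: s_def)
  have zA: "z * (A $ 1 $ 1 * x + A $ 1 $ 2 * y) = x" "z * (A $ 2 $ 1 * x + A $ 2 $ 2 * y) = y"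
    unfolding A1 A2 using z by simp_all
  have sq: "s q = z * x" using det B zA by algebra
  have sq1: "s (q + 1) = z * y" using det B zA by algebra
  have sqn: "s (n + q) = z * s n \<and> s (n + 1 + q) = z * s (n + 1)" for n
  proof (induction n)
    case 0
    then show ?case using sq sq1 by (simp add: s_def)
  next
    case (Suc n)
    have "s (n + q) + s (n + 2 + q) = a (int (n + 1)) * s (n + 1 + q)"
      using s[of "n + q"] per[of "int (n + 1)"] by (simp add: algebra_simps)
    then have "z * s n + s (n + 2 + q) = a (int (n + 1)) * z * s (n + 1)"
      using Suc by (simp add: algebra_simps)
    then have "s (n + 2 + q) = z * s (n + 2)" using s[of n] by algebra
    then show ?case using Suc by simp
  qed
  have sqm: "s (n + m * q) = z ^ m * s n" for n m
  proof (induction m)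
    case (Suc m)
    have "s (n + Suc m * q) = s ((n + m * q) + q)" by (simp add: algebra_simps)
    then show ?case using sqn[of "n + m * q"] Suc by simp
  qed simp
  \<comment> \<open>The recursion runs over natural numbers. An index \<open>n\<close> is moved by
    \<open>|n|\<close> periods into the nonnegative range and the factor \<open>z ^ |n|\<close> is
    divided out; the next fact shows that any sufficient number of periods gives the same
    value.\<close>
  define u where "u n = inverse z ^ nat \<bar>n\<bar> * s (nat (n + int (nat \<bar>n\<bar> * q)))" for n
  have u: "u n = inverse z ^ m * s (nat (n + int (m * q)))" if "n + int (m * q) \<ge> 0" for n m
  proof -
    define m' where "m' = nat \<bar>n\<bar>"
    have "\<bar>n\<bar> * 1 \<le> \<bar>n\<bar> * int q" using q by (intro mult_left_mono) auto
    then have m': "n + int (m' * q) \<ge> 0" by (simp add: m'_def)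
    have eq: "nat (n + int (m' * q)) + m * q = nat (n + int (m * q)) + m' * q"
      using m' that by linarith
    have "z ^ m * s (nat (n + int (m' * q))) = z ^ m' * s (nat (n + int (m * q)))"
      unfolding sqm[symmetric] eq ..
    then show ?thesis unfolding u_def m'_def[symmetric] using z
      by (simp add: field_simps)
  qed
  show thesis
  proof
    have "u 0 = x" "u 1 = y"
      using u[of 0 0] u[of 1 0] by (simp_all add: s_def)
    then show "u \<noteq> (\<lambda>n. 0)" using xy by auto
  next
    fix n
    define m where "m = nat \<bar>n\<bar> + 1"
    have "(\<bar>n\<bar> + 1) * 1 \<le> (\<bar>n\<bar> + 1) * int q" using q by (intro mult_left_mono) auto
    then have m: "n + int (m * q) \<ge> 1" by (simp add: m_def algebra_simps)
    define k where "k = nat (n - 1 + int (m * q))"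
    have k: "nat (n - 1 + int (m * q)) = k" "nat (n + int (m * q)) = k + 1" "nat (n + 1 + int (m * q)) = k + 2"
      using m by (auto simp: k_def)
    have "a (int (k + 1)) = a n"
    proof -
      have "a (n + int (m * q)) = a n" for m
      proof (induction m)
        case (Suc m)
        then show ?case using per[of "n + int (m * q)"] by (simp add: algebra_simps)
      qed simp
      moreover have "int (k + 1) = n + int (m * q)" using m by (simp add: k_def)
      ultimately show ?thesis by metis
    qed
    then have sk: "s k + s (k + 2) = a n * s (k + 1)" using s[of k] by simp
    have U: "u (n - 1) = inverse z ^ m * s k" "u n = inverse z ^ m * s (k + 1)"
      "u (n + 1) = inverse z ^ m * s (k + 2)"
      using u[of "n - 1" m] u[of n m] u[of "n + 1" m] m unfolding k by auto
    show "u (n - 1) + u (n + 1) = a n * u n"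
      unfolding U distrib_left[symmetric] sk by (simp only: mult.left_commute)
    have "nat (n + int q + int (m * q)) = k + 1 + q" using m by (simp add: k_def)
    then have "u (n + int q) = inverse z ^ m * s (k + 1 + q)"
      using u[of "n + int q" m] m by simp
    also have "\<dots> = z * u n"
      unfolding U using sqn[of k] by (simp only: mult.left_commute)
    finally show "u (n + int q) = z * u n" .
  qed
qed

lemma sum_period_shift:
  fixes g :: "int \<Rightarrow> 'a::ab_group_add"
  assumes "\<And>n. g (n + int q) = g n"
  shows "(\<Sum>n\<in>{0..<int q}. g (n + a)) = (\<Sum>n\<in>{0..<int q}. g n)"
proof -
  have step: "(\<Sum>n\<in>{0..<int q}. g (n + (a + 1))) = (\<Sum>n\<in>{0..<int q}. g (n + a))" for a
  proof -
    have "(\<Sum>n\<in>{0..<int q}. g (n + (a + 1))) = (\<Sum>n\<in>{1..<int q + 1}. g (n + a))"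
      by (rule sum.reindex_bij_witness[of _ "\<lambda>n. n - 1" "\<lambda>n. n + 1"]) (auto simp: algebra_simps)
    also have "\<dots> = (\<Sum>n\<in>{0..<int q}. g (n + a))"
    proof (cases "q = 0")
      case False
      then have "{1..<int q + 1} = insert (int q) {1..<int q}" "{0..<int q} = insert 0 {1..<int q}" by auto
      then show ?thesis using assms[of a] by (simp add: add.commute)
    qed simp
    finally show ?thesis .
  qed
  show ?thesis
  proof (induction a rule: int_induct[of _ 0])
    case (step2 i)
    then show ?case using step[of "i - 1"] by simp
  qed (use step in simp_all)
qed

subsection \<open>The discriminant\<close>

lemma cis_eq_1_iff_dvd:
  assumes "coprime p q" "q > 0"
  shows "cis (2 * pi * real p / real q * of_int n) = 1 \<longleftrightarrow> int q dvd n"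
proof
  assume "cis (2 * pi * real p / real q * of_int n) = 1"
  then have "cos (2 * pi * real p / real q * of_int n) = 1" by (simp add: complex_eq_iff)
  then obtain m :: int where "2 * pi * real p / real q * of_int n = of_int m * 2 * pi"
    by (auto simp: cos_one_2pi_int)
  then have "real p * of_int n = of_int m * real q"
    using assms(2) by (simp add: field_simps)
  then have "of_int (int p * n) = (of_int (m * int q) :: real)" by simp
  then have "int p * n = m * int q" by (simp only: of_int_eq_iff)
  then have "int q dvd int p * n" by simp
  then show "int q dvd n" using assms(1) by (simp add: coprime_dvd_mult_right_iff coprime_commute)
next
  assume "int q dvd n"
  then obtain m where n: "n = int q * m" by blast
  have "2 * pi * real p / real q * of_int n = 2 * pi * of_int (int p * m)"
    using assms(2) by (simp add: n)
  then show "cis (2 * pi * real p / real q * of_int n) = 1"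
    by (metis cis_multiple_2pi Ints_of_int)
qed

locale hofstadter =
  fixes p q :: nat
  assumes q_ge_3: "q \<ge> 3" and odd_q: "odd q" and coprime_pq: "coprime p q"
begin

lemma q_pos: "q > 0" using q_ge_3 by simp

definition pot :: "real \<Rightarrow> int \<Rightarrow> real" where
  "pot \<theta> n = 2 * cos (2 * pi * (real p / real q * of_int n + \<theta>))"

definition W :: "int \<Rightarrow> complex" where
  "W n = cis (2 * pi * real p / real q * of_int n)"

lemma W_add: "W (m + n) = W m * W n"
  by (simp add: W_def cis_mult distrib_left)

lemma W_0 [simp]: "W 0 = 1" and norm_W [simp]: "norm (W n) = 1" and W_nonzero [simp]: "W n \<noteq> 0"
  by (simp_all add: W_def)

lemma W_minus: "W (- n) = cnj (W n)" "W (- n) = inverse (W n)"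
  by (simp_all add: W_def cis_cnj cis_inverse)

lemma W_eq_1_iff: "W n = 1 \<longleftrightarrow> int q dvd n"
  unfolding W_def by (rule cis_eq_1_iff_dvd[OF coprime_pq q_pos])

lemma W_power: "W n ^ k = W (int k * n)"
  unfolding W_def Complex.DeMoivre by (rule arg_cong[of _ _ cis]) simp

lemma pot_W: "complex_of_real (pot \<theta> n) = cis (2 * pi * \<theta>) * W n + inverse (cis (2 * pi * \<theta>) * W n)"
proof -
  define y where "y = 2 * pi * (real p / real q * of_int n + \<theta>)"
  have "cis (2 * pi * \<theta>) * W n = cis y"
    unfolding W_def cis_mult y_def by (rule arg_cong[of _ _ cis]) (simp add: algebra_simps)
  then show ?thesis
    unfolding pot_def y_def[symmetric] by (simp only:) (simp add: complex_eq_iff)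
qed

lemma pot_periodic: "pot \<theta> (n + int q) = pot \<theta> n"
proof -
  have "complex_of_real (pot \<theta> (n + int q)) = of_real (pot \<theta> n)"
    by (simp only: pot_W W_add) (use W_eq_1_iff[of "int q"] in simp)
  then show ?thesis by (simp only: of_real_eq_iff)
qed

lemma pot_half: "pot (\<theta> + 1/2) n = - pot \<theta> n"
proof -
  have "2 * pi * (real p / real q * of_int n + (\<theta> + 1/2)) = 2 * pi * (real p / real q * of_int n + \<theta>) + pi"
    by (simp add: algebra_simps)
  then show ?thesis by (simp only: pot_def) simp
qed

definition ctrace :: "real \<Rightarrow> complex \<Rightarrow> complex" where
  "ctrace \<theta> E = trace (tprod (map (\<lambda>k. E - of_real (pot \<theta> (int k))) [1..<q+1]))"

text \<open>The phase \<open>1 / (4q)\<close> is that of the discriminant, since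
  \<open>2 * pi / (4q) = pi / (2q)\<close>. There the phase-dependent term
  \<open>2 * cos (2 * pi * q * \<theta>)\<close> of Chambers' formula is zero.\<close>

definition dpoly :: "real poly" where
  "dpoly = trace (tprod (map (\<lambda>x. [:- x, 1:]) (map (\<lambda>k. pot (1 / (4 * real q)) (int k)) [1..<q+1])))"

lemma degree_dpoly: "degree dpoly = q"
  using trace_tprod_monic[of "map (\<lambda>k. pot (1 / (4 * real q)) (int k)) [1..<q+1]"] q_pos
  unfolding dpoly_def by simp_all

lemma dpoly_eq: "poly dpoly E = trace (tprod (map (\<lambda>k. E - pot (1 / (4 * real q)) (int k)) [1..<q+1]))"
proof -
  have "poly dpoly E = trace (tprod (map (\<lambda>P. poly P E)
      (map (\<lambda>x. [:- x, 1:]) (map (\<lambda>k. pot (1 / (4 * real q)) (int k)) [1..<q+1]))))"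
    unfolding dpoly_def by (rule trace_tprod_hom[symmetric]) simp_all
  also have "\<dots> = trace (tprod (map (\<lambda>k. E - pot (1 / (4 * real q)) (int k)) [1..<q+1]))"
    by (simp only: map_map o_def) (simp add: algebra_simps)
  finally show ?thesis .
qed

lemma discriminant_eq: "discriminant p q E = - poly dpoly E"
proof -
  have "poly dpoly E = trace (foldr (**) (map (transfer_matrix p q E) [1..<q+1]) (mat 1))"
  proof -
    have "transfer_matrix p q E k = tmat (E - pot (1 / (4 * real q)) (int k))" for k
    proof -
      have "2 * pi * real (k * p) / real q + pi / (2 * real q) = 2 * pi * (real p / real q * of_int (int k) + 1 / (4 * real q))"
        using q_pos by (simp add: field_simps)
      then show ?thesis unfolding transfer_matrix_def tmat_def pot_def by simp
    qed
    then show ?thesis unfolding dpoly_eq tprod_def by (simp only: map_map o_def cong: map_cong)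
  qed
  then show ?thesis by (simp add: discriminant_def)
qed

text \<open>Complex twin of \<open>dpoly\<close>: the roots of a level are first found among complex
  numbers and then shown to be real.\<close>

definition cdpoly :: "complex poly" where
  "cdpoly = trace (tprod (map (\<lambda>x. [:- x, 1:]) (map (\<lambda>k. of_real (pot (1 / (4 * real q)) (int k))) [1..<q+1])))"

abbreviation cpoly :: "complex \<Rightarrow> complex" where
  "cpoly \<equiv> poly cdpoly"

lemma degree_cdpoly: "degree cdpoly = q" and lead_coeff_cdpoly: "lead_coeff cdpoly = 1"
  using trace_tprod_monic[of "map (\<lambda>k. complex_of_real (pot (1 / (4 * real q)) (int k))) [1..<q+1]"] q_pos
  unfolding cdpoly_def by simp_all

lemma cpoly_ctrace: "cpoly E = ctrace (1 / (4 * real q)) E"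
proof -
  have "cpoly E = trace (tprod (map (\<lambda>P. poly P E)
      (map (\<lambda>x. [:- x, 1:]) (map (\<lambda>k. of_real (pot (1 / (4 * real q)) (int k))) [1..<q+1]))))"
    unfolding cdpoly_def by (rule trace_tprod_hom[symmetric]) simp_all
  then show ?thesis
    unfolding ctrace_def by (simp only: map_map o_def) (simp add: algebra_simps)
qed

lemma cpoly_of_real: "cpoly (of_real x) = of_real (poly dpoly x)"
proof -
  have "of_real (poly dpoly x) = complex_of_real (trace (tprod (map (\<lambda>k. x - pot (1 / (4 * real q)) (int k)) [1..<q+1])))"
    by (simp only: dpoly_eq)
  also have "\<dots> = trace (tprod (map complex_of_real (map (\<lambda>k. x - pot (1 / (4 * real q)) (int k)) [1..<q+1])))"
    by (rule trace_tprod_hom[symmetric]) simp_all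
  also have "\<dots> = cpoly (of_real x)"
    unfolding cpoly_ctrace ctrace_def by (simp only: map_map o_def of_real_diff)
  finally show ?thesis by simp
qed

text \<open>Chambers' formula yields a constant \<open>g\<close> depending on \<open>E\<close>
  alone; evaluating at the phase \<open>1 / (4q)\<close>, where the cosine vanishes, identifies it
  as \<open>cpoly E\<close>.\<close>

lemma ctrace_eq: "ctrace \<theta> E = cpoly E - of_real (2 * cos (2 * pi * real q * \<theta>))"
proof -
  have *: "W 1 ^ n = 1 \<longleftrightarrow> q dvd n" for n
    using W_eq_1_iff[of "int n"] by (simp add: W_power)
  define X where "X t = trace (tprod (map (\<lambda>k. E - t * W 1 ^ k - inverse (t * W 1 ^ k)) [1..<q+1]))" for t
  obtain g where g: "\<And>t. t \<noteq> 0 \<Longrightarrow> X t = g - t ^ q - inverse (t ^ q)"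
    using Chambers[OF odd_q *, of E] unfolding X_def by blast
  have X: "ctrace \<theta> E = X (cis (2 * pi * \<theta>))" for \<theta>
  proof -
    have "E - of_real (pot \<theta> (int k)) = E - cis (2 * pi * \<theta>) * W 1 ^ k - inverse (cis (2 * pi * \<theta>) * W 1 ^ k)" for k
      by (simp add: pot_W W_power)
    then show ?thesis unfolding ctrace_def X_def by (simp only:)
  qed
  have "ctrace \<theta> E = g - of_real (2 * cos (2 * pi * real q * \<theta>))" for \<theta>
  proof -
    have "cis (2 * pi * \<theta>) ^ q = cis (2 * pi * real q * \<theta>)"
      unfolding Complex.DeMoivre by (rule arg_cong[of _ _ cis]) simp
    then show ?thesis unfolding X g[OF cis_neq_zero] by (simp add: complex_eq_iff)
  qed
  from this[of \<theta>] this[of "1 / (4 * real q)"] show ?thesis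
    using q_pos by (simp add: cpoly_ctrace)
qed

text \<open>Shifting the phase from \<open>0\<close> to \<open>1/2\<close> negates the potential.
  Since \<open>q\<close> is odd, the trace changes sign and the Chambers terms at the two phases are
  \<open>2\<close> and \<open>-2\<close>, which cancel.\<close>

lemma cpoly_uminus: "cpoly (- E) = - cpoly E"
proof -
  have "ctrace (0 + 1/2) (- E) = - ctrace 0 E"
  proof -
    have "ctrace (0 + 1/2) (- E) = trace (tprod (map uminus (map (\<lambda>k. E - of_real (pot 0 (int k))) [1..<q+1])))"
      unfolding ctrace_def map_map o_def pot_half by simp
    also have "\<dots> = - ctrace 0 E"
      unfolding trace_tprod_uminus ctrace_def using odd_q q_pos by simp
    finally show ?thesis .
  qed
  moreover have "cos (2 * pi * real q * (0 + 1/2)) = -1"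
  proof -
    obtain m where "q = 2 * m + 1" using odd_q by (elim oddE)
    then have "2 * pi * real q * (0 + 1/2) = 2 * real m * pi + pi" by (simp add: algebra_simps)
    then show ?thesis using cos_2npi[of m] by (simp only: cos_periodic_pi)
  qed
  ultimately have "cpoly (- E) - of_real (2 * (-1)) = - (cpoly E - of_real (2 * 1))"
    by (simp only: ctrace_eq mult_zero_right cos_zero)
  then show ?thesis by simp
qed

lemma dpoly_uminus: "poly dpoly (- x) = - poly dpoly x"
proof -
  have "complex_of_real (poly dpoly (- x)) = of_real (- poly dpoly x)"
    using cpoly_uminus[of "of_real x"] cpoly_of_real[of x] cpoly_of_real[of "- x"] by simp
  then show ?thesis by (simp only: of_real_eq_iff)
qed

subsection \<open>Bloch waves\<close>

definition bloch :: "real \<Rightarrow> complex \<Rightarrow> complex \<Rightarrow> (int \<Rightarrow> complex) \<Rightarrow> bool" where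
  "bloch \<theta> z E u \<longleftrightarrow> (\<forall>n. u (n - 1) + u (n + 1) + of_real (pot \<theta> n) * u n = E * u n) \<and>
     (\<forall>n. u (n + int q) = z * u n)"

lemma blochD:
  assumes "bloch \<theta> z E u"
  shows "u (n - 1) + u (n + 1) + of_real (pot \<theta> n) * u n = E * u n" "u (n + int q) = z * u n"
  using assms by (simp_all add: bloch_def)

lemma bloch_exists:
  assumes "z \<noteq> 0" "cpoly E - of_real (2 * cos (2 * pi * real q * \<theta>)) = z + inverse z"
  obtains u where "u \<noteq> (\<lambda>n. 0)" "bloch \<theta> z E u"
proof -
  define a where "a n = E - of_real (pot \<theta> n)" for n
  have a: "a (n + int q) = a n" for n by (simp add: a_def pot_periodic)
  have "trace (tprod (map (\<lambda>k. a (int k)) [1..<q+1])) = z + inverse z"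
    using assms(2) unfolding ctrace_eq[symmetric] ctrace_def a_def .
  from Floquet_solution[OF a q_pos assms(1) this] obtain u where
    u: "u \<noteq> (\<lambda>n. 0)" "\<And>n. u (n - 1) + u (n + 1) = a n * u n" "\<And>n. u (n + int q) = z * u n" by metis
  then have "bloch \<theta> z E u" by (simp add: bloch_def a_def algebra_simps)
  with u(1) show thesis by (rule that)
qed

text \<open>The level is split evenly: the phase supplies \<open>c / 2\<close> through its cosine
  and the multiplier supplies the other \<open>c / 2\<close>. This is why the union over phases
  reaches exactly the levels up to \<open>4\<close>.\<close>

lemma bloch_phases:
  assumes "\<bar>c\<bar> \<le> 4"
  obtains \<theta> and z :: complex where "0 < \<theta>" "\<theta> \<le> 1" "norm z = 1"
    "of_real c - of_real (2 * cos (2 * pi * real q * \<theta>)) = z + inverse z"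
proof -
  define y where "y = arccos (c / 4)"
  define z where "z = cis y"
  have y: "cos y = c / 4" using assms by (simp add: y_def cos_arccos_abs)
  have y_bounds: "0 \<le> y" "y \<le> pi" using assms by (auto simp: y_def intro: arccos_lbound arccos_ubound)
  \<comment> \<open>For \<open>y = 0\<close> the natural phase \<open>0\<close> lies outside
    \<open>(0, 1]\<close>; the phase \<open>1 / q\<close> has the same cosine.\<close>
  define \<theta> where "\<theta> = (if y = 0 then 1 / real q else y / (2 * pi * real q))"
  have "cos (2 * pi * real q * \<theta>) = c / 4"
    using q_pos y by (auto simp: \<theta>_def)
  moreover have "0 < \<theta>" using y_bounds q_pos by (auto simp: \<theta>_def)
  moreover have "\<theta> \<le> 1"
  proof -
    have "y \<le> 2 * pi" using y_bounds pi_gt_zero by linarith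
    also have "\<dots> \<le> 2 * pi * real q" using q_pos by simp
    finally have "y \<le> 2 * pi * real q" .
    then show ?thesis using q_pos by (auto simp: \<theta>_def divide_le_eq_1)
  qed
  moreover have "z + inverse z = of_real (c / 2)" "norm z = 1"
    by (simp_all add: z_def cis_inverse complex_eq_iff y)
  moreover have "of_real c - of_real (2 * (c / 4)) = complex_of_real (c / 2)"
    by (simp flip: of_real_diff)
  ultimately show thesis using that[of \<theta> z] by (simp only:)
qed

lemma norm_period:
  assumes "norm (z::complex) = 1" "bloch \<theta> z E u"
  shows "norm (u (n + int q)) = norm (u n)"
  using blochD(2)[OF assms(2)] assms(1) by (simp add: norm_mult)

lemma bloch_sum_pos:
  assumes "norm (z::complex) = 1" "bloch \<theta> z E u" "u \<noteq> (\<lambda>n. 0)"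
  shows "(\<Sum>n\<in>{0..<int q}. (norm (u n))\<^sup>2) > 0"
proof -
  obtain a where a: "u a \<noteq> 0" using assms(3) by auto
  have "(\<Sum>n\<in>{0..<int q}. (norm (u n))\<^sup>2) = (\<Sum>n\<in>{0..<int q}. (norm (u (n + a)))\<^sup>2)"
    by (rule sum_period_shift[symmetric]) (simp add: norm_period[OF assms(1,2)])
  moreover have "(norm (u (0 + a)))\<^sup>2 \<le> (\<Sum>n\<in>{0..<int q}. (norm (u (n + a)))\<^sup>2)"
    by (rule member_le_sum[where f = "\<lambda>n. (norm (u (n + a)))\<^sup>2"]) (use q_pos in auto)
  moreover have "(norm (u (0 + a)))\<^sup>2 > 0" using a by simp
  ultimately show ?thesis by linarith
qed

lemma bloch_sum_norm_mult:
  assumes "norm (z::complex) = 1" "bloch \<theta> z E u"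
  shows "(\<Sum>n\<in>{0..<int q}. norm (u (n + a)) * norm (u n)) \<le> (\<Sum>n\<in>{0..<int q}. (norm (u n))\<^sup>2)"
proof -
  have "2 * (norm (u (n + a)) * norm (u n)) \<le> (norm (u (n + a)))\<^sup>2 + (norm (u n))\<^sup>2" for n
    using sum_squares_bound[of "norm (u (n + a))" "norm (u n)"] by simp
  then have "(\<Sum>n\<in>{0..<int q}. 2 * (norm (u (n + a)) * norm (u n)))
      \<le> (\<Sum>n\<in>{0..<int q}. (norm (u (n + a)))\<^sup>2 + (norm (u n))\<^sup>2)"
    by (intro sum_mono)
  also have "\<dots> = 2 * (\<Sum>n\<in>{0..<int q}. (norm (u n))\<^sup>2)"
    using sum_period_shift[of "\<lambda>n. (norm (u n))\<^sup>2" q a] norm_period[OF assms]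
    by (simp add: sum.distrib)
  finally show ?thesis by (simp flip: sum_distrib_left)
qed

text \<open>Summation by parts over one period; the boundary terms cancel because
  \<open>cnj z * z = 1\<close>. Taking \<open>w = u\<close> gives real energies, and distinct real
  energies give orthogonal waves.\<close>

lemma bloch_self_adjoint:
  assumes z: "norm (z::complex) = 1" and u: "bloch \<theta> z E u" and w: "bloch \<theta> z E' w"
  shows "(E - cnj E') * (\<Sum>n\<in>{0..<int q}. cnj (w n) * u n) = 0"
proof -
  have zz: "cnj z * z = 1" using z by (metis complex_norm_square mult.commute of_real_1 power_one)
  define S where "S = (\<Sum>n\<in>{0..<int q}. cnj (w n) * u n)"
  have shift: "(\<Sum>n\<in>{0..<int q}. cnj (w (n + 1)) * u n) = (\<Sum>n\<in>{0..<int q}. cnj (w n) * u (n - 1))"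
    "(\<Sum>n\<in>{0..<int q}. cnj (w (n - 1)) * u n) = (\<Sum>n\<in>{0..<int q}. cnj (w n) * u (n + 1))"
    using sum_period_shift[of "\<lambda>n. cnj (w n) * u (n - 1)" q 1] sum_period_shift[of "\<lambda>n. cnj (w n) * u (n + 1)" q "-1"]
      blochD(2)[OF u, of "_ - 1"] blochD(2)[OF u, of "_ + 1"] blochD(2)[OF w] zz
    by (simp_all add: algebra_simps)
  have "E * S = (\<Sum>n\<in>{0..<int q}. cnj (w n) * (E * u n))"
    by (simp add: S_def sum_distrib_left mult_ac)
  also have "\<dots> = (\<Sum>n\<in>{0..<int q}. cnj (w n) * (u (n - 1) + u (n + 1) + of_real (pot \<theta> n) * u n))"
    by (simp only: blochD(1)[OF u])
  also have "\<dots> = (\<Sum>n\<in>{0..<int q}. cnj (w n) * u (n - 1)) + (\<Sum>n\<in>{0..<int q}. cnj (w n) * u (n + 1))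
      + (\<Sum>n\<in>{0..<int q}. of_real (pot \<theta> n) * cnj (w n) * u n)"
    by (simp add: distrib_left sum.distrib mult_ac)
  also have "\<dots> = (\<Sum>n\<in>{0..<int q}. (cnj (w (n - 1)) + cnj (w (n + 1)) + of_real (pot \<theta> n) * cnj (w n)) * u n)"
    unfolding shift[symmetric] by (simp add: distrib_right sum.distrib)
  also have "\<dots> = (\<Sum>n\<in>{0..<int q}. cnj (E' * w n) * u n)"
    by (simp only: blochD(1)[OF w, symmetric] complex_cnj_add complex_cnj_mult complex_cnj_complex_of_real)
  also have "\<dots> = cnj E' * S" by (simp add: S_def sum_distrib_left mult_ac)
  finally show ?thesis by (simp add: S_def algebra_simps)
qed

lemma bloch_energy:
  assumes z: "norm (z::complex) = 1" and u: "bloch \<theta> z E u" "u \<noteq> (\<lambda>n. 0)"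
  shows "E \<in> \<real>" "norm E \<le> 4"
proof -
  define S where "S = (\<Sum>n\<in>{0..<int q}. (norm (u n))\<^sup>2)"
  have S: "S > 0" unfolding S_def by (rule bloch_sum_pos[OF z u])
  have CS: "(\<Sum>n\<in>{0..<int q}. cnj (u n) * u n) = of_real S"
    unfolding S_def of_real_sum by (intro sum.cong refl) (metis complex_norm_square mult.commute)
  have "E - cnj E = 0" using bloch_self_adjoint[OF z u(1) u(1)] S unfolding CS by simp
  then have "E = cnj E" by simp
  then show "E \<in> \<real>" by (simp add: Reals_cnj_iff)
  have "norm E * S = (\<Sum>n\<in>{0..<int q}. norm (E * u n) * norm (u n))"
    by (simp add: S_def sum_distrib_left norm_mult power2_eq_square mult_ac)
  also have "\<dots> \<le> (\<Sum>n\<in>{0..<int q}. norm (u (n + (-1))) * norm (u n) + norm (u (n + 1)) * norm (u n) + 2 * (norm (u n))\<^sup>2)"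
  proof (rule sum_mono)
    fix n
    have "\<bar>pot \<theta> n\<bar> \<le> 2" by (simp add: pot_def abs_mult)
    then have "norm (of_real (pot \<theta> n) * u n) \<le> 2 * norm (u n)"
      by (simp add: norm_mult mult_right_mono)
    moreover have "norm (E * u n) \<le> norm (u (n - 1)) + norm (u (n + 1)) + norm (of_real (pot \<theta> n) * u n)"
      unfolding blochD(1)[OF u(1), symmetric] by (meson norm_triangle_le norm_triangle_ineq add_mono order_refl)
    ultimately have "norm (E * u n) \<le> norm (u (n - 1)) + norm (u (n + 1)) + 2 * norm (u n)" by simp
    then have "norm (E * u n) * norm (u n) \<le> (norm (u (n - 1)) + norm (u (n + 1)) + 2 * norm (u n)) * norm (u n)"
      by (intro mult_right_mono) auto
    then show "norm (E * u n) * norm (u n) \<le> norm (u (n + (-1))) * norm (u n) + norm (u (n + 1)) * norm (u n) + 2 * (norm (u n))\<^sup>2"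
      by (simp add: algebra_simps power2_eq_square)
  qed
  also have "\<dots> \<le> S + S + 2 * S"
    using bloch_sum_norm_mult[OF z u(1), of "-1"] bloch_sum_norm_mult[OF z u(1), of 1]
    by (simp only: sum.distrib sum_distrib_left[symmetric] S_def)
  finally show "norm E \<le> 4" using S by simp
qed

text \<open>Every complex point of the level carries a Bloch wave for one fixed phase and unimodular
  multiplier, so self-adjointness places it on the real line.\<close>

lemma cpoly_level:
  assumes "cpoly E = of_real c" "\<bar>c\<bar> \<le> 4"
  shows "E \<in> \<real>" "norm E \<le> 4"
proof -
  obtain \<theta> and z :: complex where z: "norm z = 1" "of_real c - of_real (2 * cos (2 * pi * real q * \<theta>)) = z + inverse z"
    using bloch_phases[OF assms(2)] by metis
  moreover have "z \<noteq> 0" using z(1) by auto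
  ultimately obtain u where "u \<noteq> (\<lambda>n. 0)" "bloch \<theta> z E u"
    using bloch_exists[of z E \<theta>] assms(1) by metis
  with z(1) show "E \<in> \<real>" "norm E \<le> 4" by (auto dest: bloch_energy)
qed

lemma dpoly_level_le: "\<bar>poly dpoly x\<bar> \<le> 4 \<Longrightarrow> \<bar>x\<bar> \<le> 4"
  using cpoly_level(2)[of "of_real x" "poly dpoly x"] by (simp add: cpoly_of_real)

lemma dpoly_factor:
  assumes "\<bar>c\<bar> \<le> 4"
  obtains e where "dpoly - [:c:] = (\<Prod>i<q. [:- e i, 1:])"
proof -
  define P where "P = cdpoly + [:- of_real c:]"
  have deg: "degree P = q"
    using degree_cdpoly q_pos degree_add_eq_left[of "[:- of_real c:]" cdpoly] by (simp add: P_def)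
  have lead: "lead_coeff P = 1"
    using lead_coeff_cdpoly degree_cdpoly deg q_pos by (simp add: P_def coeff_pCons split: nat.split)
  obtain root where root: "(\<Prod>i<q. [:- root i, 1:]) = P"
    using complex_poly_decompose'[of P] deg lead by (metis smult_1_left)
  have P: "poly P E = cpoly E - of_real c" for E
    by (simp add: P_def)
  have real: "root i \<in> \<real>" if "i < q" for i
  proof -
    have "poly P (root i) = 0" unfolding root[symmetric] poly_prod using that by (auto intro: prod_zero)
    then show ?thesis using cpoly_level(1)[of "root i" c] assms by (simp add: P)
  qed
  have "poly (\<Prod>i<q. [:- Re (root i), 1:]) x = poly (dpoly - [:c:]) x" for x
  proof -
    have "complex_of_real (poly (\<Prod>i<q. [:- Re (root i), 1:]) x) = (\<Prod>i<q. of_real x - root i)"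
      unfolding poly_prod of_real_prod using real by (intro prod.cong refl) simp
    also have "\<dots> = poly P (of_real x)"
      unfolding root[symmetric] poly_prod by simp
    also have "\<dots> = of_real (poly (dpoly - [:c:]) x)" by (simp add: P cpoly_of_real)
    finally show ?thesis by (simp only: of_real_eq_iff)
  qed
  then have "(\<Prod>i<q. [:- Re (root i), 1:]) = dpoly - [:c:]"
    by (simp add: poly_eq_poly_eq_iff[symmetric] fun_eq_iff)
  then show thesis using that[of "\<lambda>i. Re (root i)"] by simp
qed

end

subsection \<open>A lower bound for the derivative of the discriminant\<close>

text \<open>As many orthonormal waves as the period has sites, which is what makes them complete.
  \<open>bloch_basis_exists\<close> provides them at levels with \<open>q\<close> distinct
  roots.\<close>

locale bloch_basis = hofstadter +
  fixes \<theta> :: real and z :: complex and v :: "nat \<Rightarrow> int \<Rightarrow> complex" and e :: "nat \<Rightarrow> real"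
  assumes norm_z: "norm z = 1"
    and bloch_v: "l < q \<Longrightarrow> bloch \<theta> z (of_real (e l)) (v l)"
    and orthonormal: "\<And>l l'. l < q \<Longrightarrow> l' < q \<Longrightarrow>
      (\<Sum>n\<in>{0..<int q}. cnj (v l n) * v l' n) = (if l = l' then 1 else 0)"
begin

definition N :: int where "N = int ((q - 1) div 2)"

lemma N: "int q = 2 * N + 1" "N \<ge> 1"
proof -
  obtain m where "q = 2 * m + 1" using odd_q by (elim oddE)
  moreover from this have "N = int m" unfolding N_def by simp
  ultimately show "int q = 2 * N + 1" "N \<ge> 1" using q_ge_3 by linarith+
qed

abbreviation t :: complex where "t \<equiv> cis (2 * pi * \<theta>)"

lemma z_nonzero: "z \<noteq> 0" using norm_z by auto

text \<open>The defect of \<open>\<Sum>\<^sub>l v\<^sub>l v\<^sub>l\<^sup>*\<close> from the identity has squared Hilbert-Schmidt norm \<open>q - 2q + q = 0\<close>.\<close>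

lemma completeness:
  assumes "a \<in> {0..<int q}" "b \<in> {0..<int q}"
  shows "(\<Sum>l<q. v l a * cnj (v l b)) = (if a = b then 1 else 0)"
proof -
  define P where "P m n = (\<Sum>l<q. v l m * cnj (v l n))" for m n
  define d :: "int \<Rightarrow> int \<Rightarrow> complex" where "d m n = (if m = n then 1 else 0)" for m n
  define I where "I = {0..<int q}"
  have I: "finite I" "card I = q" by (simp_all add: I_def)
  have norm_dP: "complex_of_real ((norm (d m n - P m n))\<^sup>2) = d m n - d m n * P m n - d m n * P n m + P m n * P n m" for m n
  proof -
    have "complex_of_real ((norm (d m n - P m n))\<^sup>2) = (d m n - P m n) * cnj (d m n - P m n)"
      by (rule complex_norm_square)
    also have "cnj (d m n - P m n) = d m n - P n m"
      by (simp add: d_def P_def mult.commute)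
    finally show ?thesis by (simp add: d_def algebra_simps)
  qed
  have dd: "(\<Sum>m\<in>I. \<Sum>n\<in>I. d m n) = of_nat q"
    using I by (simp add: d_def)
  have trace_P: "(\<Sum>m\<in>I. P m m) = of_nat q"
  proof -
    have "(\<Sum>m\<in>I. P m m) = (\<Sum>l<q. \<Sum>m\<in>I. cnj (v l m) * v l m)"
      unfolding P_def by (subst sum.swap) (simp add: mult.commute)
    then show ?thesis by (simp add: I_def orthonormal)
  qed
  have dP: "(\<Sum>m\<in>I. \<Sum>n\<in>I. d m n * P m n) = of_nat q" "(\<Sum>m\<in>I. \<Sum>n\<in>I. d m n * P n m) = of_nat q"
    unfolding trace_P[symmetric] using I(1) by (intro sum.cong refl; simp add: d_def if_distrib[of "\<lambda>x. x * _"] cong: if_cong)+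
  have PP: "(\<Sum>m\<in>I. \<Sum>n\<in>I. P m n * P n m) = of_nat q"
  proof -
    have "(\<Sum>m\<in>I. \<Sum>n\<in>I. P m n * P n m)
        = (\<Sum>m\<in>I. \<Sum>n\<in>I. \<Sum>l<q. \<Sum>l'<q. (cnj (v l' m) * v l m) * (cnj (v l n) * v l' n))"
      unfolding P_def sum_product by (simp add: mult_ac)
    also have "\<dots> = (\<Sum>l<q. \<Sum>l'<q. \<Sum>m\<in>I. \<Sum>n\<in>I. (cnj (v l' m) * v l m) * (cnj (v l n) * v l' n))"
      by (simp only: sum.swap[of _ I "{..<q}"])
    also have "\<dots> = (\<Sum>l<q. \<Sum>l'<q. (\<Sum>m\<in>I. cnj (v l' m) * v l m) * (\<Sum>n\<in>I. cnj (v l n) * v l' n))"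
      by (simp only: sum_product)
    also have "\<dots> = (\<Sum>l<q. \<Sum>l'<q. if l' = l then 1 else 0)"
      unfolding I_def by (intro sum.cong refl) (simp add: orthonormal)
    finally show ?thesis by simp
  qed
  have "complex_of_real (\<Sum>m\<in>I. \<Sum>n\<in>I. (norm (d m n - P m n))\<^sup>2) = 0"
    unfolding of_real_sum norm_dP by (simp add: sum.distrib sum_subtractf dd dP PP)
  then have "(\<Sum>m\<in>I. \<Sum>n\<in>I. (norm (d m n - P m n))\<^sup>2) = 0" by (simp only: of_real_eq_0_iff)
  then have "(\<Sum>n\<in>I. (norm (d a n - P a n))\<^sup>2) = 0"
    using assms(1) I by (subst (asm) sum_nonneg_eq_0_iff) (auto intro: sum_nonneg simp: I_def)
  then have "(norm (d a b - P a b))\<^sup>2 = 0"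
    using assms(2) I by (subst (asm) sum_nonneg_eq_0_iff) (auto simp: I_def)
  then show ?thesis by (simp add: d_def P_def)
qed

definition kern :: "nat \<Rightarrow> int \<Rightarrow> int \<Rightarrow> complex" where
  "kern k m n = (\<Sum>l<q. of_real (e l) ^ k * v l m * cnj (v l n))"

lemma kern_Suc: "kern (Suc k) m n = kern k (m - 1) n + kern k (m + 1) n + of_real (pot \<theta> m) * kern k m n"
proof -
  have "of_real (e l) ^ Suc k * v l m * cnj (v l n) = of_real (e l) ^ k * v l (m - 1) * cnj (v l n)
      + of_real (e l) ^ k * v l (m + 1) * cnj (v l n)
      + of_real (pot \<theta> m) * (of_real (e l) ^ k * v l m * cnj (v l n))" if "l < q" for l
  proof -
    have "of_real (e l) ^ Suc k * v l m * cnj (v l n) = of_real (e l) ^ k * (of_real (e l) * v l m) * cnj (v l n)"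
      by simp
    then show ?thesis unfolding blochD(1)[OF bloch_v[OF that], symmetric] by (simp add: algebra_simps)
  qed
  then show ?thesis unfolding kern_def by (simp add: sum.distrib sum_distrib_left)
qed

lemma kern_period: "kern k (m + int q) n = z * kern k m n"
proof -
  have "of_real (e l) ^ k * v l (m + int q) * cnj (v l n) = z * (of_real (e l) ^ k * v l m * cnj (v l n))"
    if "l < q" for l
    using blochD(2)[OF bloch_v[OF that]] by simp
  then show ?thesis unfolding kern_def sum_distrib_left by (intro sum.cong refl) simp
qed

text \<open>Completeness gives the identity kernel on one period, and quasi-periodicity extends it.
  As \<open>N < q\<close>, the index \<open>n + a\<close> wraps around at most once and cannot
  return to \<open>n\<close>.\<close>

lemma kern_0:
  assumes n: "n \<in> {0..<int q}" and a: "\<bar>a\<bar> \<le> N"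
  shows "kern 0 (n + a) n = (if a = 0 then 1 else 0)"
proof -
  have in_range: "kern 0 m n = (if m = n then 1 else 0)" if "m \<in> {0..<int q}" for m
    using completeness[OF that n] by (simp add: kern_def)
  consider "n + a < 0" | "n + a \<in> {0..<int q}" | "n + a \<ge> int q" by fastforce
  then show ?thesis
  proof cases
    case 1
    have "kern 0 (n + a + int q) n = 0" using 1 n a N by (subst in_range) auto
    then have "z * kern 0 (n + a) n = 0" unfolding kern_period .
    then show ?thesis using z_nonzero 1 n by auto
  next
    case 2
    then show ?thesis by (simp add: in_range)
  next
    case 3
    have "kern 0 (n + a - int q) n = 0" using 3 n a N by (subst in_range) auto
    then have "kern 0 (n + a) n = 0" using kern_period[of 0 "n + a - int q" n] by simp
    then show ?thesis using 3 n by auto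
  qed
qed

text \<open>\<open>F k a b\<close> is the trace of the \<open>k\<close>-th power of the operator on Bloch functions against the Weyl
  operator with shift \<open>a\<close> and modulation \<open>b\<close>.\<close>

definition F :: "nat \<Rightarrow> int \<Rightarrow> int \<Rightarrow> complex" where
  "F k a b = (\<Sum>n\<in>{0..<int q}. W (b * n) * kern k (n + a) n)"

text \<open>The four terms of the operator move \<open>(a, b)\<close> to its four neighbours on the
  torus. The modulation steps carry the phases \<open>W a\<close> and \<open>W (- a)\<close> because
  modulation and shift commute only up to such a factor.\<close>

lemma F_Suc: "F (Suc k) a b = F k (a - 1) b + F k (a + 1) b + t * W a * F k a (b + 1) + inverse t * W (- a) * F k a (b - 1)"
proof -
  have "W (b * n) * kern (Suc k) (n + a) n = W (b * n) * kern k (n + (a - 1)) n + W (b * n) * kern k (n + (a + 1)) n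
    + t * W a * (W ((b + 1) * n) * kern k (n + a) n) + inverse t * W (- a) * (W ((b - 1) * n) * kern k (n + a) n)" for n
  proof -
    have 1: "W (b * n) * (t * W (n + a)) = t * W a * W ((b + 1) * n)"
      by (simp add: W_add distrib_right)
    have "W (b * n) * W (- (n + a)) = W (- a) * W ((b - 1) * n)"
      unfolding W_add[symmetric] by (rule arg_cong[of _ _ W]) (simp add: algebra_simps)
    then have 2: "W (b * n) * inverse (t * W (n + a)) = inverse t * W (- a) * W ((b - 1) * n)"
      by (simp add: W_minus(2)[symmetric] inverse_mult_distrib mult.left_commute mult.assoc del: cis_inverse)
    have "W (b * n) * kern (Suc k) (n + a) n = W (b * n) * kern k (n + (a - 1)) n + W (b * n) * kern k (n + (a + 1)) n
      + (W (b * n) * (t * W (n + a)) + W (b * n) * inverse (t * W (n + a))) * kern k (n + a) n"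
      unfolding kern_Suc pot_W by (simp add: algebra_simps)
    then show ?thesis unfolding 1 2 by (simp only: distrib_right mult.assoc add.assoc)
  qed
  then show ?thesis unfolding F_def by (simp only: sum.distrib sum_distrib_left)
qed

lemma F_period: "F k (a + int q) b = z * F k a b" "F k a (b + int q) = F k a b"
proof -
  show "F k (a + int q) b = z * F k a b"
    unfolding F_def sum_distrib_left
    using kern_period by (intro sum.cong refl) (simp add: add.assoc[symmetric])
  have "W ((b + int q) * n) = W (b * n)" for n
    using W_eq_1_iff[of "int q * n"] by (simp add: W_add distrib_right)
  then show "F k a (b + int q) = F k a b" by (simp add: F_def)
qed

lemma sum_W_eq_0:
  assumes "\<not> int q dvd b"
  shows "(\<Sum>n\<in>{0..<int q}. W (b * n)) = 0"
proof -
  define S where "S = (\<Sum>n\<in>{0..<int q}. W (b * n))"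
  have "S = (\<Sum>n\<in>{0..<int q}. W (b * (n + 1)))"
    unfolding S_def using W_eq_1_iff[of "b * int q"]
    by (intro sum_period_shift[symmetric]) (simp add: W_add distrib_left)
  also have "\<dots> = W b * S" by (simp add: S_def W_add distrib_left sum_distrib_left mult.commute)
  finally have "(1 - W b) * S = 0" by (simp add: algebra_simps)
  then show ?thesis using assms W_eq_1_iff[of b] by (auto simp: S_def)
qed

lemma F_0:
  assumes "\<bar>a\<bar> \<le> N" "\<bar>b\<bar> \<le> N"
  shows "F 0 a b = (if a = 0 \<and> b = 0 then of_nat q else 0)"
proof -
  have "F 0 a b = (\<Sum>n\<in>{0..<int q}. W (b * n) * (if a = 0 then 1 else 0))"
    unfolding F_def using assms(1) by (intro sum.cong refl) (simp add: kern_0)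
  moreover have "(\<Sum>n\<in>{0..<int q}. W (b * n)) = 0" if "b \<noteq> 0"
  proof (rule sum_W_eq_0)
    show "\<not> int q dvd b" using dvd_imp_le_int[OF that, of "int q"] assms(2) N by auto
  qed
  ultimately show ?thesis by auto
qed

text \<open>A path of length \<open>k\<close> on the discrete torus cannot reach points of \<open>\<ell>\<^sup>1\<close>-distance greater than \<open>k\<close>.\<close>

lemma F_vanish:
  assumes "\<bar>a\<bar> \<le> N" "\<bar>b\<bar> \<le> N" "\<bar>a\<bar> + \<bar>b\<bar> > int k"
  shows "F k a b = 0"
  using assms
proof (induction k arbitrary: a b)
  case 0
  then show ?case by (auto simp: F_0)
next
  case (Suc k)
  have 1: "F k (a - 1) b = 0"
  proof (cases "a = - N")
    case True
    have "F k (a - 1 + int q) b = 0" using Suc.prems True N by (intro Suc.IH) auto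
    then show ?thesis using z_nonzero by (simp add: F_period)
  qed (use Suc.prems in \<open>intro Suc.IH; auto\<close>)
  have 2: "F k (a + 1) b = 0"
  proof (cases "a = N")
    case True
    have "F k (a + 1 - int q) b = 0" using Suc.prems True N by (intro Suc.IH) auto
    then show ?thesis using F_period(1)[of k "a + 1 - int q" b] by simp
  qed (use Suc.prems in \<open>intro Suc.IH; auto\<close>)
  have 3: "F k a (b + 1) = 0"
  proof (cases "b = N")
    case True
    have "F k a (b + 1 - int q) = 0" using Suc.prems True N by (intro Suc.IH) auto
    then show ?thesis using F_period(2)[of k a "b + 1 - int q"] by simp
  qed (use Suc.prems in \<open>intro Suc.IH; auto\<close>)
  have 4: "F k a (b - 1) = 0"
  proof (cases "b = - N")
    case True
    have "F k a (b - 1 + int q) = 0" using Suc.prems True N by (intro Suc.IH) auto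
    then show ?thesis by (simp add: F_period)
  qed (use Suc.prems in \<open>intro Suc.IH; auto\<close>)
  show ?case unfolding F_Suc 1 2 3 4 by simp
qed

text \<open>A coordinate \<open>N + 1\<close> is congruent to \<open>- N\<close>, so wrapping around
  costs one unit of distance; hence \<open>k + 1\<close> in place of \<open>k\<close>.\<close>

lemma F_vanish':
  assumes "\<bar>a\<bar> \<le> N + 1" "\<bar>b\<bar> \<le> N + 1" "\<bar>a\<bar> + \<bar>b\<bar> > int k + 1" "\<bar>a\<bar> \<le> N \<or> \<bar>b\<bar> \<le> N"
  shows "F k a b = 0"
proof -
  consider "\<bar>a\<bar> \<le> N" "\<bar>b\<bar> \<le> N" | "a = N + 1" | "a = - N - 1" | "b = N + 1" | "b = - N - 1"
    using assms(1,2) by linarith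
  then show ?thesis
  proof cases
    case 2
    have "F k (a - int q) b = 0" using assms 2 N by (intro F_vanish) auto
    then show ?thesis using F_period(1)[of k "a - int q" b] by simp
  next
    case 3
    have "F k (a + int q) b = 0" using assms 3 N by (intro F_vanish) auto
    then show ?thesis using z_nonzero by (simp add: F_period)
  next
    case 4
    have "F k a (b - int q) = 0" using assms 4 N by (intro F_vanish) auto
    then show ?thesis using F_period(2)[of k a "b - int q"] by simp
  next
    case 5
    have "F k a (b + int q) = 0" using assms 5 N by (intro F_vanish) auto
    then show ?thesis by (simp add: F_period)
  qed (use assms in \<open>auto intro: F_vanish\<close>)
qed

text \<open>The number of shortest paths, weighted by the cocycle, is a Gaussian binomial coefficient.\<close>

lemma F_diag:
  assumes "int a \<le> N" "int b \<le> N"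
  shows "F (a + b) (int a) (int b) * (\<Prod>i=1..b. 1 - W (- int i))
    = of_nat q * inverse t ^ b * (\<Prod>i=1..b. 1 - W (- int (a + i)))"
  using assms
proof (induction "a + b" arbitrary: a b)
  case 0
  then show ?case using N by (simp add: F_0)
next
  case (Suc k)
  note hyp = Suc.hyps(1) and hk = Suc.hyps(2) and prems = Suc.prems
  have step: "F (a + b) (int a) (int b) = F k (int a - 1) (int b) + inverse t * W (- int a) * F k (int a) (int b - 1)"
  proof -
    \<comment> \<open>The outward neighbours lie at distance \<open>k + 2\<close>, out of reach even
      after a wrap, so a two-term Pascal recursion remains.\<close>
    have "F k (int a + 1) (int b) = 0" "F k (int a) (int b + 1) = 0"
      using Suc.prems Suc.hyps(2) by (auto intro!: F_vanish')
    then show ?thesis unfolding Suc.hyps(2)[symmetric] F_Suc by simp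
  qed
  show ?case
  proof (cases "b = 0")
    case True
    have "F k (int a) (- 1) = 0" using Suc True N by (intro F_vanish) auto
    moreover obtain a' where "a = Suc a'" using Suc True by (cases a) auto
    ultimately show ?thesis using Suc.hyps(1)[of a' b] Suc.hyps(2) Suc.prems True step by simp
  next
    case False
    then obtain b' where b: "b = Suc b'" using not0_implies_Suc by blast
    have IH: "F k (int a) (int b') * (\<Prod>i=1..b'. 1 - W (- int i))
      = of_nat q * inverse t ^ b' * (\<Prod>i=1..b'. 1 - W (- int (a + i)))"
      using hyp[of a b'] hk prems b by simp
    define P R where "P = (\<Prod>i=1..b'. 1 - W (- int i))" and "R = (\<Prod>i=1..b'. 1 - W (- int (a + i)))"
    have PS: "(\<Prod>i=1..b. 1 - W (- int i)) = P * (1 - W (- int b))"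
      and RS: "(\<Prod>i=1..b. 1 - W (- int (a + i))) = R * (1 - W (- int (a + b)))"
      unfolding b P_def R_def prod.cl_ivl_Suc by (subst if_not_P; simp)+
    have Wab: "W (- int (a + b)) = W (- int a) * W (- int b)"
      by (simp add: W_add[symmetric])
    have first: "F k (int a - 1) (int b) * (P * (1 - W (- int b))) = of_nat q * inverse t ^ b * ((1 - W (- int a)) * R)"
    proof (cases a)
      case 0
      have "F k (- 1) (int b) = 0" using prems hk 0 N by (intro F_vanish) auto
      then show ?thesis using 0 by simp
    next
      case (Suc a')
      have "F k (int a') (int b) * (\<Prod>i=1..b. 1 - W (- int i))
          = of_nat q * inverse t ^ b * (\<Prod>i=1..b. 1 - W (- int (a' + i)))"
        using hyp[of a' b] hk prems Suc by simp
      moreover have "(\<Prod>i=1..b. 1 - W (- int (a' + i))) = (1 - W (- int a)) * R"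
      proof -
        have "(\<Prod>i=1..b. 1 - W (- int (a' + i))) = (\<Prod>i=0..b'. 1 - W (- int (a + i)))"
          by (rule prod.reindex_bij_witness[of _ Suc "\<lambda>i. i - 1"]) (auto simp: b Suc)
        also have "\<dots> = (1 - W (- int a)) * R"
          by (simp add: R_def prod.atLeast_Suc_atMost)
        finally show ?thesis .
      qed
      ultimately show ?thesis using PS Suc by simp
    qed
    have "F (a + b) (int a) (int b) * (P * (1 - W (- int b)))
        = F k (int a - 1) (int b) * (P * (1 - W (- int b)))
        + inverse t * W (- int a) * (1 - W (- int b)) * (F k (int a) (int b') * P)"
      unfolding step by (simp add: b algebra_simps)
    \<comment> \<open>The rule behind Gaussian binomials:
      \<open>(1 - W (- a)) + W (- a) * (1 - W (- b)) = 1 - W (- (a + b))\<close>.\<close>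
    also have "\<dots> = of_nat q * inverse t ^ b * (R * (1 - W (- int (a + b))))"
      unfolding first IH[folded P_def R_def] Wab by (simp add: b algebra_simps)
    finally show ?thesis unfolding PS RS .
  qed
qed

text \<open>Since \<open>(n + i) + (n + 1 - i) = q\<close>, the factors of the numerator are the
  complex conjugates of those of the denominator in reverse order. The denominator is nonzero
  because \<open>0 < i < q\<close>.\<close>

lemma norm_F_corner: "norm (F (q - 1) N N) = real q"
proof -
  define n where "n = (q - 1) div 2"
  have n: "N = int n" "q - 1 = n + n" using N by (auto simp: N_def n_def)
  have P0: "(\<Prod>i=1..n. 1 - W (- int i)) \<noteq> 0"
  proof -
    have "W (- int i) \<noteq> 1" if "i \<in> {1..n}" for i
      using that W_eq_1_iff[of "- int i"] N n by (auto dest: zdvd_imp_le)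
    then show ?thesis by auto
  qed
  have "norm (\<Prod>i=1..n. 1 - W (- int (n + i))) = (\<Prod>i=1..n. norm (1 - W (- int (n + i))))"
    by (rule prod_norm[symmetric])
  also have "\<dots> = (\<Prod>i=1..n. norm (1 - W (- int i)))"
  proof (rule prod.reindex_bij_witness[of _ "\<lambda>i. n + 1 - i" "\<lambda>i. n + 1 - i"])
    fix i assume i: "i \<in> {1..n}"
    then have "W (- int (n + i)) = W (- int q) * W (int (n + 1 - i))"
      using N n by (simp add: W_add[symmetric] of_nat_diff)
    also have "W (- int q) = 1" using W_eq_1_iff by simp
    finally have "1 - W (- int (n + i)) = cnj (1 - W (- int (n + 1 - i)))"
      by (simp add: W_minus(1))
    then show "norm (1 - W (- int (n + 1 - i))) = norm (1 - W (- int (n + i)))"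
      by (simp only: complex_mod_cnj)
  qed auto
  also have "\<dots> = norm (\<Prod>i=1..n. 1 - W (- int i))" by (rule prod_norm)
  finally have eq: "norm (\<Prod>i=1..n. 1 - W (- int (n + i))) = norm (\<Prod>i=1..n. 1 - W (- int i))" .
  have "F (n + n) (int n) (int n) * (\<Prod>i=1..n. 1 - W (- int i))
      = of_nat q * inverse t ^ n * (\<Prod>i=1..n. 1 - W (- int (n + i)))"
    by (rule F_diag) (simp_all add: n)
  then have "norm (F (n + n) (int n) (int n) * (\<Prod>i=1..n. 1 - W (- int i)))
      = norm (of_nat q * inverse t ^ n * (\<Prod>i=1..n. 1 - W (- int (n + i))))"
    by (rule arg_cong)
  then have "norm (F (q - 1) N N) * norm (\<Prod>i=1..n. 1 - W (- int i)) = real q * norm (\<Prod>i=1..n. 1 - W (- int i))"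
    unfolding n norm_mult eq by (simp add: norm_power)
  then show ?thesis using P0 by simp
qed

text \<open>The monic polynomial \<open>Q\<close> vanishes at every \<open>e l\<close> except
  \<open>e i\<close>. Summed over eigenvectors, its trace against the Weyl operator is
  \<open>\<tau> i * Q (e i)\<close>; summed over powers, only degree \<open>q - 1\<close> survives,
  with value of modulus \<open>q\<close>. Finally \<open>|\<tau> i| \<le> 1\<close> by
  Cauchy-Schwarz.\<close>

lemma derivative_bound:
  assumes "i < q"
  shows "real q \<le> \<bar>\<Prod>l\<in>{..<q} - {i}. e i - e l\<bar>"
proof -
  define \<tau> where "\<tau> l = (\<Sum>n\<in>{0..<int q}. W (N * n) * v l (n + N) * cnj (v l n))" for l
  define Q where "Q = (\<Prod>l\<in>{..<q} - {i}. [:- complex_of_real (e l), 1:])"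
  have F: "F k N N = (\<Sum>l<q. of_real (e l) ^ k * \<tau> l)" for k
    unfolding F_def kern_def \<tau>_def sum_distrib_left by (subst sum.swap) (simp add: mult_ac)
  have degQ: "degree Q = q - 1"
    unfolding Q_def using assms by (subst degree_prod_sum_eq) auto
  have leadQ: "coeff Q (q - 1) = 1"
    unfolding degQ[symmetric] by (simp add: Q_def lead_coeff_prod)
  have "(\<Sum>l<q. \<tau> l * poly Q (of_real (e l))) = (\<Sum>k\<le>q - 1. coeff Q k * F k N N)"
    unfolding poly_altdef degQ F sum_distrib_left by (subst sum.swap) (simp add: mult_ac)
  also have "\<dots> = (\<Sum>k\<in>{q - 1}. coeff Q k * F k N N)"
  proof (rule sum.mono_neutral_right)
    show "\<forall>k\<in>{..q - 1} - {q - 1}. coeff Q k * F k N N = 0"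
      using N by (auto intro!: F_vanish)
  qed auto
  also have "\<dots> = F (q - 1) N N" using leadQ by simp
  also have "(\<Sum>l<q. \<tau> l * poly Q (of_real (e l))) = (\<Sum>l\<in>{i}. \<tau> l * poly Q (of_real (e l)))"
  proof (rule sum.mono_neutral_right)
    show "\<forall>l\<in>{..<q} - {i}. \<tau> l * poly Q (of_real (e l)) = 0"
      by (auto simp: Q_def poly_prod intro!: prod_zero)
  qed (use assms in auto)
  finally have eq: "\<tau> i * poly Q (of_real (e i)) = F (q - 1) N N" by simp
  have "norm (\<tau> i) \<le> (\<Sum>n\<in>{0..<int q}. norm (v i (n + N)) * norm (v i n))"
    unfolding \<tau>_def by (rule sum_norm_le) (simp add: norm_mult)
  also have "\<dots> \<le> (\<Sum>n\<in>{0..<int q}. (norm (v i n))\<^sup>2)"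
    by (rule bloch_sum_norm_mult[OF norm_z bloch_v[OF assms]])
  also have "\<dots> = 1"
  proof -
    have "complex_of_real (\<Sum>n\<in>{0..<int q}. (norm (v i n))\<^sup>2) = (\<Sum>n\<in>{0..<int q}. cnj (v i n) * v i n)"
      unfolding of_real_sum by (intro sum.cong refl) (metis complex_norm_square mult.commute)
    then have "complex_of_real (\<Sum>n\<in>{0..<int q}. (norm (v i n))\<^sup>2) = of_real 1"
      using orthonormal[OF assms assms] by simp
    then show ?thesis by (simp only: of_real_eq_iff)
  qed
  finally have \<tau>: "norm (\<tau> i) \<le> 1" .
  have "poly Q (of_real (e i)) = of_real (\<Prod>l\<in>{..<q} - {i}. e i - e l)"
    by (simp add: Q_def poly_prod)
  then have "norm (poly Q (of_real (e i))) = \<bar>\<Prod>l\<in>{..<q} - {i}. e i - e l\<bar>"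
    by (simp only: norm_of_real)
  moreover have "real q = norm (\<tau> i) * norm (poly Q (of_real (e i)))"
    using arg_cong[OF eq, of norm] norm_F_corner by (simp add: norm_mult)
  ultimately show ?thesis using \<tau> by (simp add: mult_left_le_one_le)
qed

end

section \<open>From simple levels to all levels\<close>

lemma pderiv_prod_linear:
  fixes e :: "nat \<Rightarrow> 'a::{idom}"
  assumes "i < n"
  shows "poly (pderiv (\<Prod>l<n. [:- e l, 1:])) (e i) = (\<Prod>l\<in>{..<n} - {i}. e i - e l)"
proof -
  have "poly (pderiv (\<Prod>l<n. [:- e l, 1:])) (e i) = (\<Sum>a<n. \<Prod>l\<in>{..<n} - {a}. e i - e l)"
    by (simp add: pderiv_prod poly_sum poly_prod pderiv_pCons)
  also have "\<dots> = (\<Sum>a\<in>{i}. \<Prod>l\<in>{..<n} - {a}. e i - e l)"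
    by (rule sum.mono_neutral_right) (use assms in \<open>auto intro!: prod_zero\<close>)
  finally show ?thesis by simp
qed

context hofstadter
begin

lemma bloch_scale: "bloch \<theta> z E u \<Longrightarrow> bloch \<theta> z E (\<lambda>n. c * u n)"
  unfolding bloch_def by (metis (no_types, lifting) distrib_left mult.left_commute)

text \<open>The phase and multiplier depend only on the level, so all its roots are energies of one
  self-adjoint operator and their normalized waves are orthonormal.\<close>

lemma bloch_basis_exists:
  assumes c: "\<bar>c\<bar> \<le> 4" and inj: "inj_on e {..<q}" and e: "\<And>i. i < q \<Longrightarrow> poly dpoly (e i) = c"
  shows "\<exists>\<theta> z v. bloch_basis p q \<theta> z v e"
proof -
  obtain \<theta> and z :: complex where z: "norm z = 1"
    and tr: "of_real c - of_real (2 * cos (2 * pi * real q * \<theta>)) = z + inverse z"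
    using bloch_phases[OF c] by metis
  have z0: "z \<noteq> 0" using z by auto
  have "\<exists>u. u \<noteq> (\<lambda>n. 0) \<and> bloch \<theta> z (of_real (e l)) u" if "l < q" for l
    using bloch_exists[OF z0, of "of_real (e l)" \<theta>] tr e[OF that] by (metis cpoly_of_real)
  then obtain u where u: "\<And>l. l < q \<Longrightarrow> u l \<noteq> (\<lambda>n. 0)" "\<And>l. l < q \<Longrightarrow> bloch \<theta> z (of_real (e l)) (u l)"
    by metis
  define S where "S l = (\<Sum>n\<in>{0..<int q}. (norm (u l n))\<^sup>2)" for l
  define v where "v l n = of_real (1 / sqrt (S l)) * u l n" for l n
  have v: "bloch \<theta> z (of_real (e l)) (v l)" if "l < q" for l
    unfolding v_def by (rule bloch_scale[OF u(2)[OF that]])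
  have "(\<Sum>n\<in>{0..<int q}. cnj (v l n) * v l' n) = (if l = l' then 1 else 0)" if "l < q" "l' < q" for l l'
  proof (cases "l = l'")
    case True
    have S: "S l > 0" unfolding S_def by (rule bloch_sum_pos[OF z u(2) u(1)]) (use that in auto)
    have "cnj (v l n) * v l n = of_real ((norm (u l n))\<^sup>2 / S l)" for n
    proof -
      have "cnj (v l n) * v l n = of_real ((norm (v l n))\<^sup>2)" by (metis complex_norm_square mult.commute)
      also have "(norm (v l n))\<^sup>2 = (norm (u l n))\<^sup>2 / S l"
        using S by (simp add: v_def norm_mult norm_divide power_mult_distrib power_divide)
      finally show ?thesis .
    qed
    then have "(\<Sum>n\<in>{0..<int q}. cnj (v l n) * v l n) = of_real (S l / S l)"
      by (simp only: S_def sum_divide_distrib of_real_sum)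
    then show ?thesis using True S by simp
  next
    case False
    then have "e l' \<noteq> e l" using inj that by (auto simp: inj_on_def)
    moreover have "(of_real (e l') - cnj (of_real (e l))) * (\<Sum>n\<in>{0..<int q}. cnj (v l n) * v l' n) = 0"
      by (rule bloch_self_adjoint[OF z v[OF that(2)] v[OF that(1)]])
    ultimately show ?thesis using False by simp
  qed
  then have "bloch_basis p q \<theta> z v e"
    using z v by unfold_locales auto
  then show ?thesis by blast
qed

lemma derivative_bound_distinct:
  assumes c: "\<bar>c\<bar> \<le> 4" and inj: "inj_on e {..<q}" and e: "dpoly - [:c:] = (\<Prod>i<q. [:- e i, 1:])" and i: "i < q"
  shows "real q \<le> \<bar>poly (pderiv dpoly) (e i)\<bar>"
proof -
  have "poly (dpoly - [:c:]) (e l) = 0" if "l < q" for l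
    unfolding e poly_prod using that by (auto intro: prod_zero)
  then obtain \<theta> z v where "bloch_basis p q \<theta> z v e"
    using bloch_basis_exists[OF c inj] by auto
  then have "real q \<le> \<bar>\<Prod>l\<in>{..<q} - {i}. e i - e l\<bar>"
    using i by (rule bloch_basis.derivative_bound)
  also have "(\<Prod>l\<in>{..<q} - {i}. e i - e l) = poly (pderiv (dpoly - [:c:])) (e i)"
    unfolding e by (rule pderiv_prod_linear[OF i, symmetric])
  finally show ?thesis by (simp add: pderiv_diff pderiv_pCons)
qed

text \<open>Levels with a multiple root are limits of levels with simple roots.\<close>

theorem dpoly_derivative_bound:
  assumes "\<bar>poly dpoly x\<bar> \<le> 4"
  shows "real q \<le> \<bar>poly (pderiv dpoly) x\<bar>"
proof (rule field_le_epsilon)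
  fix \<epsilon> :: real assume "\<epsilon> > 0"
  define c where "c = poly dpoly x"
  have "isCont (poly (pderiv dpoly)) x" by (rule poly_isCont)
  then obtain \<delta> where \<delta>: "\<delta> > 0"
    "\<And>y. \<bar>y - x\<bar> < \<delta> \<Longrightarrow> \<bar>poly (pderiv dpoly) y - poly (pderiv dpoly) x\<bar> < \<epsilon>"
    using \<open>\<epsilon> > 0\<close> unfolding continuous_at_real_range by (metis real_norm_def)
  have "pderiv dpoly \<noteq> 0"
    using degree_dpoly q_pos by (simp add: pderiv_eq_0_iff)
  then have "finite (poly dpoly ` {y. poly (pderiv dpoly) y = 0})"
    by (intro finite_imageI poly_roots_finite)
  \<comment> \<open>Critical values are finite in number, so some level \<open>c'\<close> in this
    window has simple roots only. The radius \<open>\<delta> ^ q\<close> forces one of them within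
    \<open>\<delta>\<close> of \<open>x\<close>, because the distances from \<open>x\<close> to the
    \<open>q\<close> roots multiply to \<open>|c - c'|\<close>.\<close>
  moreover have "infinite ({c - \<delta> ^ q <..< c + \<delta> ^ q} \<inter> {-4..4})"
  proof -
    have "\<delta> ^ q > 0" using \<delta>(1) by simp
    then have "max (c - \<delta> ^ q) (-4) < min (c + \<delta> ^ q) 4"
      using assms by (auto simp: c_def)
    then have "infinite {max (c - \<delta> ^ q) (-4) <..< min (c + \<delta> ^ q) 4}"
      by (rule infinite_Ioo)
    moreover have "{max (c - \<delta> ^ q) (-4) <..< min (c + \<delta> ^ q) 4} \<subseteq> {c - \<delta> ^ q <..< c + \<delta> ^ q} \<inter> {-4..4}"
      by auto
    ultimately show ?thesis using infinite_super by blast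
  qed
  ultimately obtain c' where c': "c' \<in> {c - \<delta> ^ q <..< c + \<delta> ^ q} \<inter> {-4..4}"
    "c' \<notin> poly dpoly ` {y. poly (pderiv dpoly) y = 0}"
    by (meson finite_subset subsetI)
  have c'4: "\<bar>c'\<bar> \<le> 4" using c'(1) by auto
  obtain e where e: "dpoly - [:c':] = (\<Prod>i<q. [:- e i, 1:])"
    using dpoly_factor[OF c'4] by blast
  have root: "poly dpoly (e l) = c'" if "l < q" for l
  proof -
    have "poly (dpoly - [:c':]) (e l) = 0"
      unfolding e poly_prod using that by (auto intro: prod_zero)
    then show ?thesis by simp
  qed
  have inj: "inj_on e {..<q}"
  proof (rule inj_onI, rule ccontr)
    fix i j assume ij: "i \<in> {..<q}" "j \<in> {..<q}" "e i = e j" "i \<noteq> j"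
    have "poly (pderiv (dpoly - [:c':])) (e i) = (\<Prod>l\<in>{..<q} - {i}. e i - e l)"
      unfolding e using ij by (intro pderiv_prod_linear) auto
    also have "\<dots> = 0" using ij by (auto intro!: prod_zero bexI[of _ j])
    finally have "poly (pderiv dpoly) (e i) = 0" by (simp add: pderiv_diff pderiv_pCons)
    then show False using c'(2) root[of i] ij by auto
  qed
  have "\<exists>i<q. \<bar>x - e i\<bar> < \<delta>"
  proof (rule ccontr)
    assume "\<not> ?thesis"
    then have "(\<Prod>i<q. \<delta>) \<le> (\<Prod>i<q. \<bar>x - e i\<bar>)"
      using \<delta>(1) by (intro prod_mono) auto
    also have "\<dots> = \<bar>poly (dpoly - [:c':]) x\<bar>" unfolding e poly_prod abs_prod by simp
    also have "\<dots> = \<bar>c - c'\<bar>" by (simp add: c_def)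
    finally show False using c'(1) by auto
  qed
  then obtain i where i: "i < q" "\<bar>e i - x\<bar> < \<delta>" by (auto simp: abs_minus_commute)
  have "real q \<le> \<bar>poly (pderiv dpoly) (e i)\<bar>"
    by (rule derivative_bound_distinct[OF c'4 inj e i(1)])
  then show "real q \<le> \<bar>poly (pderiv dpoly) x\<bar> + \<epsilon>" using \<delta>(2)[OF i(2)] by linarith
qed

end

subsection \<open>Bands of a polynomial\<close>

text \<open>Continuity controls the upper bound; the positive derivative controls the lower one,
  which matters when \<open>f v = - C\<close>.\<close>

lemma poly_extend_right:
  fixes f :: "real poly"
  assumes "poly (pderiv f) v > 0" "poly f v \<ge> - C" "poly f v < C"
  obtains h where "h > 0" "\<And>y. y \<in> {v..v + h} \<Longrightarrow> \<bar>poly f y\<bar> \<le> C"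
proof -
  obtain d1 where d1: "d1 > 0" "\<And>h. h > 0 \<Longrightarrow> h < d1 \<Longrightarrow> poly f v < poly f (v + h)"
    using DERIV_pos_inc_right[OF poly_DERIV assms(1)] by blast
  have "isCont (poly f) v" by (rule poly_isCont)
  then obtain d2 where d2: "d2 > 0" "\<And>y. \<bar>y - v\<bar> < d2 \<Longrightarrow> \<bar>poly f y - poly f v\<bar> < C - poly f v"
    unfolding continuous_at_real_range using assms(3) by (metis diff_gt_0_iff_gt real_norm_def)
  show thesis
  proof (rule that[of "min d1 d2 / 2"])
    fix y assume y: "y \<in> {v..v + min d1 d2 / 2}"
    have "min d1 d2 / 2 < d2" "min d1 d2 / 2 < d1" using d1(1) d2(1) by linarith+
    then have "\<bar>y - v\<bar> < d2" and d1': "y - v < d1" using y by auto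
    then have "poly f y < C" using d2(2)[of y] by linarith
    moreover have "poly f v \<le> poly f y"
      using d1(2)[of "y - v"] y d1' by (cases "y = v") auto
    ultimately show "\<bar>poly f y\<bar> \<le> C" using assms(2) by auto
  qed (use d1(1) d2(1) in auto)
qed

lemma sgn_prod_linear_sorted:
  fixes l :: "nat \<Rightarrow> real"
  assumes "k < n" "\<And>i. i \<le> k \<Longrightarrow> l i < x" "\<And>i. k < i \<Longrightarrow> i < n \<Longrightarrow> x < l i"
  shows "(-1) ^ (n - Suc k) * (\<Prod>i<n. x - l i) > 0"
proof -
  have split: "{..<n} = {..k} \<union> {k<..<n}" using assms(1) by auto
  have "(\<Prod>i<n. x - l i) = (\<Prod>i\<in>{..k}. x - l i) * (\<Prod>i\<in>{k<..<n}. - (l i - x))"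
    unfolding split by (subst prod.union_disjoint) auto
  also have "(\<Prod>i\<in>{k<..<n}. - (l i - x)) = (-1) ^ (n - Suc k) * (\<Prod>i\<in>{k<..<n}. l i - x)"
    by (subst prod_uminus) simp
  finally have "(-1) ^ (n - Suc k) * (\<Prod>i<n. x - l i)
      = ((-1) ^ (n - Suc k) * (-1) ^ (n - Suc k)) * ((\<Prod>i\<in>{..k}. x - l i) * (\<Prod>i\<in>{k<..<n}. l i - x))"
    by (simp only: mult_ac)
  also have "(-1) ^ (n - Suc k) * (-1) ^ (n - Suc k) = (1::real)"
    by (simp flip: power_add power_mult_distrib)
  finally show ?thesis using assms by (auto intro!: mult_pos_pos prod_pos)
qed

text \<open>The interface between operator theory and the geometry of bands: all gap estimates are
  derived from these properties of the negated discriminant.\<close>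

locale band_poly =
  fixes f :: "real poly" and N :: nat
  assumes N_pos: "N \<ge> 1"
    and f_odd: "\<And>x. poly f (- x) = - poly f x"
    and f_deriv: "\<And>x. \<bar>poly f x\<bar> \<le> 4 \<Longrightarrow> 1 \<le> \<bar>poly (pderiv f) x\<bar>"
    and f_level: "\<And>x. \<bar>poly f x\<bar> \<le> 4 \<Longrightarrow> \<bar>x\<bar> \<le> 4"
    and f_factor: "\<And>c. \<bar>c\<bar> \<le> 4 \<Longrightarrow> \<exists>e. f - [:c:] = (\<Prod>i<2 * N + 1. [:- e i, 1:])"
begin

definition q where "q = 2 * N + 1"

definition S :: "real set" where "S = {x. \<bar>poly f x\<bar> \<le> 4}"

lemma compact_S: "compact S"
proof -
  have "S = poly f -` {-4..4}" by (auto simp: S_def)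
  moreover have "closed (poly f -` {-4..4})"
    by (rule continuous_closed_vimage) (auto intro: poly_isCont)
  ultimately have "closed S" by simp
  moreover have "S \<subseteq> {-4..4}"
  proof
    fix x assume "x \<in> S"
    then show "x \<in> {-4..4}" using f_level[of x] by (simp add: S_def abs_le_iff)
  qed
  then have "bounded S" by (rule bounded_subset[OF bounded_closed_interval])
  ultimately show ?thesis by (simp add: compact_eq_bounded_closed)
qed

lemma deriv_nonzero: "x \<in> S \<Longrightarrow> poly (pderiv f) x \<noteq> 0"
  using f_deriv[of x] by (auto simp: S_def)

lemma component_interval:
  assumes "x \<in> S"
  obtains u v where "connected_component_set S x = {u..v}" "u \<le> x" "x \<le> v"
proof -
  have "compact (connected_component_set S x)"
    using compact_S connected_component_subset[of S x] unfolding compact_eq_bounded_closed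
    by (auto intro: closed_connected_component bounded_subset)
  then obtain u v where uv: "connected_component_set S x = {u..v}"
    using connected_compact_interval_1[of "connected_component_set S x"] by auto
  moreover have "x \<in> connected_component_set S x" using assms by simp
  ultimately show thesis using that[of u v] by auto
qed

text \<open>Were the value at the right end any other, the component could be prolonged to the
  right.\<close>

lemma right_end:
  assumes x: "x \<in> S" and C: "connected_component_set S x = {u..v}"
  shows "poly (pderiv f) v > 0 \<Longrightarrow> poly f v = 4" "poly (pderiv f) v < 0 \<Longrightarrow> poly f v = - 4"
proof -
  have xuv: "u \<le> x" "x \<le> v" using x C by (metis atLeastAtMost_iff connected_component_refl mem_Collect_eq)+
  have sub: "{u..v} \<subseteq> S" unfolding C[symmetric] by (rule connected_component_subset)
  then have "v \<in> S" using xuv by auto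
  then have v4: "\<bar>poly f v\<bar> \<le> 4" by (simp add: S_def)
  have no_ext: False if "h > 0" "\<And>y. y \<in> {v..v + h} \<Longrightarrow> \<bar>poly f y\<bar> \<le> 4" for h
  proof -
    have "{u..v + h} \<subseteq> S" using sub that by (force simp: S_def)
    then have "{u..v + h} \<subseteq> {u..v}" unfolding C[symmetric] using xuv that(1)
      by (intro connected_component_maximal) auto
    then show False using that(1) xuv by auto
  qed
  show "poly f v = 4" if "poly (pderiv f) v > 0"
  proof (rule ccontr)
    assume "poly f v \<noteq> 4"
    then show False using poly_extend_right[of f v 4] that v4 no_ext by (metis abs_le_iff linorder_not_less minus_le_iff order_antisym)
  qed
  show "poly f v = - 4" if "poly (pderiv f) v < 0"
  proof (rule ccontr)
    assume "poly f v \<noteq> - 4"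
    then have "poly (- f) v < 4" using v4 by simp
    moreover have "poly (pderiv (- f)) v > 0" using that by (simp add: pderiv_minus)
    moreover have "poly (- f) v \<ge> - 4" using v4 by simp
    ultimately obtain h where "h > 0" "\<And>y. y \<in> {v..v + h} \<Longrightarrow> \<bar>poly (- f) y\<bar> \<le> 4"
      using poly_extend_right[of "- f" v 4] by metis
    then show False by (intro no_ext[of h]) auto
  qed
qed

lemma uminus_S: "uminus ` S = S"
  using f_odd by (force simp: S_def image_iff intro: exI[of _ "- _"])

lemma component_uminus:
  assumes x: "x \<in> S" and C: "connected_component_set S x = {u..v}"
  shows "connected_component_set S (- x) = {- v..- u}"
proof -
  have *: "uminus ` connected_component_set S y \<subseteq> connected_component_set S (- y)" if "y \<in> S" for y
  proof (rule connected_component_maximal)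
    show "connected (uminus ` connected_component_set S y)"
      by (intro connected_continuous_image continuous_intros) auto
    show "uminus ` connected_component_set S y \<subseteq> S"
      using connected_component_subset[of S y] uminus_S by blast
  qed (use that in auto)
  have "- x \<in> S" using x uminus_S by blast
  from *[OF this] have "uminus ` (uminus ` connected_component_set S (- x)) \<subseteq> uminus ` connected_component_set S x"
    by (intro image_mono) simp
  then have "connected_component_set S (- x) \<subseteq> uminus ` connected_component_set S x"
    by (simp add: image_image)
  with *[OF x] have "connected_component_set S (- x) = uminus ` connected_component_set S x" by simp
  then show ?thesis by (simp add: C)
qed

lemma pderiv_even: "poly (pderiv f) (- x) = poly (pderiv f) x"
proof -
  have "((\<lambda>x. - poly f (- x)) has_real_derivative poly (pderiv f) (- x)) (at x)"
    by (auto intro!: derivative_eq_intros)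
  then have "(poly f has_real_derivative poly (pderiv f) (- x)) (at x)"
    by (simp add: f_odd)
  then show ?thesis using poly_DERIV DERIV_unique by blast
qed

text \<open>Reflection at \<open>0\<close> makes the left end the right end of the mirrored
  component, with the same derivative and the opposite value.\<close>

lemma left_end:
  assumes x: "x \<in> S" and C: "connected_component_set S x = {u..v}"
  shows "poly (pderiv f) u > 0 \<Longrightarrow> poly f u = - 4" "poly (pderiv f) u < 0 \<Longrightarrow> poly f u = 4"
proof -
  have "- x \<in> S" using x uminus_S by blast
  from right_end[OF this component_uminus[OF x C]]
  show "poly (pderiv f) u > 0 \<Longrightarrow> poly f u = - 4" "poly (pderiv f) u < 0 \<Longrightarrow> poly f u = 4"
    by (simp_all add: pderiv_even f_odd)
qed

text \<open>Zeros and bands are numbered from \<open>0\<close> to \<open>2N\<close>; the band \<open>B\<^sub>j\<close> of the paper is \<open>B (N + j) = {u (N + j)..v (N + j)}\<close>.\<close>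

definition L :: "real list" where "L = sorted_list_of_set {x. poly f x = 0}"

definition l :: "nat \<Rightarrow> real" where "l k = L ! k"

lemma f_nonzero: "f \<noteq> 0"
  using f_deriv[of 0] f_odd[of 0] by auto

text \<open>\<open>f_factor\<close> lists \<open>q\<close> roots with multiplicity, so
  \<open>q\<close> distinct points of the level must exhaust the list.\<close>

lemma poly_eq_prod:
  assumes c: "\<bar>c\<bar> \<le> 4" and inj: "inj_on x {..<q}" and root: "\<And>i. i < q \<Longrightarrow> poly f (x i) = c"
  shows "f - [:c:] = (\<Prod>i<q. [:- x i, 1:])"
proof -
  obtain e where e: "f - [:c:] = (\<Prod>i<q. [:- e i, 1:])" using f_factor[OF c] unfolding q_def[symmetric] by blast
  have "x ` {..<q} \<subseteq> e ` {..<q}"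
  proof
    fix y assume "y \<in> x ` {..<q}"
    then have "poly (f - [:c:]) y = 0" using root by auto
    then show "y \<in> e ` {..<q}" unfolding e poly_prod by auto
  qed
  moreover have "card (x ` {..<q}) = q" by (simp add: card_image[OF inj])
  moreover have "card (e ` {..<q}) \<le> q" using card_image_le[of "{..<q}" e] by simp
  ultimately have eq: "x ` {..<q} = e ` {..<q}" by (intro card_subset_eq) (auto intro: le_antisym dest: card_mono[rotated])
  then have "card (e ` {..<q}) = card {..<q}" using \<open>card (x ` {..<q}) = q\<close> by simp
  then have "inj_on e {..<q}" by (intro eq_card_imp_inj_on) auto
  then have "(\<Prod>i<q. [:- e i, 1:]) = (\<Prod>y\<in>x ` {..<q}. [:- y, 1:])"
    unfolding eq by (subst prod.reindex) (auto simp: o_def)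
  then show ?thesis unfolding e by (subst (asm) prod.reindex[OF inj]) (simp add: o_def)
qed

text \<open>A repeated factor would make the derivative vanish at a zero, against
  \<open>f_deriv\<close>.\<close>

lemma card_zeros: "card {x. poly f x = 0} = q"
proof -
  obtain e where e: "f - [:0:] = (\<Prod>i<q. [:- e i, 1:])" using f_factor[of 0] unfolding q_def[symmetric] by auto
  have fx: "poly f x = (\<Prod>i<q. x - e i)" for x
    using arg_cong[OF e, of "\<lambda>p. poly p x"] by (simp add: poly_prod)
  have inj: "inj_on e {..<q}"
  proof (rule inj_onI, rule ccontr)
    fix i j assume ij: "i \<in> {..<q}" "j \<in> {..<q}" "e i = e j" "i \<noteq> j"
    have "poly (pderiv f) (e i) = (\<Sum>a<q. \<Prod>l\<in>{..<q} - {a}. e i - e l)"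
      using e by (simp add: pderiv_prod poly_sum poly_prod pderiv_pCons)
    also have "\<dots> = 0"
    proof (rule sum.neutral, rule ballI)
      fix a assume "a \<in> {..<q}"
      have "i \<in> {..<q} - {a} \<or> j \<in> {..<q} - {a}" using ij by auto
      then show "(\<Prod>l\<in>{..<q} - {a}. e i - e l) = 0"
      proof
        assume "i \<in> {..<q} - {a}"
        then show ?thesis by (intro prod_zero bexI[of _ i]) auto
      next
        assume "j \<in> {..<q} - {a}"
        then show ?thesis using ij(3) by (intro prod_zero bexI[of _ j]) auto
      qed
    qed
    finally have "poly (pderiv f) (e i) = 0" .
    moreover have "poly f (e i) = 0" unfolding fx using ij by (auto intro!: prod_zero)
    ultimately show False using f_deriv[of "e i"] by simp
  qed
  have "{x. poly f x = 0} = e ` {..<q}" unfolding fx by auto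
  then show ?thesis by (simp add: card_image[OF inj])
qed

lemma length_L: "length L = q" and set_L: "set L = {x. poly f x = 0}"
  and sorted_L: "sorted_wrt (<) L"
  using card_zeros poly_roots_finite[OF f_nonzero] by (simp_all add: L_def)

lemma l_less: "i < k \<Longrightarrow> k < q \<Longrightarrow> l i < l k"
  unfolding l_def using sorted_L length_L by (auto intro: sorted_wrt_nth_less)

lemma l_zero: "k < q \<Longrightarrow> poly f (l k) = 0"
  unfolding l_def using set_L length_L nth_mem[of k L] by simp

lemma zero_l:
  assumes "poly f x = 0"
  shows "\<exists>k<q. x = l k"
proof -
  have "x \<in> set L" unfolding set_L using assms by simp
  then show ?thesis unfolding l_def in_set_conv_nth length_L by blast
qed

lemma inj_l: "inj_on l {..<q}"
proof (rule inj_onI, rule ccontr)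
  fix i j assume "i \<in> {..<q}" "j \<in> {..<q}" "l i = l j" "i \<noteq> j"
  then show False using l_less[of i j] l_less[of j i] by (auto simp: neq_iff)
qed

lemma f_prod: "poly f x = (\<Prod>i<q. x - l i)"
  using arg_cong[OF poly_eq_prod[of 0 l], of "\<lambda>p. poly p x"] inj_l l_zero by (simp add: poly_prod)

lemma l_uminus:
  assumes "k < q"
  shows "l (2 * N - k) = - l k"
proof -
  have "rev (map uminus L) = L"
  proof (rule sorted_distinct_set_unique)
    show "sorted (rev (map uminus L))"
      using sorted_L by (auto simp: sorted_wrt_rev sorted_wrt_map elim: sorted_wrt_mono_rel[rotated])
    show "distinct (rev (map uminus L))" using sorted_L
      by (simp add: distinct_map strict_sorted_iff)
    show "set (rev (map uminus L)) = set L"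
      unfolding set_rev set_map set_L by (auto simp: f_odd image_iff) (metis add.inverse_inverse f_odd neg_equal_0_iff_equal)
  qed (use sorted_L strict_sorted_iff in auto)
  then have "l (2 * N - k) = rev (map uminus L) ! (2 * N - k)" by (simp add: l_def)
  also have "\<dots> = - l k" using assms by (simp add: rev_nth length_L l_def q_def)
  finally show ?thesis .
qed

lemma l_N: "l N = 0"
  using l_uminus[of N] by (simp add: q_def)

lemma l_S: "k < q \<Longrightarrow> l k \<in> S"
  by (simp add: S_def l_zero)

definition B :: "nat \<Rightarrow> real set" where "B k = connected_component_set S (l k)"
definition u :: "nat \<Rightarrow> real" where "u k = Inf (B k)"
definition v :: "nat \<Rightarrow> real" where "v k = Sup (B k)"

lemma B_eq:
  assumes "k < q"
  shows "B k = {u k..v k}" "u k \<le> l k" "l k \<le> v k"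
proof -
  obtain a b where "B k = {a..b}" "a \<le> l k" "l k \<le> b"
    using component_interval[OF l_S[OF assms]] unfolding B_def by metis
  then show "B k = {u k..v k}" "u k \<le> l k" "l k \<le> v k" by (simp_all add: u_def v_def)
qed

lemma B_S: "B k \<subseteq> S"
  unfolding B_def by (rule connected_component_subset)

lemma B_zero_unique:
  assumes "k < q" "x \<in> B k" "poly f x = 0"
  shows "x = l k"
proof (rule ccontr)
  assume "x \<noteq> l k"
  then have lt: "min x (l k) < max x (l k)" by auto
  have "poly f (min x (l k)) = poly f (max x (l k))"
    using assms l_zero[OF assms(1)] by (simp add: min_def max_def)
  then obtain y where y: "min x (l k) < y" "y < max x (l k)" "poly (pderiv f) y = 0"
    using poly_MVT[OF lt, of f] lt by auto
  have "y \<in> B k" using y assms(2) B_eq[OF assms(1)] by auto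
  then show False using y(3) deriv_nonzero B_S by blast
qed

text \<open>The modulus \<open>4\<close> comes from \<open>right_end\<close> and
  \<open>left_end\<close>. The sign counts zeros to the right: \<open>2N - k\<close> for
  \<open>v k\<close>, one more for \<open>u k\<close>. The product \<open>f * f'\<close> is positive
  at \<open>v k\<close> since \<open>|f|\<close> leaves the band increasing.\<close>

lemma edge_values:
  assumes "k < q"
  shows "poly f (v k) = 4 * (-1) ^ (2 * N - k)" "poly f (u k) = - 4 * (-1) ^ (2 * N - k)"
    "poly f (v k) * poly (pderiv f) (v k) > 0" "u k < l k" "l k < v k"
    "\<And>i. i < k \<Longrightarrow> v i < u k"
proof -
  have C: "connected_component_set S (l j) = {u j..v j}" if "j < q" for j
    using B_eq[OF that] by (simp add: B_def)
  have v_S: "v j \<in> S" "u j \<in> S" if "j < q" for j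
    using B_S[of j] B_eq[OF that] by auto
  have vpm: "\<bar>poly f (v j)\<bar> = 4 \<and> poly f (v j) * poly (pderiv f) (v j) > 0" if "j < q" for j
    using right_end[OF l_S[OF that] C[OF that]] deriv_nonzero[OF v_S(1)[OF that]]
    by (cases "poly (pderiv f) (v j) > 0") auto
  have upm: "\<bar>poly f (u j)\<bar> = 4" if "j < q" for j
    using left_end[OF l_S[OF that] C[OF that]] deriv_nonzero[OF v_S(2)[OF that]]
    by (cases "poly (pderiv f) (u j) > 0") auto
  have ne: "u j < l j" "l j < v j" if "j < q" for j
    using upm[OF that] vpm[OF that] B_eq(2,3)[OF that] l_zero[OF that]
    by (force simp: order.order_iff_strict)+
  have l_out: "l i \<notin> B j" if "i < q" "j < q" "i \<noteq> j" for i j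
    using B_zero_unique[OF that(2) _ l_zero[OF that(1)]] inj_l that by (auto simp: inj_on_def)
  have ord: "v i < u j" if "i < j" "j < q" for i j
  proof (rule ccontr)
    assume "\<not> v i < u j"
    have "B i \<inter> B j \<noteq> {}"
    proof -
      have "u j \<in> B i"
      proof -
        have "u i \<le> u j"
        proof (rule ccontr)
          assume "\<not> u i \<le> u j"
          then have "l i \<in> B j" using l_less[OF that] ne[of i] ne[OF that(2)] B_eq[OF that(2)] that by auto
          then show False using l_out[of i j] that by auto
        qed
        then show ?thesis using \<open>\<not> v i < u j\<close> B_eq[of i] that by auto
      qed
      moreover have "u j \<in> B j" using B_eq[OF that(2)] by auto
      ultimately show ?thesis by auto
    qed
    then have "B i = B j" unfolding B_def by (simp add: connected_component_nonoverlap)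
    moreover have "l i \<in> B i" using B_eq[of i] that by auto
    ultimately have "l i \<in> B j" by blast
    then show False using l_out[of i j] that by auto
  qed
  show "\<And>i. i < k \<Longrightarrow> v i < u k" using ord assms by blast
  show "u k < l k" "l k < v k" using ne assms by blast+
  show "poly f (v k) * poly (pderiv f) (v k) > 0" using vpm assms by blast
  have below: "l i < u k" if "i < k" for i using ord[OF that assms] ne(2)[of i] that assms by simp
  have above: "v k < l i" if "k < i" "i < q" for i using ord[OF that] ne(1)[OF that(2)] by simp
  have sv: "(-1) ^ (2 * N - k) * poly f (v k) > 0"
  proof -
    have "(-1) ^ (q - Suc k) * (\<Prod>i<q. v k - l i) > 0"
    proof (rule sgn_prod_linear_sorted)
      show "l i < v k" if "i \<le> k" for i
      proof (cases "i = k")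
        case False
        then show ?thesis using below[of i] ne[OF assms] that by linarith
      qed (use ne[OF assms] in auto)
    qed (use above assms in auto)
    then show ?thesis unfolding f_prod by (simp add: q_def)
  qed
  have "(-1) ^ (2 * N - k) * poly f (u k) < 0"
  \<comment> \<open>\<open>sgn_prod_linear_sorted\<close> wants at least one zero to the left, which
    the leftmost band does not have.\<close>
  proof (cases k)
    case 0
    have "(-1) ^ (q - Suc 0) * (\<Prod>i<q. - (l i - u k)) < 0"
    proof -
      have "(\<Prod>i<q. l i - u k) > 0"
      proof (rule prod_pos)
        fix i assume i: "i \<in> {..<q}"
        show "0 < l i - u k"
        proof (cases "i = k")
          case False
          then show ?thesis using above[of i] ne[OF assms] 0 i by auto
        qed (use ne[OF assms] in auto)
      qed
      then show ?thesis by (subst prod_uminus) (simp add: q_def)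
    qed
    then show ?thesis unfolding f_prod 0 by (simp add: q_def)
  next
    case (Suc k')
    have "(-1) ^ (q - Suc k') * (\<Prod>i<q. u k - l i) > 0"
    proof (rule sgn_prod_linear_sorted)
      show "u k < l i" if "k' < i" "i < q" for i
      proof (cases "i = k")
        case False
        then show ?thesis using above[of i] ne[OF assms] Suc that by linarith
      qed (use ne[OF assms] in auto)
    qed (use below Suc assms in auto)
    moreover have "q - Suc k' = Suc (2 * N - k)" using Suc assms by (simp add: q_def)
    ultimately show ?thesis unfolding f_prod by simp
  qed
  with sv vpm[OF assms] upm[OF assms]
  show "poly f (v k) = 4 * (-1) ^ (2 * N - k)" "poly f (u k) = - 4 * (-1) ^ (2 * N - k)"
    by (cases "even (2 * N - k)"; auto)+
qed

end

section \<open>The two parts of a band and the gap inequality\<close>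

lemma less_mult_left_bound:
  fixes a d P M :: real
  assumes "a < 4 * d * P" "P \<le> M" "d > 0"
  shows "a < 4 * d * M"
  using assms(1) mult_left_mono[OF assms(2), of "4 * d"] assms(3) by linarith

lemma zero_less_mult_pos_nonneg:
  fixes a b :: real
  assumes "a * b > 0" "a \<ge> 0"
  shows "b > 0"
  using assms by (auto simp: zero_less_mult_iff)

text \<open>With \<open>r = w' / w\<close> the hypothesis reads
  \<open>1 \<le> (exp 1 * r) * exp r\<close>. If \<open>exp 1 * r\<close> were below
  \<open>(sqrt 5 - 1) / 2\<close>, about \<open>0.618\<close>, then \<open>r < 1/4\<close> and the
  right side would be at most \<open>0.62 * 4/3 < 1\<close>.\<close>

lemma golden_ratio_bound:
  fixes w w' :: real
  assumes w: "w > 0" "w' > 0" and le: "w / w' \<le> exp (1 + w' / w)"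
  shows "w \<le> 2 * exp 1 / (sqrt 5 - 1) * w'"
proof (rule ccontr)
  define r where "r = w' / w"
  have r: "r > 0" using w by (simp add: r_def)
  have "sqrt 5 \<le> sqrt (2.24\<^sup>2)" by (rule real_sqrt_le_mono) (simp add: power2_eq_square)
  then have sqrt5: "sqrt 5 \<le> 2.24" "sqrt 5 > 1" by simp_all
  have e: "exp 1 \<ge> (5/2 :: real)" using exp_lower_Taylor_quadratic[of 1] by simp
  assume "\<not> ?thesis"
  then have "2 * exp 1 / (sqrt 5 - 1) * w' < w" by simp
  then have "2 * exp 1 * w' < w * (sqrt 5 - 1)" using sqrt5(2) by (simp add: field_simps)
  then have er: "2 * exp 1 * r < sqrt 5 - 1" using w by (simp add: r_def field_simps)
  then have er': "exp 1 * r < 0.62" using sqrt5 by simp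
  moreover have "5/2 * r \<le> exp 1 * r" using e r by (intro mult_right_mono) auto
  ultimately have r4: "r < 1/4" by simp
  have "1 - r \<le> exp (- r)" using exp_ge_add_one_self[of "- r"] by simp
  then have "3/4 \<le> exp (- r)" using r4 by linarith
  then have "exp r \<le> 4/3" by (simp add: exp_minus field_simps)
  have "1 / r \<le> exp (1 + r)" using le by (simp add: r_def)
  then have "1 \<le> (exp 1 * r) * exp r" using r by (simp add: exp_add field_simps)
  also have "\<dots> \<le> 0.62 * (4/3)"
    using er' r \<open>exp r \<le> 4/3\<close> by (intro mult_mono) auto
  finally show False by simp
qed

context band_poly
begin

lemma v_pos: "u N < 0" "v N > 0" and u_uminus: "k < q \<Longrightarrow> u (2 * N - k) = - v k"
proof -
  have "N < q" by (simp add: q_def)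
  then show "u N < 0" "v N > 0" using edge_values[of N] l_N by auto
next
  assume k: "k < q"
  then have k': "2 * N - k < q" by (simp add: q_def)
  have "connected_component_set S (- l k) = {- v k..- u k}"
    by (rule component_uminus[OF l_S[OF k]]) (use B_eq[OF k] in \<open>simp add: B_def\<close>)
  then have "{u (2 * N - k)..v (2 * N - k)} = {- v k..- u k}"
    unfolding B_eq(1)[OF k', symmetric] B_def l_uminus[OF k] .
  then show "u (2 * N - k) = - v k"
    using edge_values(4,5)[OF k] unfolding Icc_eq_Icc by linarith
qed

lemma edges_mono:
  assumes "k < q"
  shows "i \<le> k \<Longrightarrow> v i \<le> v k" "i \<le> k \<Longrightarrow> u i \<le> u k"
proof -
  show "v i \<le> v k" if "i \<le> k"
    using that edge_values(4-6)[OF assms] by (cases "i = k") (auto simp: less_le intro: order.trans less_imp_le)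
  show "u i \<le> u k" if "i \<le> k"
  proof (cases "i = k")
    case False
    then have "v i < u k" using edge_values(6)[OF assms] that by simp
    moreover have "u i < v i" using edge_values(4,5)[of i] that assms by linarith
    ultimately show ?thesis by simp
  qed simp
qed

lemma v_le_4: "k < q \<Longrightarrow> v k \<le> 4"
  using f_level[of "v k"] B_S[of k] B_eq[of k] edge_values(4,5)[of k] by (auto simp: S_def subset_eq)

text \<open>The product of the factors \<open>(u - l\<^sub>i) / (v - l\<^sub>i)\<close> over the other zeros is controlled by
  \<open>f' / f \<ge> 0\<close> at \<open>v\<close>.\<close>

lemma band_parts_ratio:
  assumes k: "k < q"
  shows "v k - l k \<le> 2 * exp 1 / (sqrt 5 - 1) * (l k - u k)"
proof (rule golden_ratio_bound)
  note ev = edge_values[OF k]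
  show pos: "0 < v k - l k" "0 < l k - u k" using ev by auto
  define I where "I = {..<q} - {k}"
  have fprod: "poly f x = (x - l k) * (\<Prod>i\<in>I. x - l i)" for x
    unfolding f_prod I_def using k by (subst prod.remove[of _ k]) auto
  have nz: "v k - l i \<noteq> 0 \<and> (u k - l i) / (v k - l i) > 0" if "i \<in> I" for i
  proof (cases "i < k")
    case True
    then have "l i < u k" using ev(6)[OF True] edge_values(5)[of i] k by simp
    then show ?thesis using ev by (auto intro!: divide_pos_pos)
  next
    case False
    then have i: "k < i" "i < q" using that by (auto simp: I_def)
    have "v k < l i" using edge_values(6)[OF i(2) i(1)] edge_values(4)[OF i(2)] by simp
    then show ?thesis using ev by (auto intro!: divide_neg_neg)
  qed
  have deriv: "poly (pderiv f) (v k) = (\<Sum>i<q. \<Prod>j\<in>{..<q} - {i}. v k - l j)"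
  proof -
    have "f - [:0:] = (\<Prod>i<q. [:- l i, 1:])"
      by (rule poly_eq_prod) (use inj_l l_zero in auto)
    then have "poly (pderiv (f - [:0:])) (v k) = poly (pderiv (\<Prod>i<q. [:- l i, 1:])) (v k)" by (simp only:)
    then show ?thesis by (simp add: pderiv_prod poly_sum poly_prod pderiv_pCons)
  qed
  have vk: "v k - l i \<noteq> 0" if "i < q" for i using nz[of i] pos that by (cases "i = k") (auto simp: I_def)
  have "(\<Prod>j\<in>{..<q} - {i}. v k - l j) = poly f (v k) / (v k - l i)" if "i < q" for i
    unfolding f_prod using that vk[OF that] by (subst prod.remove[of "{..<q}" i]) auto
  then have deriv': "poly (pderiv f) (v k) = poly f (v k) * (\<Sum>i<q. 1 / (v k - l i))"
    unfolding deriv by (simp add: sum_distrib_left)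
  \<comment> \<open>At the right edge \<open>f * f' > 0\<close>; dividing by the square of
    \<open>f\<close> leaves a positive logarithmic derivative.\<close>
  have "poly f (v k) * poly f (v k) * (\<Sum>i<q. 1 / (v k - l i)) > 0"
    using ev(3) unfolding deriv' by (simp only: mult.assoc)
  moreover have "poly f (v k) * poly f (v k) \<ge> 0" by simp
  ultimately have "(\<Sum>i<q. 1 / (v k - l i)) > 0" by (rule zero_less_mult_pos_nonneg)
  then have sum: "(\<Sum>i\<in>I. 1 / (v k - l i)) \<ge> - (1 / (v k - l k))"
    unfolding I_def using k by (subst (asm) sum.remove[of _ k]) auto
  \<comment> \<open>Both edges lie at modulus \<open>4\<close>, so the ratio of the two parts equals
    the inverse ratio of the products over the other zeros.\<close>
  have "\<bar>poly f (u k)\<bar> = 4" "\<bar>poly f (v k)\<bar> = 4" using ev(1,2) by (auto simp: abs_mult)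
  then have "(l k - u k) * \<bar>\<Prod>i\<in>I. u k - l i\<bar> = (v k - l k) * \<bar>\<Prod>i\<in>I. v k - l i\<bar>"
    and "\<bar>\<Prod>i\<in>I. v k - l i\<bar> \<noteq> 0"
    using pos unfolding fprod abs_mult by auto
  then have "(v k - l k) / (l k - u k) = \<bar>\<Prod>i\<in>I. u k - l i\<bar> / \<bar>\<Prod>i\<in>I. v k - l i\<bar>"
    using pos by (simp add: field_simps)
  also have "\<dots> = \<bar>\<Prod>i\<in>I. (u k - l i) / (v k - l i)\<bar>"
    by (simp only: prod_dividef abs_divide)
  also have "\<dots> = (\<Prod>i\<in>I. (u k - l i) / (v k - l i))"
    using nz by (intro abs_of_nonneg prod_nonneg) (auto intro: less_imp_le)
  \<comment> \<open>The bound \<open>1 + s \<le> exp s\<close> in each factor turns the product into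
    the logarithmic derivative without its \<open>k\<close>-th term. That term, times the band
    length, is \<open>1 + (l k - u k) / (v k - l k)\<close>.\<close>
  also have "\<dots> \<le> (\<Prod>i\<in>I. exp (- (v k - u k) * (1 / (v k - l i))))"
  proof (rule prod_mono)
    fix i assume i: "i \<in> I"
    have "(u k - l i) / (v k - l i) = 1 + (- (v k - u k) * (1 / (v k - l i)))"
      using nz[OF i] by (simp add: field_simps)
    then show "0 \<le> (u k - l i) / (v k - l i) \<and> (u k - l i) / (v k - l i) \<le> exp (- (v k - u k) * (1 / (v k - l i)))"
      using nz[OF i] exp_ge_add_one_self[of "- (v k - u k) * (1 / (v k - l i))"] by linarith
  qed
  also have "\<dots> = exp (- (v k - u k) * (\<Sum>i\<in>I. 1 / (v k - l i)))"
    by (subst exp_sum[symmetric]) (simp_all add: I_def sum_distrib_left)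
  also have "\<dots> \<le> exp (1 + (l k - u k) / (v k - l k))"
  proof -
    have "(v k - u k) * (- (1 / (v k - l k))) \<le> (v k - u k) * (\<Sum>i\<in>I. 1 / (v k - l i))"
      using sum pos by (intro mult_left_mono) auto
    moreover have "(v k - u k) * (1 / (v k - l k)) = 1 + (l k - u k) / (v k - l k)"
      using pos by (simp add: field_simps)
    ultimately show ?thesis
      unfolding exp_le_cancel_iff mult_minus_left mult_minus_right by linarith
  qed
  finally show "(v k - l k) / (l k - u k) \<le> exp (1 + (l k - u k) / (v k - l k))" .
qed

text \<open>Let \<open>x\<^sub>i\<close> be the edges at which \<open>f\<close> takes the same value as at the gap edge \<open>\<alpha> = v (N + j)\<close>. The
  derivative at \<open>\<alpha>\<close> is the gap length times the product of the other \<open>\<alpha> - x\<^sub>i\<close>, while the product of all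
  \<open>z - x\<^sub>i\<close> is \<open>\<plusminus>4\<close>. Moving the base point from \<open>z\<close> to \<open>\<alpha>\<close>, the factors with indices \<open>i\<close> and \<open>2N - 1 - i\<close>
  compensate each other; only those with \<open>N - j - 2 \<le> i < N + j\<close> remain to be estimated.\<close>

lemma gap_inequality:
  assumes j: "j < N" and z: "poly f z = 0" "0 \<le> z" "z < v (N + j)"
    and \<rho>: "\<And>i y. N \<le> i + j + 2 \<Longrightarrow> i < N + j \<Longrightarrow> y \<in> {u i, v i} \<Longrightarrow> \<bar>v (N + j) - y\<bar> \<le> \<rho> i * \<bar>z - y\<bar>"
    and \<rho>0: "\<And>i. \<rho> i \<ge> 0"
  shows "(v (N + j) - z)\<^sup>2 < 4 * (u (N + j + 1) - v (N + j)) * (\<Prod>i\<in>{i. N \<le> i + j + 2 \<and> i < N + j}. \<rho> i)"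
proof -
  define k where "k = N + j"
  have k: "k < q" "k + 1 < q" using j by (simp_all add: k_def q_def)
  define \<alpha> \<beta> where "\<alpha> = v k" and "\<beta> = u (k + 1)"
  define c where "c = poly f \<alpha>"
  have c4: "\<bar>c\<bar> = 4" using edge_values(1)[OF k(1)] by (simp add: c_def \<alpha>_def abs_mult)
  have exp: "2 * N - k = Suc (2 * N - (k + 1))" using k by (simp add: q_def)
  have c\<beta>: "poly f \<beta> = c" unfolding c_def \<alpha>_def \<beta>_def edge_values(1)[OF k(1)] edge_values(2)[OF k(2)] exp by simp
  have \<alpha>\<beta>: "\<alpha> < \<beta>" using edge_values(6)[OF k(2), of k] by (simp add: \<alpha>_def \<beta>_def)
  \<comment> \<open>Exactly one edge of each band lies at level \<open>c\<close>, and which one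
    alternates; hence the hypothesis on \<open>\<rho>\<close> covers both edges.\<close>
  define x where "x i = (if i = k + 1 then \<beta> else if poly f (v i) = c then v i else u i)" for i
  have x_uv: "x i \<in> {u i, v i}" for i by (simp add: x_def \<beta>_def)
  have x_root: "poly f (x i) = c" if "i < q" for i
  proof (cases "poly f (v i) = c")
    case False
    have "\<bar>poly f (v i)\<bar> = 4" "poly f (u i) = - poly f (v i)"
      using edge_values(1,2)[OF that] by (simp_all add: abs_mult)
    then have "poly f (u i) = c" using False c4 by linarith
    then show ?thesis using c\<beta> by (simp add: x_def)
  qed (simp add: x_def c\<beta>)
  have x_k: "x k = \<alpha>" "x (k + 1) = \<beta>" by (simp_all add: x_def c_def \<alpha>_def)
  have x_bounds: "u i \<le> x i" "x i \<le> v i" if "i < q" for i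
    using x_uv[of i] edge_values(4,5)[OF that] by auto
  have x_less: "x i < x i'" if "i < i'" "i' < q" for i i'
    using x_bounds[of i] x_bounds[of i'] edge_values(6)[OF that(2,1)] that by linarith
  have inj_x: "inj_on x {..<q}"
  proof (rule inj_onI, rule ccontr)
    fix i i' assume "i \<in> {..<q}" "i' \<in> {..<q}" "x i = x i'" "i \<noteq> i'"
    then show False using x_less[of i i'] x_less[of i' i] by (auto simp: neq_iff)
  qed
  have factor: "f - [:c:] = (\<Prod>i<q. [:- x i, 1:])"
    by (rule poly_eq_prod) (use c4 inj_x x_root in auto)
  define A where "A = {..<q} - {k, k + 1}"
  have A: "finite A" "k \<notin> A" "k + 1 \<notin> A" "{..<q} = insert k (insert (k + 1) A)"
    using k by (auto simp: A_def)
  define Q where "Q = (\<Prod>i\<in>A. \<bar>\<alpha> - x i\<bar>)"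
  define Z where "Z = (\<Prod>i\<in>A. \<bar>z - x i\<bar>)"
  have "poly (pderiv f) \<alpha> = (\<Prod>i\<in>{..<q} - {k}. x k - x i)"
    using pderiv_prod_linear[OF k(1), of x] unfolding factor[symmetric] x_k(1) by (simp add: pderiv_diff pderiv_pCons)
  also have "{..<q} - {k} = insert (k + 1) A" using k by (auto simp: A_def)
  finally have "poly (pderiv f) \<alpha> = (\<alpha> - \<beta>) * (\<Prod>i\<in>A. \<alpha> - x i)"
    using A x_k by simp
  then have "\<bar>poly (pderiv f) \<alpha>\<bar> = (\<beta> - \<alpha>) * Q"
    using \<alpha>\<beta> by (simp add: abs_mult Q_def abs_prod)
  then have Q1: "1 \<le> (\<beta> - \<alpha>) * Q"
    using f_deriv[of \<alpha>] c4 by (simp add: c_def)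
  have "\<bar>poly (f - [:c:]) z\<bar> = (\<alpha> - z) * (\<beta> - z) * Z"
    unfolding factor poly_prod A(4) using A z \<alpha>\<beta> x_k
    by (simp add: abs_mult Z_def abs_prod \<alpha>_def k_def mult_ac)
  then have Z4: "(\<alpha> - z) * (\<beta> - z) * Z = 4" using z(1) c4 by simp
  \<comment> \<open>\<open>Lo\<close> and \<open>M\<close> are exchanged by the map from
    \<open>i\<close> to \<open>2N - 1 - i\<close>, \<open>U\<close> holds the unpaired indices left
    of the gap, and \<open>H\<close> all indices to its right.\<close>
  define U where "U = {i. N \<le> i + j + 2 \<and> i < N + j}"
  define Lo where "Lo = {i. i + j + 2 < N}"
  define M where "M = {k + 2..<2 * N}"
  define H where "H = {k + 2..<q}"
  have fin: "finite U" "finite Lo" by (auto simp: U_def Lo_def intro: finite_subset[of _ "{..<N + j}"])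
  have A_split: "A = (U \<union> Lo) \<union> H" using j by (auto simp: A_def U_def Lo_def H_def k_def q_def)
  have disj: "(U \<union> Lo) \<inter> H = {}" "U \<inter> Lo = {}" by (auto simp: U_def Lo_def H_def k_def)
  have prod_A: "(\<Prod>i\<in>A. g i) = (\<Prod>i\<in>U. g i) * ((\<Prod>i\<in>Lo. g i) * (\<Prod>i\<in>H. g i))" for g :: "nat \<Rightarrow> real"
    unfolding A_split using fin disj by (simp add: prod.union_disjoint H_def mult.assoc)
  \<comment> \<open>The index \<open>2N\<close> has no partner; its edge lies beyond the gap, so
    moving the base point right to \<open>\<alpha>\<close> only brings it nearer.\<close>
  have prod_H: "(\<Prod>i\<in>H. g i) = (\<Prod>i\<in>M. g i) * (if k + 2 \<le> 2 * N then g (2 * N) else 1)" for g :: "nat \<Rightarrow> real"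
  proof (cases "k + 2 \<le> 2 * N")
    case True
    then have "H = insert (2 * N) M" by (auto simp: H_def M_def q_def)
    then show ?thesis using True by (simp add: M_def mult.commute)
  next
    case False
    then have "H = {}" "M = {}" by (auto simp: H_def M_def q_def)
    then show ?thesis using False by simp
  qed
  have prod_M: "(\<Prod>i\<in>M. g i) = (\<Prod>i\<in>Lo. g (2 * N - 1 - i))" for g :: "nat \<Rightarrow> real"
    by (rule prod.reindex_bij_witness[of _ "\<lambda>i. 2 * N - 1 - i" "\<lambda>i. 2 * N - 1 - i"])
      (auto simp: M_def Lo_def k_def)
  have pair: "\<bar>\<alpha> - x i\<bar> * \<bar>\<alpha> - x (2 * N - 1 - i)\<bar> \<le> \<bar>z - x i\<bar> * \<bar>z - x (2 * N - 1 - i)\<bar>" if "i \<in> Lo" for i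
  proof -
    define i' where "i' = 2 * N - 1 - i"
    have i: "i < q" "i' < q" "k + 1 < i'" "2 * N - i < q" "i' < 2 * N - i" "i \<le> N" "i < k"
      using that by (auto simp: Lo_def i'_def k_def q_def)
    have "x i \<le> v i" using x_bounds i by auto
    also have "v i = - u (2 * N - i)" using u_uminus[of i] i by simp
    finally have 1: "u (2 * N - i) \<le> - x i" by simp
    have 2: "x i' < u (2 * N - i)" using edge_values(6)[OF i(4,5)] x_bounds(2)[OF i(2)] by simp
    have 3: "\<beta> < x i'" using x_less[OF i(3,2)] unfolding x_k(2) .
    have "x i < \<alpha>" using x_less[OF i(7) k(1)] by (simp add: x_k)
    have "x i < 0" using 1 2 3 \<alpha>\<beta> z by (simp add: \<alpha>_def k_def)
    \<comment> \<open>As a function of the base point this product is a concave parabola with vertex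
      \<open>(x i + x i') / 2 < 0\<close>, hence decreasing from \<open>z \<ge> 0\<close> to
      \<open>\<alpha>\<close>.\<close>
    have "(\<alpha> - x i) * (x i' - \<alpha>) \<le> (z - x i) * (x i' - z)"
    proof -
      have "0 \<le> (\<alpha> - z) * (\<alpha> + z - x i - x i')"
        using 1 2 z by (intro mult_nonneg_nonneg) (auto simp: \<alpha>_def k_def)
      then show ?thesis by (simp add: algebra_simps)
    qed
    then show ?thesis unfolding i'_def[symmetric]
      using \<open>x i < \<alpha>\<close> \<open>x i < 0\<close> 3 \<alpha>\<beta> z by (simp add: \<alpha>_def k_def abs_if)
  qed
  have LH: "(\<Prod>i\<in>Lo. \<bar>\<alpha> - x i\<bar>) * (\<Prod>i\<in>H. \<bar>\<alpha> - x i\<bar>) \<le> (\<Prod>i\<in>Lo. \<bar>z - x i\<bar>) * (\<Prod>i\<in>H. \<bar>z - x i\<bar>)"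
  proof -
    have "(\<Prod>i\<in>Lo. \<bar>\<alpha> - x i\<bar>) * (\<Prod>i\<in>M. \<bar>\<alpha> - x i\<bar>) \<le> (\<Prod>i\<in>Lo. \<bar>z - x i\<bar>) * (\<Prod>i\<in>M. \<bar>z - x i\<bar>)"
      unfolding prod_M prod.distrib[symmetric] by (rule prod_mono) (use pair in auto)
    moreover have "(if k + 2 \<le> 2 * N then \<bar>\<alpha> - x (2 * N)\<bar> else 1) \<le> (if k + 2 \<le> 2 * N then \<bar>z - x (2 * N)\<bar> else 1)"
    proof (cases "k + 2 \<le> 2 * N")
      case True
      then have "\<beta> < x (2 * N)" using x_less[of "k + 1" "2 * N"] unfolding x_k(2) by (simp add: q_def)
      then show ?thesis using \<alpha>\<beta> z by (simp add: \<alpha>_def k_def)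
    qed simp
    ultimately show ?thesis unfolding prod_H mult.assoc[symmetric]
      by (rule mult_mono) (auto intro!: prod_nonneg mult_nonneg_nonneg)
  qed
  define R where "R = (\<Prod>i\<in>U. \<rho> i)"
  have U_le: "(\<Prod>i\<in>U. \<bar>\<alpha> - x i\<bar>) \<le> R * (\<Prod>i\<in>U. \<bar>z - x i\<bar>)"
    unfolding R_def prod.distrib[symmetric]
    by (rule prod_mono) (use \<rho> x_uv in \<open>auto simp: U_def \<alpha>_def k_def\<close>)
  have R0: "R \<ge> 0" unfolding R_def using \<rho>0 by (simp add: prod_nonneg)
  have QZ: "Q \<le> R * Z"
  proof -
    have "Q \<le> (R * (\<Prod>i\<in>U. \<bar>z - x i\<bar>)) * ((\<Prod>i\<in>Lo. \<bar>z - x i\<bar>) * (\<Prod>i\<in>H. \<bar>z - x i\<bar>))"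
      unfolding Q_def prod_A by (rule mult_mono[OF U_le LH]) (auto intro!: R0 prod_nonneg mult_nonneg_nonneg)
    then show ?thesis unfolding Z_def prod_A by (simp only: mult.assoc)
  qed
  have pos: "\<alpha> - z > 0" "\<beta> - z > 0" using z \<alpha>\<beta> by (auto simp: \<alpha>_def k_def)
  have "(\<alpha> - z)\<^sup>2 < (\<alpha> - z) * (\<beta> - z)"
    using pos \<alpha>\<beta> by (simp add: power2_eq_square)
  also have "\<dots> \<le> (\<alpha> - z) * (\<beta> - z) * ((\<beta> - \<alpha>) * Q)"
    using Q1 pos by simp
  also have "\<dots> \<le> (\<alpha> - z) * (\<beta> - z) * ((\<beta> - \<alpha>) * (R * Z))"
    using QZ pos \<alpha>\<beta> by (intro mult_left_mono) auto
  also have "\<dots> = (\<beta> - \<alpha>) * R * ((\<alpha> - z) * (\<beta> - z) * Z)" by (simp only: mult_ac)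
  also have "\<dots> = 4 * (\<beta> - \<alpha>) * R" unfolding Z4 by simp
  finally show ?thesis by (simp add: \<alpha>_def \<beta>_def R_def U_def k_def)
qed

section \<open>The three gap estimates\<close>

lemma edge_cases:
  assumes "i < k" "k < q" "y \<in> {u i, v i}"
  shows "y < u k" "u i \<le> y" "y \<le> v i"
  using assms edge_values(4,5)[of i] edge_values(6)[OF assms(2,1)] by auto

text \<open>Base point \<open>0\<close>. The unpaired edges, at most two, lie left of
  \<open>- v N\<close>, so each costs a factor \<open>2\<close>; with the \<open>4\<close> of
  \<open>gap_inequality\<close> this makes \<open>16\<close>.\<close>

lemma gap_0: "(v N / 4)\<^sup>2 < u (N + 1) - v N"
proof -
  have N: "N < q" by (simp add: q_def)
  have vN: "u N = - v N" using u_uminus[OF N] by simp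
  define U where "U = {i. N \<le> i + 0 + 2 \<and> i < N + 0}"
  have *: "(v (N + 0) - 0)\<^sup>2 < 4 * (u (N + 0 + 1) - v (N + 0)) * (\<Prod>i\<in>U. 2)"
    unfolding U_def
  proof (rule gap_inequality)
    fix i y assume "i < N + 0" "y \<in> {u i, v i}"
    then have "y < u N" using edge_cases(1) N by simp
    then show "\<bar>v (N + 0) - y\<bar> \<le> 2 * \<bar>0 - y\<bar>" using vN v_pos by simp
  qed (use N_pos f_odd[of 0] v_pos in auto)
  moreover have "(\<Prod>i\<in>U. 2) \<le> (4 :: real)"
  proof -
    have "card U \<le> card {N - 2..<N}" by (rule card_mono) (auto simp: U_def)
    then have "(2 :: real) ^ card U \<le> 2 ^ 2" by (intro power_increasing) auto
    then show ?thesis by simp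
  qed
  moreover have "v N < u (N + 1)" using edge_values(6)[of "N + 1" N] N_pos by (simp add: q_def)
  ultimately have "(v (N + 0) - 0)\<^sup>2 < 4 * (u (N + 0 + 1) - v (N + 0)) * 4"
    by (intro less_mult_left_bound[OF *]) simp_all
  then show ?thesis by (simp add: power_divide)
qed

text \<open>Base point \<open>l k\<close>. An unpaired edge \<open>y\<close> lies left of
  \<open>u k\<close>, so \<open>v k - l k \<le> (C - 1) * (l k - y)\<close> and the factor is at
  most \<open>C\<close>. Unpaired indices run from \<open>N - j - 2\<close> to
  \<open>N + j - 1\<close>.\<close>

lemma gap_band_part:
  assumes j: "j < N"
  defines "C \<equiv> 1 + 2 * exp 1 / (sqrt 5 - 1)"
  shows "(v (N + j) - l (N + j))\<^sup>2 / (4 * C ^ (2 * (j + 1))) < u (N + j + 1) - v (N + j)"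
proof -
  define k where "k = N + j"
  have k: "k < q" "k + 1 < q" using j by (auto simp: k_def q_def)
  have C1: "C \<ge> 1" by (simp add: C_def)
  define U where "U = {i. N \<le> i + j + 2 \<and> i < N + j}"
  have *: "(v (N + j) - l k)\<^sup>2 < 4 * (u (N + j + 1) - v (N + j)) * (\<Prod>i\<in>U. C)"
    unfolding U_def
  proof (rule gap_inequality[OF j])
    show "poly f (l k) = 0" by (rule l_zero[OF k(1)])
    show "0 \<le> l k" using l_less[of N k] l_N k by (cases "j = 0") (auto simp: k_def)
    show "l k < v (N + j)" using edge_values(5)[OF k(1)] by (simp add: k_def)
    fix i y assume "i < N + j" "y \<in> {u i, v i}"
    then have y: "y < u k" using edge_cases(1) k by (simp add: k_def)
    have "v k - l k \<le> (C - 1) * (l k - u k)" using band_parts_ratio[OF k(1)] by (simp add: C_def)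
    also have "\<dots> \<le> (C - 1) * (l k - y)" using y C1 by (intro mult_left_mono) auto
    finally have "v k - y \<le> C * (l k - y)" by (simp add: algebra_simps)
    then show "\<bar>v (N + j) - y\<bar> \<le> C * \<bar>l k - y\<bar>"
      using y edge_values(4,5)[OF k(1)] by (simp add: k_def)
  qed (use C1 in auto)
  moreover have "(\<Prod>i\<in>U. C) \<le> C ^ (2 * (j + 1))"
  proof -
    have "card U \<le> card {N - (j + 2)..<N + j}" by (rule card_mono) (auto simp: U_def)
    then have "C ^ card U \<le> C ^ (2 * (j + 1))" by (intro power_increasing C1) auto
    then show ?thesis by simp
  qed
  moreover have gap: "v k < u (k + 1)" using edge_values(6)[OF k(2), of k] by simp
  ultimately have "(v k - l k)\<^sup>2 < 4 * (u (k + 1) - v k) * C ^ (2 * (j + 1))"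
    using less_mult_left_bound[OF *] unfolding k_def[symmetric] by simp
  then have "(v k - l k)\<^sup>2 < (u (k + 1) - v k) * (4 * C ^ (2 * (j + 1)))" by (simp only: mult_ac)
  moreover have "4 * C ^ (2 * (j + 1)) > 0" using C1 by simp
  ultimately show ?thesis unfolding k_def[symmetric] by (simp only: pos_divide_less_eq)
qed

text \<open>Base point \<open>0\<close>. At most two unpaired edges lie left of
  \<open>- \<alpha>\<close> and cost \<open>2\<close> each. The other \<open>2j\<close> satisfy
  \<open>w \<le> |y| \<le> \<alpha>\<close> and cost \<open>2\<alpha> / w\<close> each.\<close>

lemma gap_central_band:
  assumes j: "1 \<le> j" "j < N"
  shows "(v N / 8) ^ (2 * j) < u (N + j + 1) - v (N + j)"
proof -
  define k where "k = N + j"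
  have k: "k < q" "k + 1 < q" "N < q" using j by (auto simp: k_def q_def)
  define w where "w = v N"
  define \<alpha> where "\<alpha> = v k"
  have w: "w > 0" "u N = - w" using v_pos u_uminus[OF k(3)] by (simp_all add: w_def)
  have \<alpha>: "u (N - j) = - \<alpha>" using u_uminus[OF k(1)] j by (simp add: \<alpha>_def k_def)
  have w\<alpha>: "w \<le> \<alpha>" using edges_mono(1)[OF k(1), of N] by (simp add: w_def \<alpha>_def k_def)
  have \<alpha>4: "\<alpha> \<le> 4" using v_le_4[OF k(1)] by (simp add: \<alpha>_def)
  define U where "U = {i. N \<le> i + j + 2 \<and> i < N + j}"
  define \<rho> where "\<rho> i = (if i + j < N then 2 else 2 * \<alpha> / w)" for i
  have *: "(v (N + j) - 0)\<^sup>2 < 4 * (u (N + j + 1) - v (N + j)) * (\<Prod>i\<in>U. \<rho> i)"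
    unfolding U_def
  proof (rule gap_inequality[OF j(2)])
    show "0 < v (N + j)" using w w\<alpha> by (simp add: \<alpha>_def k_def)
    fix i y assume i: "i < N + j" "y \<in> {u i, v i}"
    show "\<bar>v (N + j) - y\<bar> \<le> \<rho> i * \<bar>0 - y\<bar>"
    proof (cases "i + j < N")
      case True
      then have "y < - \<alpha>" using edge_cases(1)[of i "N - j" y] i k \<alpha> by simp
      then show ?thesis using True w w\<alpha> by (simp add: \<rho>_def \<alpha>_def k_def)
    next
      case False
      have ik: "i < k" "i < q" using i k by (auto simp: k_def)
      have "y \<le> v i" "u i \<le> y" using edge_cases[OF ik(1) k(1) i(2)] by auto
      moreover have "v i \<le> \<alpha>" using edges_mono(1)[OF k(1), of i] ik by (simp add: \<alpha>_def)
      moreover have "- \<alpha> \<le> u i" using edges_mono(2)[OF ik(2), of "N - j"] False \<alpha> by simp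
      ultimately have y\<alpha>: "\<bar>\<alpha> - y\<bar> \<le> 2 * \<alpha>" by linarith
      have "w \<le> \<bar>y\<bar>"
      proof -
        consider "i < N" | "i = N" | "N < i" by linarith
        then show ?thesis
        proof cases
          case 1
          then show ?thesis using edge_cases(1)[OF 1 k(3) i(2)] w by simp
        next
          case 2
          then show ?thesis using i(2) w by (auto simp: w_def)
        next
          case 3
          then show ?thesis using edge_values(6)[OF ik(2) 3] \<open>u i \<le> y\<close> by (simp add: w_def)
        qed
      qed
      then have "2 * \<alpha> / w * w \<le> 2 * \<alpha> / w * \<bar>y\<bar>" using w w\<alpha> by (intro mult_left_mono) auto
      then show ?thesis using y\<alpha> False w by (simp add: \<rho>_def \<alpha>_def k_def)
    qed
  qed (use f_odd[of 0] w w\<alpha> in \<open>auto simp: \<rho>_def\<close>)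
  moreover have "(\<Prod>i\<in>U. \<rho> i) \<le> 4 * (2 * \<alpha> / w) ^ (2 * j)"
  proof -
    define V where "V = {i. N \<le> i + j + 2 \<and> i + j < N}"
    have U: "U = V \<union> {N - j..<N + j}" using j by (auto simp: U_def V_def)
    have "finite V" by (rule finite_subset[of _ "{..<N}"]) (auto simp: V_def)
    then have "(\<Prod>i\<in>U. \<rho> i) = (\<Prod>i\<in>V. \<rho> i) * (\<Prod>i\<in>{N - j..<N + j}. \<rho> i)"
      unfolding U by (intro prod.union_disjoint) (auto simp: V_def)
    also have "(\<Prod>i\<in>V. \<rho> i) = 2 ^ card V"
      by (simp add: \<rho>_def V_def)
    also have "(\<Prod>i\<in>{N - j..<N + j}. \<rho> i) = (\<Prod>i\<in>{N - j..<N + j}. 2 * \<alpha> / w)"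
      by (intro prod.cong) (auto simp: \<rho>_def)
    also have "\<dots> = (2 * \<alpha> / w) ^ (2 * j)"
    proof -
      have "card {N - j..<N + j} = 2 * j" using j by simp
      then show ?thesis by (simp only: prod_constant)
    qed
    also have "2 ^ card V * (2 * \<alpha> / w) ^ (2 * j) \<le> 4 * (2 * \<alpha> / w) ^ (2 * j)"
    proof (rule mult_right_mono)
      have "card V \<le> card {N - (j + 2)..<N - j}" by (rule card_mono) (auto simp: V_def)
      then have "(2 :: real) ^ card V \<le> 2 ^ 2" by (intro power_increasing) auto
      then show "(2 :: real) ^ card V \<le> 4" by simp
    qed (use w w\<alpha> in auto)
    finally show ?thesis .
  qed
  moreover have "v k < u (k + 1)" using edge_values(6)[OF k(2), of k] by simp
  ultimately have main: "\<alpha>\<^sup>2 < 4 * (u (k + 1) - v k) * (4 * (2 * \<alpha> / w) ^ (2 * j))"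
    using less_mult_left_bound[OF *] unfolding \<alpha>_def k_def[symmetric] by simp
  have "(w / 8) ^ (2 * j) * (16 * (2 * \<alpha> / w) ^ (2 * j)) = 16 * (\<alpha> / 4) ^ (2 * j)"
    using w by (simp add: power_mult_distrib[symmetric])
  \<comment> \<open>Here \<open>\<alpha> \<le> 4\<close> makes the higher power the smaller one, and
    \<open>1 \<le> j\<close> enters.\<close>
  also have "\<dots> \<le> 16 * (\<alpha> / 4) ^ 2"
    using j w w\<alpha> \<alpha>4 by (intro mult_left_mono power_decreasing) auto
  also have "\<dots> = \<alpha>\<^sup>2" by (simp add: power_divide)
  also note main
  also have "4 * (u (k + 1) - v k) * (4 * (2 * \<alpha> / w) ^ (2 * j)) = (u (k + 1) - v k) * (16 * (2 * \<alpha> / w) ^ (2 * j))"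
    by (simp add: algebra_simps)
  finally have "(w / 8) ^ (2 * j) * (16 * (2 * \<alpha> / w) ^ (2 * j)) < (u (k + 1) - v k) * (16 * (2 * \<alpha> / w) ^ (2 * j))" .
  moreover have "16 * (2 * \<alpha> / w) ^ (2 * j) > 0" using w w\<alpha> by simp
  ultimately have "(w / 8) ^ (2 * j) < u (k + 1) - v k"
    by (simp only: mult_less_cancel_right_pos)
  then show ?thesis by (simp add: w_def k_def)
qed

end

subsection \<open>Exponentially decaying kernels on \<open>\<ell>\<^sup>2\<close>\<close>

lemma infsum_bounded_nonneg:
  fixes f :: "'a \<Rightarrow> real"
  assumes "\<And>x. f x \<ge> 0" "\<And>F. finite F \<Longrightarrow> sum f F \<le> B"
  shows "f summable_on UNIV" "infsum f UNIV \<le> B"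
proof -
  show 1: "f summable_on UNIV"
    by (rule nonneg_bdd_above_summable_on) (use assms in \<open>auto intro!: bdd_aboveI2[of _ _ B]\<close>)
  show "infsum f UNIV \<le> B"
    by (rule infsum_le_finite_sums[OF 1]) (use assms in auto)
qed

lemma infsum_sum_swap:
  fixes f :: "'b \<Rightarrow> 'a \<Rightarrow> 'c::{topological_comm_monoid_add, t2_space}"
  assumes "finite F" "\<And>m. m \<in> F \<Longrightarrow> f m summable_on A"
  shows "(\<lambda>n. \<Sum>m\<in>F. f m n) summable_on A" "(\<Sum>\<^sub>\<infinity>n\<in>A. \<Sum>m\<in>F. f m n) = (\<Sum>m\<in>F. infsum (f m) A)"
  using assms by (induction F) (simp_all add: summable_on_add infsum_add)

lemma l2_norm_sq: "(l2_norm \<phi>)\<^sup>2 = (\<Sum>\<^sub>\<infinity>n. (cmod (\<phi> n))\<^sup>2)"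
  unfolding l2_norm_def by (simp add: infsum_nonneg)

lemma l2_norm_nonneg: "l2_norm \<phi> \<ge> 0"
  unfolding l2_norm_def by (simp add: infsum_nonneg)

lemma l2_sum_le:
  assumes "\<phi> \<in> l2" "finite F"
  shows "(\<Sum>n\<in>F. (cmod (\<phi> n))\<^sup>2) \<le> (l2_norm \<phi>)\<^sup>2"
  unfolding l2_norm_sq by (rule finite_sum_le_infsum) (use assms in \<open>auto simp: l2_def\<close>)

lemma l2_le_norm:
  assumes "\<phi> \<in> l2"
  shows "cmod (\<phi> n) \<le> l2_norm \<phi>"
  using l2_sum_le[OF assms, of "{n}"] l2_norm_nonneg[of \<phi>] by (simp add: power2_le_iff_abs_le abs_le_square_iff[symmetric])

lemma l2_finite_support:
  assumes "finite F" "\<And>n. n \<notin> F \<Longrightarrow> \<phi> n = 0"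
  shows "\<phi> \<in> l2" "(l2_norm \<phi>)\<^sup>2 = (\<Sum>n\<in>F. (cmod (\<phi> n))\<^sup>2)"
proof -
  show "\<phi> \<in> l2" unfolding l2_def
  proof (intro CollectI finite_nonzero_values_imp_summable_on)
    show "finite {n \<in> UNIV. (cmod (\<phi> n))\<^sup>2 \<noteq> 0}"
      by (rule finite_subset[OF _ assms(1)]) (use assms(2) in auto)
  qed
  have "(l2_norm \<phi>)\<^sup>2 = (\<Sum>\<^sub>\<infinity>n\<in>F. (cmod (\<phi> n))\<^sup>2)"
    unfolding l2_norm_sq by (rule infsum_cong_neutral) (use assms(2) in auto)
  then show "(l2_norm \<phi>)\<^sup>2 = (\<Sum>n\<in>F. (cmod (\<phi> n))\<^sup>2)" using assms(1) by simp
qed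

lemma sum_geometric_int:
  fixes r :: real
  assumes r: "0 \<le> r" "r < 1" and F: "finite F"
  shows "(\<Sum>n\<in>F. r ^ nat \<bar>m - n\<bar>) \<le> 2 / (1 - r)"
proof -
  have geo: "(\<Sum>k\<in>K. r ^ k) \<le> 1 / (1 - r)" if "finite K" for K :: "nat set"
    using sum_le_suminf[of "\<lambda>k. r ^ k" K] r that by (simp add: suminf_geometric summable_geometric)
  have half: "(\<Sum>n\<in>G. r ^ nat \<bar>m - n\<bar>) \<le> 1 / (1 - r)"
    if "finite G" "inj_on (\<lambda>n. nat \<bar>m - n\<bar>) G" for G
  proof -
    have "(\<Sum>n\<in>G. r ^ nat \<bar>m - n\<bar>) = (\<Sum>k\<in>(\<lambda>n. nat \<bar>m - n\<bar>) ` G. r ^ k)"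
      by (subst sum.reindex[OF that(2)]) simp
    then show ?thesis using geo that(1) by simp
  qed
  have "(\<Sum>n\<in>F. r ^ nat \<bar>m - n\<bar>) = (\<Sum>n\<in>{n\<in>F. n \<le> m}. r ^ nat \<bar>m - n\<bar>) + (\<Sum>n\<in>{n\<in>F. \<not> n \<le> m}. r ^ nat \<bar>m - n\<bar>)"
    using F by (subst sum.union_disjoint[symmetric]) (auto intro: sum.cong)
  also have "\<dots> \<le> 1 / (1 - r) + 1 / (1 - r)"
    using F by (intro add_mono half) (auto simp: inj_on_def)
  finally show ?thesis by simp
qed

locale decaying_kernel =
  fixes G :: "int \<Rightarrow> int \<Rightarrow> complex" and C r :: real
  assumes r: "0 \<le> r" "r < 1" and C: "C \<ge> 0"
    and G_bound: "\<And>m n. cmod (G m n) \<le> C * r ^ nat \<bar>m - n\<bar>"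
begin

lemma decay_summable:
  "(\<lambda>n. r ^ nat \<bar>m - n\<bar>) summable_on UNIV"
  by (rule infsum_bounded_nonneg[where B = "2 / (1 - r)"]) (use r sum_geometric_int in auto)

lemma summable_mult:
  fixes \<phi> :: "int \<Rightarrow> 'a::real_normed_vector"
  assumes "\<And>n. norm (\<phi> n) \<le> B"
  shows "(\<lambda>n. r ^ nat \<bar>m - n\<bar> * norm (\<phi> n)) summable_on UNIV"
proof (rule summable_on_comparison_test)
  show "(\<lambda>n. r ^ nat \<bar>m - n\<bar> * B) summable_on UNIV"
    by (intro summable_on_cmult_left decay_summable)
qed (use assms r in \<open>auto intro!: mult_left_mono\<close>)

lemma kernel_summable:
  assumes "\<And>n. norm (\<phi> n) \<le> B"
  shows "(\<lambda>n. norm (G m n * \<phi> n)) summable_on UNIV" "(\<lambda>n. G m n * \<phi> n) summable_on UNIV"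
proof -
  show "(\<lambda>n. norm (G m n * \<phi> n)) summable_on UNIV"
  proof (rule Infinite_Sum.abs_summable_on_comparison_test')
    show "(\<lambda>n. C * (r ^ nat \<bar>m - n\<bar> * norm (\<phi> n))) summable_on UNIV"
      by (intro summable_on_cmult_right summable_mult[OF assms])
    show "norm (G m n * \<phi> n) \<le> C * (r ^ nat \<bar>m - n\<bar> * norm (\<phi> n))" for n
      using mult_right_mono[OF G_bound[of m n], of "norm (\<phi> n)"] by (simp add: norm_mult mult.assoc)
  qed
  then show "(\<lambda>n. G m n * \<phi> n) summable_on UNIV" by (rule abs_summable_summable)
qed

definition R :: "(int \<Rightarrow> complex) \<Rightarrow> int \<Rightarrow> complex" where
  "R \<phi> m = (\<Sum>\<^sub>\<infinity>n. G m n * \<phi> n)"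

text \<open>Schur test: Cauchy-Schwarz with the decay factor as weight.\<close>

lemma R_bounded:
  assumes \<phi>: "\<phi> \<in> l2"
  shows "R \<phi> \<in> l2" "l2_norm (R \<phi>) \<le> C * (2 / (1 - r)) * l2_norm \<phi>"
proof -
  define A where "A = 2 / (1 - r)"
  have A: "A \<ge> 0" using r by (simp add: A_def)
  define k where "k m n = r ^ nat \<bar>m - n\<bar>" for m n :: int
  have k0: "k m n \<ge> 0" for m n using r by (simp add: k_def)
  define D where "D m = (\<Sum>\<^sub>\<infinity>n. k m n * (cmod (\<phi> n))\<^sup>2)" for m
  have sq_bound: "norm ((cmod (\<phi> n))\<^sup>2) \<le> (l2_norm \<phi>)\<^sup>2" for n
    using l2_le_norm[OF \<phi>, of n] by (simp add: power_mono)
  have D_summable: "(\<lambda>n. k m n * (cmod (\<phi> n))\<^sup>2) summable_on UNIV" for m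
    using summable_mult[of "\<lambda>n. (cmod (\<phi> n))\<^sup>2", OF sq_bound] by (simp add: k_def)
  have D0: "D m \<ge> 0" for m unfolding D_def using k0 by (intro infsum_nonneg) auto
  have point: "(cmod (R \<phi> m))\<^sup>2 \<le> C\<^sup>2 * A * D m" for m
  proof -
    have "cmod (R \<phi> m) \<le> (\<Sum>\<^sub>\<infinity>n. cmod (G m n * \<phi> n))"
      unfolding R_def by (rule norm_infsum_bound) (rule kernel_summable(1)[OF l2_le_norm[OF \<phi>]])
    also have "\<dots> \<le> C * sqrt (A * D m)"
    proof (rule infsum_le_finite_sums)
      fix F :: "int set" assume F: "finite F"
      have "(\<Sum>n\<in>F. cmod (G m n * \<phi> n)) \<le> (\<Sum>n\<in>F. C * (k m n * cmod (\<phi> n)))"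
        using mult_right_mono[OF G_bound] by (intro sum_mono) (simp add: norm_mult mult.assoc[symmetric] k_def)
      also have "\<dots> = C * (\<Sum>n\<in>F. sqrt (k m n) * (sqrt (k m n) * cmod (\<phi> n)))"
        using k0 by (simp add: sum_distrib_left mult.assoc[symmetric])
      also have "(\<Sum>n\<in>F. sqrt (k m n) * (sqrt (k m n) * cmod (\<phi> n))) \<le> sqrt (A * D m)"
      proof (rule real_le_rsqrt)
        have "(\<Sum>n\<in>F. sqrt (k m n) * (sqrt (k m n) * cmod (\<phi> n)))\<^sup>2
            \<le> (\<Sum>n\<in>F. (sqrt (k m n))\<^sup>2) * (\<Sum>n\<in>F. (sqrt (k m n) * cmod (\<phi> n))\<^sup>2)"
          by (rule Cauchy_Schwarz_ineq_sum)
        also have "\<dots> = (\<Sum>n\<in>F. k m n) * (\<Sum>n\<in>F. k m n * (cmod (\<phi> n))\<^sup>2)"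
          using k0 by (simp add: power_mult_distrib)
        also have "\<dots> \<le> A * D m"
        proof (rule mult_mono)
          show "(\<Sum>n\<in>F. k m n) \<le> A" unfolding k_def A_def by (rule sum_geometric_int[OF r F])
          show "(\<Sum>n\<in>F. k m n * (cmod (\<phi> n))\<^sup>2) \<le> D m"
            unfolding D_def using k0 by (intro finite_sum_le_infsum[OF D_summable F]) auto
        qed (use A k0 in \<open>auto intro: sum_nonneg\<close>)
        finally show "(\<Sum>n\<in>F. sqrt (k m n) * (sqrt (k m n) * cmod (\<phi> n)))\<^sup>2 \<le> A * D m" .
      qed
      finally show "(\<Sum>n\<in>F. cmod (G m n * \<phi> n)) \<le> C * sqrt (A * D m)"
        using C by (simp add: mult_left_mono)
    qed (rule kernel_summable(1)[OF l2_le_norm[OF \<phi>]])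
    finally have "(cmod (R \<phi> m))\<^sup>2 \<le> (C * sqrt (A * D m))\<^sup>2" by (intro power_mono) auto
    then show ?thesis using A D0[of m] by (simp add: power_mult_distrib)
  qed
  have fin: "(\<Sum>m\<in>F. (cmod (R \<phi> m))\<^sup>2) \<le> (C * A * l2_norm \<phi>)\<^sup>2" if F: "finite F" for F
  proof -
    have "(\<Sum>m\<in>F. D m) \<le> A * (l2_norm \<phi>)\<^sup>2"
    proof -
      have "(\<Sum>m\<in>F. D m) = (\<Sum>\<^sub>\<infinity>n. (\<Sum>m\<in>F. k m n * (cmod (\<phi> n))\<^sup>2))"
        unfolding D_def by (rule infsum_sum_swap(2)[OF F, symmetric]) (rule D_summable)
      also have "\<dots> = (\<Sum>\<^sub>\<infinity>n. (\<Sum>m\<in>F. k m n) * (cmod (\<phi> n))\<^sup>2)"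
        by (simp add: sum_distrib_right)
      also have "\<dots> \<le> A * (l2_norm \<phi>)\<^sup>2"
      proof -
        have kA: "(\<Sum>m\<in>F. k m n) \<le> A" for n
          using sum_geometric_int[OF r F, of n] by (simp add: k_def A_def abs_minus_commute)
        have s: "(\<lambda>n. (cmod (\<phi> n))\<^sup>2) summable_on UNIV" using \<phi> by (simp add: l2_def)
        have le: "(\<Sum>m\<in>F. k m n) * (cmod (\<phi> n))\<^sup>2 \<le> A * (cmod (\<phi> n))\<^sup>2" for n
          by (intro mult_right_mono kA) auto
        have "(\<Sum>\<^sub>\<infinity>n. (\<Sum>m\<in>F. k m n) * (cmod (\<phi> n))\<^sup>2) \<le> (\<Sum>\<^sub>\<infinity>n. A * (cmod (\<phi> n))\<^sup>2)"
        proof (rule infsum_mono)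
          show "(\<lambda>n. A * (cmod (\<phi> n))\<^sup>2) summable_on UNIV" by (rule summable_on_cmult_right[OF s])
          then show "(\<lambda>n. (\<Sum>m\<in>F. k m n) * (cmod (\<phi> n))\<^sup>2) summable_on UNIV"
            by (rule summable_on_comparison_test) (use le k0 in \<open>auto intro!: mult_nonneg_nonneg sum_nonneg\<close>)
        qed (rule le)
        also have "\<dots> = A * (l2_norm \<phi>)\<^sup>2" unfolding l2_norm_sq by (rule infsum_cmult_right[OF s])
        finally show ?thesis .
      qed
      finally show ?thesis .
    qed
    have "(\<Sum>m\<in>F. (cmod (R \<phi> m))\<^sup>2) \<le> C\<^sup>2 * A * (\<Sum>m\<in>F. D m)"
      unfolding sum_distrib_left by (rule sum_mono) (rule point)
    also have "\<dots> \<le> C\<^sup>2 * A * (A * (l2_norm \<phi>)\<^sup>2)"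
      using A \<open>(\<Sum>m\<in>F. D m) \<le> _\<close> by (intro mult_left_mono) auto
    also have "\<dots> = (C * A * l2_norm \<phi>)\<^sup>2" by (simp add: power2_eq_square)
    finally show ?thesis .
  qed
  from infsum_bounded_nonneg[of "\<lambda>m. (cmod (R \<phi> m))\<^sup>2", OF _ fin]
  have 1: "(\<lambda>m. (cmod (R \<phi> m))\<^sup>2) summable_on UNIV" "(l2_norm (R \<phi>))\<^sup>2 \<le> (C * A * l2_norm \<phi>)\<^sup>2"
    unfolding l2_norm_sq by auto
  then show "R \<phi> \<in> l2" by (simp add: l2_def)
  show "l2_norm (R \<phi>) \<le> C * (2 / (1 - r)) * l2_norm \<phi>"
    unfolding A_def[symmetric] using 1(2) by (rule power2_le_imp_le) (use C A l2_norm_nonneg in auto)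
qed

text \<open>The Green equation makes \<open>R\<close> a right inverse. Symmetry of \<open>G\<close>
  moves the operator to the second variable, which makes \<open>R\<close> a left inverse.\<close>

lemma not_in_spectrum:
  assumes T: "\<And>\<phi> n. T \<phi> n - z * \<phi> n = \<phi> (n - 1) + \<phi> (n + 1) + a n * \<phi> n"
    and a: "\<And>n. cmod (a n) \<le> A"
    and sym: "\<And>m n. G m n = G n m"
    and green: "\<And>m n. G (m - 1) n + G (m + 1) n + a m * G m n = (if m = n then 1 else 0)"
  shows "z \<notin> l2_spectrum T"
proof -
  have delta: "(\<Sum>\<^sub>\<infinity>n. (G (m - 1) n + G (m + 1) n + a m * G m n) * \<phi> n) = \<phi> m" for m and \<phi> :: "int \<Rightarrow> complex"
  proof -
    have "(\<Sum>\<^sub>\<infinity>n. (G (m - 1) n + G (m + 1) n + a m * G m n) * \<phi> n) = (\<Sum>\<^sub>\<infinity>n\<in>{m}. \<phi> n)"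
      unfolding green by (rule infsum_cong_neutral) auto
    then show ?thesis by simp
  qed
  have right: "(\<lambda>n. T (R \<phi>) n - z * R \<phi> n) = \<phi>" if \<phi>: "\<phi> \<in> l2" for \<phi>
  proof
    fix m
    note s = kernel_summable(2)[OF l2_le_norm[OF \<phi>]]
    have "T (R \<phi>) m - z * R \<phi> m = (\<Sum>\<^sub>\<infinity>n. G (m - 1) n * \<phi> n) + (\<Sum>\<^sub>\<infinity>n. G (m + 1) n * \<phi> n)
        + (\<Sum>\<^sub>\<infinity>n. a m * (G m n * \<phi> n))"
      unfolding T unfolding R_def by (simp only: infsum_cmult_right[OF s])
    also have "\<dots> = (\<Sum>\<^sub>\<infinity>n. G (m - 1) n * \<phi> n + G (m + 1) n * \<phi> n + a m * (G m n * \<phi> n))"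
      by (simp only: infsum_add summable_on_add summable_on_cmult_right s)
    also have "\<dots> = (\<Sum>\<^sub>\<infinity>n. (G (m - 1) n + G (m + 1) n + a m * G m n) * \<phi> n)"
      by (simp add: algebra_simps)
    finally show "T (R \<phi>) m - z * R \<phi> m = \<phi> m" unfolding delta .
  qed
  have left: "R (\<lambda>n. T \<phi> n - z * \<phi> n) = \<phi>" if \<phi>: "\<phi> \<in> l2" for \<phi>
  proof
    fix m
    have shift: "bij_betw (\<lambda>n::int. n + c) UNIV UNIV" for c
      by (rule bij_betwI[of _ _ _ "\<lambda>n. n - c"]) auto
    have b: "cmod (\<phi> (n + c)) \<le> l2_norm \<phi>" for n c using l2_le_norm[OF \<phi>] .
    have ab: "cmod (a n * \<phi> n) \<le> A * l2_norm \<phi>" for n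
      unfolding norm_mult using a[of n] l2_le_norm[OF \<phi>, of n] by (intro mult_mono) (auto intro: order.trans[OF norm_ge_zero])
    have s: "(\<lambda>n. G m n * \<phi> (n + c)) summable_on UNIV" "(\<lambda>n. G m n * (a n * \<phi> n)) summable_on UNIV" for c
      using kernel_summable(2)[OF b] kernel_summable(2)[OF ab] by auto
    have s': "(\<lambda>n. G m (n + c) * \<phi> n) summable_on UNIV" for c
      using s(1)[of "- c"] summable_on_reindex_bij_betw[OF shift[of c], of "\<lambda>n. G m n * \<phi> (n + - c)"] by simp
    have eq: "(\<Sum>\<^sub>\<infinity>n. G m n * \<phi> (n + c)) = (\<Sum>\<^sub>\<infinity>n. G m (n + - c) * \<phi> n)" for c
      using infsum_reindex_bij_betw[OF shift[of "- c"], of "\<lambda>n. G m n * \<phi> (n + c)"] by simp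
    have "R (\<lambda>n. T \<phi> n - z * \<phi> n) m = (\<Sum>\<^sub>\<infinity>n. G m n * \<phi> (n + -1) + G m n * \<phi> (n + 1) + G m n * (a n * \<phi> n))"
      unfolding R_def T by (simp add: distrib_left)
    also have "\<dots> = (\<Sum>\<^sub>\<infinity>n. G m n * \<phi> (n + -1)) + (\<Sum>\<^sub>\<infinity>n. G m n * \<phi> (n + 1)) + (\<Sum>\<^sub>\<infinity>n. G m n * (a n * \<phi> n))"
      by (simp only: infsum_add summable_on_add s)
    also have "\<dots> = (\<Sum>\<^sub>\<infinity>n. G m (n + 1) * \<phi> n + G m (n + -1) * \<phi> n + G m n * (a n * \<phi> n))"
      by (simp only: infsum_add summable_on_add s s' eq minus_minus)
    also have "\<dots> = (\<Sum>\<^sub>\<infinity>n. (if n = m then 1 else 0) * \<phi> n)"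
    proof (rule infsum_cong)
      fix n
      have "G m (n + 1) * \<phi> n + G m (n + -1) * \<phi> n + G m n * (a n * \<phi> n)
          = (G (n - 1) m + G (n + 1) m + a n * G n m) * \<phi> n"
        using sym[of m "n + 1"] sym[of m "n - 1"] sym[of m n] by (simp add: algebra_simps)
      then show "G m (n + 1) * \<phi> n + G m (n + -1) * \<phi> n + G m n * (a n * \<phi> n) = (if n = m then 1 else 0) * \<phi> n"
        unfolding green .
    qed
    also have "\<dots> = (\<Sum>\<^sub>\<infinity>n\<in>{m}. \<phi> n)" by (rule infsum_cong_neutral) auto
    finally show "R (\<lambda>n. T \<phi> n - z * \<phi> n) m = \<phi> m" by simp
  qed
  show ?thesis unfolding l2_spectrum_def using R_bounded right left by blast
qed

end

subsection \<open>The spectrum as a level set of the discriminant\<close>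

text \<open>Of the two real roots of \<open>s * s + 1 = \<tau> * s\<close> the one outside the unit
  circle is estimated, the sign of the square root agreeing with that of \<open>\<tau>\<close>; its
  inverse is the answer.\<close>

lemma hyperbolic_multiplier:
  fixes \<tau> :: real
  assumes "\<bar>\<tau>\<bar> > 2"
  obtains \<rho> where "\<rho> \<noteq> 0" "\<bar>\<rho>\<bar> < 1" "\<rho> + inverse \<rho> = \<tau>"
proof -
  define D where "D = sqrt (\<tau>\<^sup>2 - 4)"
  have t4: "\<tau>\<^sup>2 > 4" using abs_le_square_iff[of \<tau> 2] assms by (simp add: not_le[symmetric])
  have D: "D\<^sup>2 = \<tau>\<^sup>2 - 4" "D \<ge> 0" using t4 by (simp_all add: D_def)
  define s where "s = (if \<tau> > 0 then (\<tau> + D) / 2 else (\<tau> - D) / 2)"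
  have s1: "\<bar>s\<bar> > 1"
  proof (cases "\<tau> > 0")
    case True
    then have "\<tau> > 2" using assms by linarith
    then show ?thesis unfolding s_def using True D(2) by simp
  next
    case False
    then have "\<tau> < - 2" using assms by linarith
    then show ?thesis unfolding s_def using False D(2) by simp
  qed
  have "2 * s - \<tau> = D \<or> 2 * s - \<tau> = - D" by (cases "\<tau> > 0") (simp_all add: s_def field_simps)
  then have "(2 * s - \<tau>)\<^sup>2 = D\<^sup>2" by (elim disjE) simp_all
  then have "(2 * s - \<tau>)\<^sup>2 = \<tau>\<^sup>2 - 4" by (simp only: D(1))
  then have "s * s + 1 = \<tau> * s" by (simp add: power2_eq_square algebra_simps)
  then have "s + inverse s = \<tau>" using s1 by (simp add: field_simps)
  moreover have "\<bar>inverse s\<bar> < 1" using s1 by (simp add: abs_inverse inverse_less_1_iff)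
  moreover have "inverse s \<noteq> 0" using s1 by auto
  ultimately show thesis using that[of "inverse s"] by (simp add: add.commute)
qed

lemma second_order_zero:
  fixes s :: "int \<Rightarrow> 'a::comm_ring_1"
  assumes rec: "\<And>n. s (n - 1) + s (n + 1) = b n * s n" and "s 0 = 0" "s 1 = 0"
  shows "s n = 0"
proof -
  have "s n = 0 \<and> s (n + 1) = 0" for n
  proof (induction n rule: int_induct[of _ 0])
    case base
    then show ?case using assms by simp
  next
    case (step1 i)
    then show ?case using rec[of "i + 1"] by simp
  next
    case (step2 i)
    then show ?case using rec[of i] by simp
  qed
  then show ?thesis by blast
qed

context hofstadter
begin

lemma almost_mathieu_pot:
  "almost_mathieu (real p / real q) \<theta> \<phi> n = \<phi> (n - 1) + \<phi> (n + 1) + of_real (pot \<theta> n) * \<phi> n"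
  by (simp add: almost_mathieu_def pot_def)

lemma bloch_sum_periods:
  assumes "norm (z::complex) = 1" "bloch \<theta> z E u"
  shows "(\<Sum>n\<in>{0..<int (K * q)}. (norm (u n))\<^sup>2) = real K * (\<Sum>n\<in>{0..<int q}. (norm (u n))\<^sup>2)"
proof (induction K)
  case (Suc K)
  have split: "{0..<int (Suc K * q)} = {0..<int (K * q)} \<union> {int (K * q)..<int (K * q) + int q}"
    using ivl_disj_un_two(3)[of 0 "int (K * q)" "int (K * q) + int q"] by (simp add: algebra_simps)
  have "(\<Sum>n\<in>{int (K * q)..<int (K * q) + int q}. (norm (u n))\<^sup>2) = (\<Sum>n\<in>{0..<int q}. (norm (u (n + int (K * q))))\<^sup>2)"
    by (rule sum.reindex_bij_witness[of _ "\<lambda>n. n + int (K * q)" "\<lambda>n. n - int (K * q)"]) auto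
  also have "\<dots> = (\<Sum>n\<in>{0..<int q}. (norm (u n))\<^sup>2)"
    by (rule sum_period_shift[where g = "\<lambda>n. (norm (u n))\<^sup>2"]) (simp add: norm_period[OF assms])
  finally show ?case unfolding split using Suc
    by (subst sum.union_disjoint) (auto simp: algebra_simps)
qed simp

text \<open>Truncate a Bloch wave to \<open>K\<close> periods. The squared norm grows like
  \<open>K * S\<close>, while the defect lives on the four sites at the cuts and stays below
  \<open>4 * S\<close>; a bounded inverse with constant \<open>C\<close> fails once
  \<open>4 * C\<^sup>2 < K\<close>.\<close>

lemma level_in_spectrum:
  assumes "\<bar>poly dpoly x\<bar> \<le> 4"
  shows "\<exists>\<theta>\<in>{0<..1}. complex_of_real x \<in> l2_spectrum (almost_mathieu (real p / real q) \<theta>)"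
proof -
  obtain \<theta> and z :: complex where \<theta>: "0 < \<theta>" "\<theta> \<le> 1" and z: "norm z = 1"
    and tr: "of_real (poly dpoly x) - of_real (2 * cos (2 * pi * real q * \<theta>)) = z + inverse z"
    using bloch_phases[OF assms] by metis
  have "z \<noteq> 0" using z by auto
  then obtain u where u: "u \<noteq> (\<lambda>n. 0)" "bloch \<theta> z (of_real x) u"
    using bloch_exists[of z "of_real x" \<theta>] tr by (metis cpoly_of_real)
  define T where "T = almost_mathieu (real p / real q) \<theta>"
  define S where "S = (\<Sum>n\<in>{0..<int q}. (norm (u n))\<^sup>2)"
  have S: "S > 0" unfolding S_def by (rule bloch_sum_pos[OF z u(2,1)])
  have u_le: "(norm (u n))\<^sup>2 \<le> S" for n
  proof -
    have "S = (\<Sum>k\<in>{0..<int q}. (norm (u (k + n)))\<^sup>2)" unfolding S_def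
      by (rule sum_period_shift[symmetric]) (simp add: norm_period[OF z u(2)])
    moreover have "(norm (u (0 + n)))\<^sup>2 \<le> (\<Sum>k\<in>{0..<int q}. (norm (u (k + n)))\<^sup>2)"
      by (rule member_le_sum[where f = "\<lambda>k. (norm (u (k + n)))\<^sup>2"]) (use q_pos in auto)
    ultimately show ?thesis by simp
  qed
  have "of_real x \<in> l2_spectrum T"
  proof (rule ccontr)
    assume "\<not> ?thesis"
    then obtain R C where R: "\<And>\<phi>. \<phi> \<in> l2 \<Longrightarrow> R (\<lambda>n. T \<phi> n - of_real x * \<phi> n) = \<phi>"
      and C: "\<And>\<phi>. \<phi> \<in> l2 \<Longrightarrow> l2_norm (R \<phi>) \<le> C * l2_norm \<phi>"
      unfolding l2_spectrum_def by blast
    obtain K :: nat where K: "real K > 4 * C\<^sup>2" "K \<ge> 1"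
      using reals_Archimedean2[of "max 1 (4 * C\<^sup>2)"] by (metis max.strict_boundedE of_nat_1 of_nat_less_iff less_imp_le)
    define L where "L = int (K * q)"
    have "1 * q \<le> K * q" using K(2) by (intro mult_right_mono) auto
    then have "3 \<le> K * q" using q_ge_3 by linarith
    then have "int 3 \<le> L" unfolding L_def by (simp only: of_nat_le_iff)
    then have L: "L \<ge> 3" by simp
    define \<phi> where "\<phi> n = (if n \<in> {0..<L} then u n else 0)" for n
    define \<psi> where "\<psi> = (\<lambda>n. T \<phi> n - of_real x * \<phi> n)"
    define F where "F = {-1, 0, L - 1, L}"
    have \<phi>: "\<phi> \<in> l2" "(l2_norm \<phi>)\<^sup>2 = real K * S"
    proof -
      have fin: "finite {0..<L}" and out: "\<And>n. n \<notin> {0..<L} \<Longrightarrow> \<phi> n = 0" by (simp, unfold \<phi>_def, rule if_not_P)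
      show "\<phi> \<in> l2" by (rule l2_finite_support(1)[OF fin out])
      have "(l2_norm \<phi>)\<^sup>2 = (\<Sum>n\<in>{0..<L}. (norm (\<phi> n))\<^sup>2)"
        by (rule l2_finite_support(2)[OF fin out])
      also have "\<dots> = (\<Sum>n\<in>{0..<L}. (norm (u n))\<^sup>2)" by (rule sum.cong) (simp_all add: \<phi>_def)
      finally show "(l2_norm \<phi>)\<^sup>2 = real K * S"
        unfolding L_def bloch_sum_periods[OF z u(2)] S_def .
    qed
    have \<psi>_eq: "\<psi> n = \<phi> (n - 1) + \<phi> (n + 1) + (of_real (pot \<theta> n) - of_real x) * \<phi> n" for n
      by (simp add: \<psi>_def T_def almost_mathieu_pot algebra_simps)
    have ub: "u (n - 1) + u (n + 1) + (of_real (pot \<theta> n) - of_real x) * u n = 0" for n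
      using blochD(1)[OF u(2), of n] by (simp add: algebra_simps)
    have \<psi>_out: "\<psi> n = 0" if "n \<notin> F" for n
    proof -
      have "n \<noteq> -1" "n \<noteq> 0" "n \<noteq> L - 1" "n \<noteq> L" using that by (simp_all add: F_def)
      then consider "n < -1" | "n > L" | "0 < n" "n < L - 1" by linarith
      then show ?thesis by cases (use ub[of n] in \<open>auto simp: \<psi>_eq \<phi>_def\<close>)
    qed
    have \<psi>_in: "(norm (\<psi> n))\<^sup>2 \<le> S" if n: "n \<in> F" for n
    proof -
      consider "n = -1" | "n = 0" | "n = L - 1" | "n = L" using n by (auto simp: F_def)
      then have "\<psi> n \<in> range u \<union> uminus ` range u"
      proof cases
        case 1
        then have "\<psi> n = u 0" using L by (simp add: \<psi>_eq \<phi>_def)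
        then show ?thesis by blast
      next
        case 2
        then have "\<psi> n = - u (-1)" using L ub[of 0] by (simp add: \<psi>_eq \<phi>_def) (simp add: eq_neg_iff_add_eq_0 algebra_simps)
        then show ?thesis by blast
      next
        case 3
        then have "\<psi> n = - u L" using L ub[of "L - 1"] by (simp add: \<psi>_eq \<phi>_def) (simp add: eq_neg_iff_add_eq_0 algebra_simps)
        then show ?thesis by blast
      next
        case 4
        then have "\<psi> n = u (L - 1)" using L by (simp add: \<psi>_eq \<phi>_def)
        then show ?thesis by blast
      qed
      then show ?thesis using u_le by auto
    qed
    have finF: "finite F" "card F \<le> 4" by (simp_all add: F_def card_insert_if)
    have \<psi>: "\<psi> \<in> l2" "(l2_norm \<psi>)\<^sup>2 \<le> 4 * S"
    proof -
      show "\<psi> \<in> l2" by (rule l2_finite_support(1)[OF finF(1) \<psi>_out])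
      have "(l2_norm \<psi>)\<^sup>2 = (\<Sum>n\<in>F. (norm (\<psi> n))\<^sup>2)"
        by (rule l2_finite_support(2)[OF finF(1) \<psi>_out])
      also have "\<dots> \<le> of_nat (card F) * S" by (rule sum_bounded_above) (rule \<psi>_in)
      also have "\<dots> \<le> 4 * S" using finF(2) S by (intro mult_right_mono) auto
      finally show "(l2_norm \<psi>)\<^sup>2 \<le> 4 * S" .
    qed
    have "l2_norm \<phi> \<le> C * l2_norm \<psi>" using C[OF \<psi>(1)] R[OF \<phi>(1)] by (simp add: \<psi>_def)
    then have "(l2_norm \<phi>)\<^sup>2 \<le> (C * l2_norm \<psi>)\<^sup>2" by (rule power_mono) (rule l2_norm_nonneg)
    also have "\<dots> \<le> C\<^sup>2 * (4 * S)" unfolding power_mult_distrib by (rule mult_left_mono[OF \<psi>(2)]) simp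
    finally have "real K * S \<le> (4 * C\<^sup>2) * S" by (simp add: \<phi>(2))
    then show False using S K(1) by simp
  qed
  then show ?thesis using \<theta> by (auto simp: T_def)
qed

text \<open>Dividing \<open>norm (u n)\<close> by \<open>r powi n\<close> leaves a
  \<open>q\<close>-periodic function, bounded by its sum over one period.\<close>

lemma bloch_growth:
  assumes u: "bloch \<theta> z E u" and r: "r > 0" "r ^ q = norm z"
  obtains A where "A \<ge> 0" "\<And>n. norm (u n) \<le> A * r powi n"
proof -
  define g where "g n = norm (u n) * r powi (- n)" for n
  have per: "g (n + int q) = g n" for n
  proof -
    have "r powi (- (n + int q)) = r powi (- n) * inverse (r ^ q)"
      using r by (simp add: power_int_diff divide_inverse)
    moreover have "z \<noteq> 0" using r by auto
    ultimately show ?thesis using r by (simp add: g_def blochD(2)[OF u] norm_mult field_simps)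
  qed
  define A where "A = (\<Sum>k\<in>{0..<int q}. g k)"
  have g0: "g n \<ge> 0" for n using r by (simp add: g_def)
  have "g n \<le> A" for n
  proof -
    have "g (0 + n) \<le> (\<Sum>k\<in>{0..<int q}. g (k + n))"
      by (rule member_le_sum[where f = "\<lambda>k. g (k + n)"]) (use q_pos g0 in auto)
    also have "\<dots> = A" unfolding A_def by (rule sum_period_shift[where g = g]) (rule per)
    finally show ?thesis by simp
  qed
  then have "norm (u n) \<le> A * r powi n" for n
    using r by (simp add: g_def power_int_minus field_simps)
  moreover have "A \<ge> 0" unfolding A_def by (intro sum_nonneg g0)
  ultimately show thesis using that by blast
qed

text \<open>Off the level set the Floquet multipliers are real and not unimodular, so one solution
  decays to the right and another to the left. Their product, divided by the Wronskian, is an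
  exponentially decaying Green function.\<close>

lemma level_not_in_spectrum:
  assumes x: "\<bar>poly dpoly x\<bar> > 4"
  shows "complex_of_real x \<notin> l2_spectrum (almost_mathieu (real p / real q) \<theta>)"
proof -
  define \<tau> where "\<tau> = poly dpoly x - 2 * cos (2 * pi * real q * \<theta>)"
  have "\<bar>2 * cos (2 * pi * real q * \<theta>)\<bar> \<le> 2" by (simp add: abs_mult)
  then have "\<bar>\<tau>\<bar> > 2" using x unfolding \<tau>_def by linarith
  then obtain \<rho> where \<rho>: "\<rho> \<noteq> 0" "\<bar>\<rho>\<bar> < 1" "\<rho> + inverse \<rho> = \<tau>"
    using hyperbolic_multiplier by blast
  have tr: "cpoly (of_real x) - of_real (2 * cos (2 * pi * real q * \<theta>)) = complex_of_real \<rho> + inverse (complex_of_real \<rho>)"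
    unfolding cpoly_of_real of_real_diff[symmetric] \<tau>_def[symmetric] \<rho>(3)[symmetric] by simp
  obtain u where u: "u \<noteq> (\<lambda>n. 0)" "bloch \<theta> (of_real \<rho>) (of_real x) u"
    using bloch_exists[OF _ tr] \<rho>(1) by auto
  have "cpoly (of_real x) - of_real (2 * cos (2 * pi * real q * \<theta>)) = inverse (complex_of_real \<rho>) + inverse (inverse (complex_of_real \<rho>))"
    unfolding tr by simp
  then obtain w where w: "w \<noteq> (\<lambda>n. 0)" "bloch \<theta> (inverse (of_real \<rho>)) (of_real x) w"
    using bloch_exists[of "inverse (complex_of_real \<rho>)" "of_real x" \<theta>] \<rho>(1) by auto
  define a where "a n = complex_of_real (pot \<theta> n) - of_real x" for n
  have ru: "u (n - 1) + u (n + 1) = - a n * u n" and rw: "w (n - 1) + w (n + 1) = - a n * w n" for n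
    using blochD(1)[OF u(2), of n] blochD(1)[OF w(2), of n] by (simp_all add: a_def algebra_simps)
  define D where "D n = u n * w (n + 1) - u (n + 1) * w n" for n
  have step: "D (n + 1) = D n" for n
  proof -
    have "u (n + 1 + 1) = - a (n + 1) * u (n + 1) - u n" "w (n + 1 + 1) = - a (n + 1) * w (n + 1) - w n"
      using ru[of "n + 1"] rw[of "n + 1"] by (simp_all add: algebra_simps)
    then show ?thesis unfolding D_def by (simp only:) (simp add: algebra_simps)
  qed
  have D: "D n = D 0" for n
  proof (induction n rule: int_induct[of _ 0])
    case (step2 i)
    then show ?case using step[of "i - 1"] by simp
  qed (use step in simp_all)
  have D0: "D 0 \<noteq> 0"
  proof
    assume D0: "D 0 = 0"
    \<comment> \<open>With zero Wronskian at \<open>0\<close>, the combination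
      \<open>w i * u - u i * w\<close> is a solution with zero initial data. Moving by one period
      then yields \<open>\<rho> * \<rho> = 1\<close> unless \<open>w i\<close> and
      \<open>u i\<close> vanish.\<close>
    have vanish: "w i = 0 \<and> u i = 0" if "i = 0 \<or> i = 1" for i
    proof -
      have eq: "w i * u n - u i * w n = 0" for n
      proof (rule second_order_zero)
        show "w i * u (n - 1) - u i * w (n - 1) + (w i * u (n + 1) - u i * w (n + 1)) = - a n * (w i * u n - u i * w n)" for n
        proof -
          have "w i * u (n - 1) - u i * w (n - 1) + (w i * u (n + 1) - u i * w (n + 1))
              = w i * (u (n - 1) + u (n + 1)) - u i * (w (n - 1) + w (n + 1))" by (simp add: algebra_simps)
          then show ?thesis unfolding ru rw by (simp add: algebra_simps)
        qed
        show "w i * u 0 - u i * w 0 = 0" "w i * u 1 - u i * w 1 = 0"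
          using that D0 by (auto simp: D_def algebra_simps)
      qed
      have "w i * u n = 0" for n
      proof -
        have "w i * (of_real \<rho> * u n) = u i * (inverse (of_real \<rho>) * w n)"
          using eq[of "n + int q"] blochD(2)[OF u(2), of n] blochD(2)[OF w(2), of n] by simp
        also have "\<dots> = inverse (of_real \<rho>) * (w i * u n)" using eq[of n] by simp
        finally have "complex_of_real (\<rho> * \<rho>) * (w i * u n) = w i * u n"
          using \<rho>(1) by (simp add: field_simps)
        then have "complex_of_real (\<rho> * \<rho> - 1) * (w i * u n) = 0" by (simp add: algebra_simps)
        moreover have "\<rho> * \<rho> \<noteq> 1" using \<rho>(2) by (auto simp: square_eq_1_iff)
        then have "complex_of_real (\<rho> * \<rho> - 1) \<noteq> 0" by (simp only: of_real_eq_0_iff)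
        ultimately show ?thesis by (simp only: mult_eq_0_iff simp_thms)
      qed
      then have "w i = 0" using u(1) by auto
      moreover have "u i = 0"
      proof -
        have "u i * w n = 0" for n using eq[of n] \<open>w i = 0\<close> by simp
        then show ?thesis using w(1) by auto
      qed
      ultimately show ?thesis ..
    qed
    have "u n = 0" for n
      by (rule second_order_zero[of u "\<lambda>n. - a n"]) (use ru vanish in auto)
    then show False using u(1) by auto
  qed
  \<comment> \<open>The decay rate per site, as \<open>\<rho>\<close> is the decay over a whole
    period.\<close>
  define r where "r = root q \<bar>\<rho>\<bar>"
  have r: "0 < r" "r < 1" "r ^ q = \<bar>\<rho>\<bar>"
    using \<rho> q_pos by (simp_all add: r_def)
  obtain A where A: "A \<ge> 0" "\<And>n. norm (u n) \<le> A * r powi n"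
    using bloch_growth[OF u(2) r(1)] r(3) by auto
  obtain B where B: "B \<ge> 0" "\<And>n. norm (w n) \<le> B * inverse r powi n"
    using bloch_growth[OF w(2), of "inverse r"] r by (auto simp: norm_inverse power_inverse)
  have mixed: "norm (w m * u n) \<le> A * B * r ^ nat \<bar>m - n\<bar>" if "m \<le> n" for m n
  proof -
    have "norm (w m * u n) \<le> (B * inverse r powi m) * (A * r powi n)"
      unfolding norm_mult using A B r by (intro mult_mono) auto
    also have "\<dots> = A * B * (r powi n * r powi (- m))" using r by (simp add: power_int_inverse power_int_minus)
    also have "r powi n * r powi (- m) = r powi (n - m)" using r by (simp add: power_int_diff power_int_minus divide_inverse)
    also have "\<dots> = r ^ nat \<bar>m - n\<bar>" using that by (simp add: power_int_def)
    finally show ?thesis .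
  qed
  \<comment> \<open>The left-decaying \<open>w\<close> takes the smaller index and the
    right-decaying \<open>u\<close> the larger. The minus sign compensates the jump
    \<open>- D 0\<close> on the diagonal.\<close>
  define G where "G m n = - (if m \<le> n then w m * u n else u m * w n) / D 0" for m n
  have sym: "G m n = G n m" for m n by (auto simp: G_def)
  interpret decaying_kernel G "A * B / norm (D 0)" r
  proof
    show "norm (G m n) \<le> A * B / norm (D 0) * r ^ nat \<bar>m - n\<bar>" for m n
      using mixed[of m n] mixed[of n m] D0
      by (auto simp: G_def norm_divide norm_mult divide_right_mono abs_minus_commute mult.commute)
  qed (use r A B in auto)
  show ?thesis
  proof (rule not_in_spectrum)
    show "almost_mathieu (real p / real q) \<theta> \<phi> n - of_real x * \<phi> n = \<phi> (n - 1) + \<phi> (n + 1) + a n * \<phi> n" for \<phi> n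
      by (simp add: almost_mathieu_pot a_def algebra_simps)
    show "norm (a n) \<le> 2 + \<bar>x\<bar>" for n
    proof -
      have "\<bar>pot \<theta> n\<bar> \<le> 2" by (simp add: pot_def abs_mult)
      moreover have "norm (a n) \<le> \<bar>pot \<theta> n\<bar> + \<bar>x\<bar>"
        unfolding a_def using norm_triangle_ineq4[of "complex_of_real (pot \<theta> n)" "of_real x"] by simp
      ultimately show ?thesis by linarith
    qed
    show "G m n = G n m" for m n by (rule sym)
    fix m n
    define H where "H m = (if m \<le> n then w m * u n else u m * w n)" for m
    have "H (m - 1) + H (m + 1) + a m * H m = (if m = n then - D 0 else 0)"
    proof -
      consider "m < n" | "m = n" | "n < m" by linarith
      then show ?thesis
      proof cases
        case 1
        then have "H (m - 1) + H (m + 1) + a m * H m = (w (m - 1) + w (m + 1) + a m * w m) * u n"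
          by (simp add: H_def algebra_simps)
        then show ?thesis using 1 by (simp add: rw)
      next
        case 2
        then have "H (m - 1) + H (m + 1) + a m * H m = w (n - 1) * u n + (u (n + 1) + a n * u n) * w n"
          by (simp add: H_def algebra_simps)
        also have "u (n + 1) + a n * u n = - u (n - 1)"
          using ru[of n] by (simp add: eq_neg_iff_add_eq_0 algebra_simps)
        also have "w (n - 1) * u n + - u (n - 1) * w n = - D (n - 1)" by (simp add: D_def)
        also have "D (n - 1) = D 0" by (rule D)
        finally show ?thesis using 2 by simp
      next
        case 3
        have "H (m - 1) = u (m - 1) * w n"
          using 3 by (cases "m - 1 = n") (auto simp: H_def mult.commute)
        moreover have "H (m + 1) = u (m + 1) * w n" "H m = u m * w n" using 3 by (simp_all add: H_def)
        ultimately have "H (m - 1) + H (m + 1) + a m * H m = (u (m - 1) + u (m + 1) + a m * u m) * w n"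
          by (simp add: algebra_simps)
        then show ?thesis using 3 by (simp add: ru)
      qed
    qed
    moreover have "G (m - 1) n + G (m + 1) n + a m * G m n = - (H (m - 1) + H (m + 1) + a m * H m) / D 0"
      by (simp add: G_def H_def divide_inverse algebra_simps)
    ultimately show "G (m - 1) n + G (m + 1) n + a m * G m n = (if m = n then 1 else 0)"
      using D0 by simp
  qed
qed

theorem spec_union_eq: "spec_union (real p / real q) = {x. \<bar>poly dpoly x\<bar> \<le> 4}"
  unfolding spec_union_def using level_in_spectrum level_not_in_spectrum by (auto simp: not_le[symmetric])

end

section \<open>Components of the level set and their numbering\<close>

context band_poly
begin

text \<open>On a component \<open>f'\<close> keeps its sign, so the end values are \<open>4\<close>
  and \<open>-4\<close> in some order and \<open>f\<close> vanishes between. Hence every component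
  is one of the bands built around zeros.\<close>

lemma component_has_zero:
  assumes x: "x \<in> S"
  shows "\<exists>y\<in>connected_component_set S x. poly f y = 0"
proof -
  obtain a b where C: "connected_component_set S x = {a..b}" "a \<le> x" "x \<le> b"
    using component_interval[OF x] by metis
  have sub: "{a..b} \<subseteq> S" unfolding C(1)[symmetric] by (rule connected_component_subset)
  have ab: "a \<in> S" "b \<in> S" using sub C by auto
  note re = right_end[OF x C(1)] and le = left_end[OF x C(1)]
  have no_change: False if "a < b" and ex: "\<exists>y>a. y < b \<and> poly (pderiv f) y = 0"
  proof -
    obtain y where y: "a < y" "y < b" "poly (pderiv f) y = 0" using ex by blast
    then have "y \<in> {a..b}" by simp
    then show False using sub deriv_nonzero y(3) by blast
  qed
  have ne: "poly (pderiv f) a \<noteq> 0" "poly (pderiv f) b \<noteq> 0" using deriv_nonzero ab by blast+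
  have "a \<noteq> b" using re le ne by (cases "poly (pderiv f) a > 0") auto
  then have lt: "a < b" using C by linarith
  have "\<exists>y>a. y < b \<and> poly f y = 0"
  proof (cases "poly (pderiv f) a > 0")
    case True
    then have "poly (pderiv f) b > 0"
      using no_change[OF lt] poly_IVT_neg[OF lt, of "pderiv f"] ne(2) by (meson linorder_neqE_linordered_idom)
    then show ?thesis using poly_IVT_pos[OF lt, of f] re(1) le(1) True by simp
  next
    case False
    then have a: "poly (pderiv f) a < 0" using ne(1) by linarith
    then have "poly (pderiv f) b < 0"
      using no_change[OF lt] poly_IVT_pos[OF lt, of "pderiv f"] ne(2) by (meson linorder_neqE_linordered_idom)
    then show ?thesis using poly_IVT_neg[OF lt, of f] re(2) le(2) a by simp
  qed
  then show ?thesis unfolding C(1) by (auto intro: less_imp_le)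
qed

lemma components_S: "components S = B ` {..<q}"
proof
  show "B ` {..<q} \<subseteq> components S"
    unfolding B_def components_def using l_S by auto
  show "components S \<subseteq> B ` {..<q}"
  proof
    fix X assume "X \<in> components S"
    then obtain x where x: "x \<in> S" "X = connected_component_set S x" by (auto simp: components_def)
    then obtain y where y: "y \<in> X" "poly f y = 0" using component_has_zero by blast
    then obtain k where k: "k < q" "y = l k" using zero_l by blast
    have "connected_component_set S x = connected_component_set S y"
      using y(1) x(2) connected_component_eq[of y S x] by simp
    then show "X \<in> B ` {..<q}" using k x(2) by (auto simp: B_def)
  qed
qed

lemma bands_to_left:
  assumes k: "k < q"
  shows "{X \<in> components S. Sup X < Inf (B k)} = B ` {..<k}" "card (B ` {..<k}) = k"
proof -
  have iff: "v i < u k \<longleftrightarrow> i < k" if "i < q" for i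
  proof (cases "i < k")
    case True
    then show ?thesis using edge_values(6)[OF k] by simp
  next
    case False
    then have "u k \<le> u i" using edges_mono(2)[OF that, of k] by simp
    then show ?thesis using False edge_values(4,5)[OF that] by simp
  qed
  show "{X \<in> components S. Sup X < Inf (B k)} = B ` {..<k}"
    unfolding components_S u_def[symmetric] using iff k by (auto simp: v_def[symmetric])
  have "inj_on B {..<k}"
  proof (rule inj_onI, rule ccontr)
    fix i i' assume "i \<in> {..<k}" "i' \<in> {..<k}" "B i = B i'" "i \<noteq> i'"
    then have eq: "u i = u i'" "v i = v i'" and q: "i < q" "i' < q" and "i < i' \<or> i' < i"
      using k by (auto simp: u_def v_def)
    then show False
      using edge_values(4,5)[OF q(1)] edge_values(6)[OF q(1), of i'] edge_values(6)[OF q(2), of i] by linarith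
  qed
  then show "card (B ` {..<k}) = k" by (simp add: card_image)
qed

lemma the_band:
  assumes k: "k < q"
  shows "(THE X. X \<in> components S \<and> finite {X' \<in> components S. Sup X' < Inf X} \<and>
      int (card {X' \<in> components S. Sup X' < Inf X}) = int k) = B k"
proof (rule the_equality)
  show "B k \<in> components S \<and> finite {X' \<in> components S. Sup X' < Inf (B k)} \<and>
      int (card {X' \<in> components S. Sup X' < Inf (B k)}) = int k"
    unfolding bands_to_left[OF k] using k by (simp add: components_S)
next
  fix X assume X: "X \<in> components S \<and> finite {X' \<in> components S. Sup X' < Inf X} \<and>
      int (card {X' \<in> components S. Sup X' < Inf X}) = int k"
  then obtain i where i: "i < q" "X = B i" by (auto simp: components_S)
  have "int (card {X' \<in> components S. Sup X' < Inf (B i)}) = int k" using X i(2) by blast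
  then show "X = B k" unfolding bands_to_left[OF i(1)] using i by simp
qed

lemma the_band_zero:
  assumes "k < q"
  shows "(THE x. x \<in> B k \<and> poly f x = 0) = l k"
proof (rule the_equality)
  show "l k \<in> B k \<and> poly f (l k) = 0"
    using B_eq[OF assms] l_zero[OF assms] by simp
qed (use B_zero_unique[OF assms] in blast)

lemma the_edge:
  assumes k: "k < q"
  shows "(THE x. x \<in> frontier (B k) \<and> poly f x = 4 * (-1) ^ (2 * N - k)) = v k"
    "(THE x. x \<in> frontier (B k) \<and> poly f x = - 4 * (-1) ^ (2 * N - k)) = u k"
proof -
  note ev = edge_values[OF k]
  have fr: "frontier (B k) = {u k, v k}"
    unfolding B_eq(1)[OF k] using ev(4,5) by (auto simp: frontier_def)
  show "(THE x. x \<in> frontier (B k) \<and> poly f x = 4 * (-1) ^ (2 * N - k)) = v k"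
    "(THE x. x \<in> frontier (B k) \<and> poly f x = - 4 * (-1) ^ (2 * N - k)) = u k"
    unfolding fr by (rule the_equality; use ev(1,2) in auto)+
qed

end

section \<open>Identification of the bands, edges and gaps\<close>

context hofstadter
begin

theorem band_poly: "band_poly dpoly ((q - 1) div 2)"
proof
  have q: "2 * ((q - 1) div 2) + 1 = q" using odd_q by (elim oddE) simp
  show "1 \<le> (q - 1) div 2" using q_ge_3 by simp
  show "poly dpoly (- x) = - poly dpoly x" for x by (rule dpoly_uminus)
  show "1 \<le> \<bar>poly (pderiv dpoly) x\<bar>" if "\<bar>poly dpoly x\<bar> \<le> 4" for x
    using dpoly_derivative_bound[OF that] q_ge_3 by linarith
  show "\<bar>x\<bar> \<le> 4" if "\<bar>poly dpoly x\<bar> \<le> 4" for x by (rule dpoly_level_le[OF that])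
  show "\<exists>e. dpoly - [:c:] = (\<Prod>i<2 * ((q - 1) div 2) + 1. [:- e i, 1:])" if "\<bar>c\<bar> \<le> 4" for c
    unfolding q using dpoly_factor[OF that] by blast
qed

context
  fixes N j :: nat
  assumes N: "N = (q - 1) div 2" and j: "j \<le> N"
begin

interpretation bp: band_poly dpoly N
  unfolding N by (rule band_poly)

lemma q_N: "bp.q = q" "q = 2 * N + 1"
proof -
  show "q = 2 * N + 1" unfolding N using odd_q by (elim oddE) simp
  then show "bp.q = q" by (simp add: bp.q_def)
qed

lemma k_less: "N + j < bp.q" using j by (simp add: q_N)

lemma band_eq: "band p q (int j) = bp.B (N + j)"
proof -
  have S: "spec_union (real p / real q) = bp.S"
    by (simp add: spec_union_eq bp.S_def)
  show ?thesis
    unfolding band_def S Let_def N[symmetric] using bp.the_band[OF k_less] by (simp only: of_nat_add add.commute)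
qed

lemma band_zero_eq: "band_zero p q (int j) = bp.l (N + j)"
  unfolding band_zero_def band_eq discriminant_eq using bp.the_band_zero[OF k_less] by simp

text \<open>As \<open>q = 2N + 1\<close>, the residue of \<open>q\<close> modulo \<open>4\<close> is
  the parity of \<open>N\<close>.\<close>

lemma sign_eq: "(if q mod 4 = 3 then 4 else -4) = (- 4 :: real) * (-1) ^ N"
proof -
  have "q mod 4 = 3 \<longleftrightarrow> odd N"
    unfolding q_N(2) by presburger
  then show ?thesis by simp
qed

lemma sign_eq': "(if q mod 4 = 3 then - 4 else 4) = (4 :: real) * (-1) ^ N"
  using sign_eq by (simp split: if_splits)

lemma power_N: "(-1 :: real) ^ (2 * N - (N + j)) = (-1) ^ N * (-1) ^ j"
proof -
  have "(-1 :: real) ^ j * (-1) ^ j = 1" by (simp flip: power_add power_mult_distrib)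
  then have "(-1 :: real) ^ (N - j) = (-1) ^ (N - j) * ((-1) ^ j * (-1) ^ j)" by (simp only: mult_1_right)
  also have "\<dots> = (-1) ^ (N - j + j) * (-1) ^ j" by (simp only: power_add mult.assoc)
  finally show ?thesis using j by simp
qed

text \<open>The level defining this edge is the same for all \<open>j\<close>, whereas the value of
  \<open>f\<close> at \<open>v (N + j)\<close> alternates with \<open>j\<close>; so the edge changes
  sides with the parity of \<open>j\<close>. The discriminant being \<open>- f\<close> accounts for
  the remaining sign.\<close>

lemma band_mu_eq: "band_mu p q (int j) = (if even j then bp.v (N + j) else bp.u (N + j))"
proof -
  have "- x = - 4 * (-1) ^ N \<longleftrightarrow> x = (if even j then 4 else - 4) * (-1) ^ (2 * N - (N + j))" for x :: real
    unfolding power_N by auto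
  then show ?thesis
    unfolding band_mu_def band_eq discriminant_eq sign_eq using bp.the_edge[OF k_less] by simp
qed

lemma band_eta_eq: "band_eta p q (int j) = (if even j then bp.u (N + j) else bp.v (N + j))"
proof -
  have "- x = 4 * (-1) ^ N \<longleftrightarrow> x = (if even j then - 4 else 4) * (-1) ^ (2 * N - (N + j))" for x :: real
    unfolding power_N by auto
  then show ?thesis
    unfolding band_eta_def band_eq discriminant_eq sign_eq' using bp.the_edge[OF k_less] by simp
qed

lemma band_w_eq: "band_w p q (int j) = bp.v (N + j) - bp.l (N + j)"
  unfolding band_w_def band_mu_eq band_eta_eq band_zero_eq by simp

end

lemma gap_length_eq:
  assumes "j < (q - 1) div 2"
  shows "gap_length p q (int j) =
    band_poly.u dpoly ((q - 1) div 2 + j + 1) - band_poly.v dpoly ((q - 1) div 2 + j)"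
proof -
  have j: "int j + 1 = int (j + 1)" by simp
  show ?thesis unfolding gap_length_def j
    using band_mu_eq[OF refl, of j] band_mu_eq[OF refl, of "j + 1"]
      band_eta_eq[OF refl, of j] band_eta_eq[OF refl, of "j + 1"] assms by (simp add: add.assoc)
qed

end

theorem lemma1:
  fixes p q :: nat
  assumes "q \<ge> 3" and "odd q" and "0 < p" and "p < q" and "coprime p q"
  shows "gap_length p q 0 > (band_w p q 0 / 4)\<^sup>2 \<and>
    (\<forall>j::nat. 1 \<le> j \<and> j < (q - 1) div 2 \<longrightarrow>
       gap_length p q (int j) > (band_w p q (int j))\<^sup>2 / (4 * C0 ^ (2 * (j + 1)))) \<and>
    (\<forall>j::nat. 1 \<le> j \<and> j < (q - 1) div 2 \<longrightarrow>
       gap_length p q (int j) > (band_w p q 0 / 8) ^ (2 * j))"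
proof -
  interpret hofstadter p q by unfold_locales (use assms in auto)
  define N where "N = (q - 1) div 2"
  interpret bp: band_poly dpoly N unfolding N_def by (rule band_poly)
  have w0: "band_w p q 0 = bp.v N"
    using band_w_eq[OF N_def, of 0] by (simp add: bp.l_N)
  have gap: "gap_length p q (int j) = bp.u (N + j + 1) - bp.v (N + j)" if "j < N" for j
    using gap_length_eq[of j] that by (simp add: N_def)
  have w: "band_w p q (int j) = bp.v (N + j) - bp.l (N + j)" if "j < N" for j
    using band_w_eq[OF N_def, of j] that by simp
  have "gap_length p q 0 > (band_w p q 0 / 4)\<^sup>2"
    using gap[of 0] bp.gap_0 bp.N_pos by (simp add: w0)
  moreover have "gap_length p q (int j) > (band_w p q (int j))\<^sup>2 / (4 * C0 ^ (2 * (j + 1)))" if "j < N" for j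
    using bp.gap_band_part[OF that] unfolding gap[OF that] w[OF that] C0_def .
  moreover have "gap_length p q (int j) > (band_w p q 0 / 8) ^ (2 * j)" if "1 \<le> j" "j < N" for j
    using bp.gap_central_band[OF that] unfolding gap[OF that(2)] w0 .
  ultimately show ?thesis by (simp add: N_def)
qed

end
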